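(* Let $\Gamma$ be a finite, simple, connected, undirected $2$-distance-transitive graph of valency $k\le 8$, and suppose that $\Gamma$ is locally-primitive. Then $\Gamma$ is either $2$-arc-transitive or isomorphic to the icosahedron.
   Context: $\Gamma$ is $2$-distance-transitive if its diameter is at least $2$, $\mathrm{Aut}(\Gamma)$ is vertex-transitive, and for each vertex $u$ the stabilizer $\mathrm{Aut}(\Gamma)_u$ is transitive on $\Gamma(u)$ and on the set $\Gamma_2(u)$ of vertices at distance $2$ from $u$. $\Gamma$ is locally-primitive if for each vertex $u$, $\mathrm{Aut}(\Gamma)_u$ acts primitively on $\Gamma(u)$. $\Gamma$ is $2$-arc-transitive if $\mathrm{Aut}(\Gamma)$ is transitive on vertices and on $2$-arcs (sequences $(u_0,u_1,u_2)$ with $u_0\sim u_1\sim u_2$, $u_0\ne u_2$). *)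

theory Defs
  imports Main
begin

text \<open>A graph is given by a vertex set V and an adjacency predicate E.\<close>

definition simple_graph :: "'a set \<Rightarrow> ('a \<Rightarrow> 'a \<Rightarrow> bool) \<Rightarrow> bool" where
  "simple_graph V E \<longleftrightarrow>
     (\<forall>x y. E x y \<longrightarrow> x \<in> V \<and> y \<in> V) \<and>
     (\<forall>x y. E x y \<longrightarrow> E y x) \<and> (\<forall>x. \<not> E x x)"

definition edge_rel :: "'a set \<Rightarrow> ('a \<Rightarrow> 'a \<Rightarrow> bool) \<Rightarrow> ('a \<times> 'a) set" where
  "edge_rel V E = {(x, y). x \<in> V \<and> y \<in> V \<and> E x y}"

definition connected_graph :: "'a set \<Rightarrow> ('a \<Rightarrow> 'a \<Rightarrow> bool) \<Rightarrow> bool" where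
  "connected_graph V E \<longleftrightarrow> V \<noteq> {} \<and> (\<forall>u\<in>V. \<forall>v\<in>V. (u, v) \<in> (edge_rel V E)\<^sup>*)"

text \<open>Neighbourhood \<Gamma>(u).\<close>
definition nbhd :: "'a set \<Rightarrow> ('a \<Rightarrow> 'a \<Rightarrow> bool) \<Rightarrow> 'a \<Rightarrow> 'a set" where
  "nbhd V E u = {v \<in> V. E u v}"

definition regular_of_valency :: "'a set \<Rightarrow> ('a \<Rightarrow> 'a \<Rightarrow> bool) \<Rightarrow> nat \<Rightarrow> bool" where
  "regular_of_valency V E k \<longleftrightarrow> (\<forall>v\<in>V. card (nbhd V E v) = k)"

text \<open>Graph distance: length of a shortest walk (for connected graphs).\<close>
definition gdist :: "'a set \<Rightarrow> ('a \<Rightarrow> 'a \<Rightarrow> bool) \<Rightarrow> 'a \<Rightarrow> 'a \<Rightarrow> nat" where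
  "gdist V E u v = (LEAST n. (u, v) \<in> (edge_rel V E) ^^ n)"

text \<open>\<Gamma>_i(u): vertices at distance exactly i from u.\<close>
definition sphere :: "'a set \<Rightarrow> ('a \<Rightarrow> 'a \<Rightarrow> bool) \<Rightarrow> nat \<Rightarrow> 'a \<Rightarrow> 'a set" where
  "sphere V E i u = {v \<in> V. (u, v) \<in> (edge_rel V E)\<^sup>* \<and> gdist V E u v = i}"

definition diameter_ge_2 :: "'a set \<Rightarrow> ('a \<Rightarrow> 'a \<Rightarrow> bool) \<Rightarrow> bool" where
  "diameter_ge_2 V E \<longleftrightarrow> (\<exists>u\<in>V. \<exists>v\<in>V. (u, v) \<in> (edge_rel V E)\<^sup>* \<and> gdist V E u v \<ge> 2)"

text \<open>The automorphism group Aut(\<Gamma>), as a set of permutations of V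
  (extended by the identity outside V).\<close>
definition Aut :: "'a set \<Rightarrow> ('a \<Rightarrow> 'a \<Rightarrow> bool) \<Rightarrow> ('a \<Rightarrow> 'a) set" where
  "Aut V E = {f. bij_betw f V V \<and> (\<forall>x. x \<notin> V \<longrightarrow> f x = x) \<and>
                 (\<forall>x\<in>V. \<forall>y\<in>V. E x y \<longleftrightarrow> E (f x) (f y))}"

definition stabilizer :: "('a \<Rightarrow> 'a) set \<Rightarrow> 'a \<Rightarrow> ('a \<Rightarrow> 'a) set" where
  "stabilizer G u = {g \<in> G. g u = u}"

definition transitive_on :: "('a \<Rightarrow> 'a) set \<Rightarrow> 'a set \<Rightarrow> bool" where
  "transitive_on G \<Omega> \<longleftrightarrow> (\<forall>x\<in>\<Omega>. \<forall>y\<in>\<Omega>. \<exists>g\<in>G. g x = y)"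

text \<open>Blocks of imprimitivity and primitive actions (G acting on \<Omega> by application,
  each g permuting \<Omega>).\<close>
definition is_block :: "('a \<Rightarrow> 'a) set \<Rightarrow> 'a set \<Rightarrow> 'a set \<Rightarrow> bool" where
  "is_block G \<Omega> B \<longleftrightarrow> B \<subseteq> \<Omega> \<and> (\<forall>g\<in>G. g ` B = B \<or> g ` B \<inter> B = {})"

definition primitive_on :: "('a \<Rightarrow> 'a) set \<Rightarrow> 'a set \<Rightarrow> bool" where
  "primitive_on G \<Omega> \<longleftrightarrow> \<Omega> \<noteq> {} \<and> transitive_on G \<Omega> \<and>
     (\<forall>B. is_block G \<Omega> B \<longrightarrow> card B \<le> 1 \<or> B = \<Omega>)"

definition two_distance_transitive :: "'a set \<Rightarrow> ('a \<Rightarrow> 'a \<Rightarrow> bool) \<Rightarrow> bool" where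
  "two_distance_transitive V E \<longleftrightarrow> diameter_ge_2 V E \<and> transitive_on (Aut V E) V \<and>
     (\<forall>u\<in>V. transitive_on (stabilizer (Aut V E) u) (nbhd V E u) \<and>
             transitive_on (stabilizer (Aut V E) u) (sphere V E 2 u))"

definition locally_primitive :: "'a set \<Rightarrow> ('a \<Rightarrow> 'a \<Rightarrow> bool) \<Rightarrow> bool" where
  "locally_primitive V E \<longleftrightarrow> (\<forall>u\<in>V. primitive_on (stabilizer (Aut V E) u) (nbhd V E u))"

definition two_arcs :: "'a set \<Rightarrow> ('a \<Rightarrow> 'a \<Rightarrow> bool) \<Rightarrow> ('a \<times> 'a \<times> 'a) set" where
  "two_arcs V E = {(u0, u1, u2). u0 \<in> V \<and> u1 \<in> V \<and> u2 \<in> V \<and> E u0 u1 \<and> E u1 u2 \<and> u0 \<noteq> u2}"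

definition two_arc_transitive :: "'a set \<Rightarrow> ('a \<Rightarrow> 'a \<Rightarrow> bool) \<Rightarrow> bool" where
  "two_arc_transitive V E \<longleftrightarrow> transitive_on (Aut V E) V \<and>
     (\<forall>(a, b, c)\<in>two_arcs V E. \<forall>(a', b', c')\<in>two_arcs V E.
        \<exists>g\<in>Aut V E. g a = a' \<and> g b = b' \<and> g c = c')"

text \<open>The icosahedron on vertices {0..<12}: apex 0, upper pentagon 1..5,
  lower pentagon 6..10, apex 11; upper vertex 1+i is adjacent to lower
  vertices 6+i and 6+((i+1) mod 5).\<close>
definition ico_edges :: "(nat \<times> nat) set" where
  "ico_edges = (\<Union>i\<in>{0..<5::nat}.
      {(0, 1+i), (11, 6+i), (1+i, 1 + (i+1) mod 5), (6+i, 6 + (i+1) mod 5),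
       (1+i, 6+i), (1+i, 6 + (i+1) mod 5)})"

definition ico_adj :: "nat \<Rightarrow> nat \<Rightarrow> bool" where
  "ico_adj x y \<longleftrightarrow> (x, y) \<in> ico_edges \<or> (y, x) \<in> ico_edges"

definition graph_iso :: "'a set \<Rightarrow> ('a \<Rightarrow> 'a \<Rightarrow> bool) \<Rightarrow> 'b set \<Rightarrow> ('b \<Rightarrow> 'b \<Rightarrow> bool) \<Rightarrow> bool" where
  "graph_iso V E W F \<longleftrightarrow> (\<exists>f. bij_betw f V W \<and> (\<forall>x\<in>V. \<forall>y\<in>V. E x y \<longleftrightarrow> F (f x) (f y)))"

definition isomorphic_to_icosahedron :: "'a set \<Rightarrow> ('a \<Rightarrow> 'a \<Rightarrow> bool) \<Rightarrow> bool" where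
  "isomorphic_to_icosahedron V E \<longleftrightarrow> graph_iso V E {0..<12::nat} ico_adj"

end

theory Submission
  imports Defs
begin

text \<open>
Let \<open>a\<^sub>1\<close> and \<open>c\<^sub>2\<close> be the numbers of common neighbours of two vertices at distance 1 and 2, and
suppose the graph is not 2-arc-transitive. Every orbit of 2-arcs \<open>(u, x, w)\<close> with \<open>u, w\<close> at distance 2
has the same number of middle vertices over each such pair, which ties the lengths of the suborbits
on a neighbourhood to \<open>c\<^sub>2\<close>.

If \<open>a\<^sub>1 > 0\<close>, an invariant relation of small valency on a neighbourhood must be a single cycle of odd
length, so neighbourhoods are pentagons, heptagons or complements of heptagons; counting common
neighbours kills the heptagons, and the pentagons give the icosahedron.

If \<open>a\<^sub>1 = 0\<close>, the count leaves only \<open>c\<^sub>2 = k - 1\<close> (the complete bipartite graph minus a perfect matching,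
which is 2-arc-transitive) and \<open>k = 7\<close>, \<open>c\<^sub>2 = 2\<close> with a vertex stabilizer preserving the quadratic residue
tournament on each neighbourhood. Here every 2-arc lies in a unique quadrangle, so labellings of
neighbourhoods can be transported along edges. An involution reversing an edge encodes the transport
in a permutation \<open>g\<close> of the integers mod 7, for which there are 16 possibilities. For eight of them quadrangles close up to cubes,
so the graph is the 7-cube or its antipodal quotient; for two of them some vertex would have 14
neighbours; for the other six, \<open>g i = c / i\<close>, and coset enumeration bounds the graph so tightly
that reversing the tournament extends to an automorphism. All cases are contradictory.
\<close>

section \<open>Invariant relations and counting\<close>

text \<open>Local primitivity enters only as the statement that an invariant equivalence relation on
  a neighbourhood is trivial or universal. For this reason relations on neighbourhoods are carried
  as ternary predicates with the middle vertex as first argument. The tournament comes from an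
  orientation argument. If every orbit of 2-arcs has exactly one middle vertex over each pair at
  distance 2, and there are at least two middle vertices, then not all 2-arcs can be reversible. In
  valency 7 the stabilizer of a vertex acts on the labels of its neighbours by maps
  \<open>i -> s i + r\<close> with \<open>s\<close> in {1, 2, 4}, and an automorphism fixing a
  vertex and all its neighbours is trivial. Everything is therefore governed by one rotation
  \<open>a\<close> at \<open>u\<close> and one involution \<open>h\<close> reversing the edge from
  \<open>u\<close> to \<open>l 0\<close>. Conjugation by \<open>h\<close> preserves the stabilizer
  of that edge's ends, which acts by multiplying labels by 1, 2 or 4; it therefore turns doubling
  into multiplication by 2 or by 4. The first leaves 4 involutions \<open>g\<close>, the second 12,
  hence the 16 possibilities.\<close>

lemma card_eq_double_count:
  assumes "finite A" "finite B"
    and "\<And>x. x \<in> A \<Longrightarrow> card {y \<in> B. r x y} = m"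
    and "\<And>y. y \<in> B \<Longrightarrow> card {x \<in> A. r x y} = n"
  shows "card A * m = card B * n"
proof -
  have "card (SIGMA x:A. {y \<in> B. r x y}) = card A * m"
    using assms by (simp add: card_SigmaI)
  moreover have "card (SIGMA y:B. {x \<in> A. r x y}) = card B * n"
    using assms by (simp add: card_SigmaI)
  moreover have "(SIGMA y:B. {x \<in> A. r x y}) = prod.swap ` (SIGMA x:A. {y \<in> B. r x y})"
    by force
  moreover have "card (prod.swap ` (SIGMA x:A. {y \<in> B. r x y})) = card (SIGMA x:A. {y \<in> B. r x y})"
    by (rule card_image) simp
  ultimately show ?thesis by simp
qed

section \<open>Automorphisms, pairs at distance 2 and transitivity\<close>

locale dt_graph =
  fixes V :: "'a set" and E :: "'a \<Rightarrow> 'a \<Rightarrow> bool" and k :: nat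
  assumes fin: "finite V"
    and simple: "simple_graph V E"
    and conn: "connected_graph V E"
    and reg: "regular_of_valency V E k"
    and dt: "two_distance_transitive V E"
    and lp: "locally_primitive V E"
begin

definition N :: "'a \<Rightarrow> 'a set" where "N u = {v. E u v}"
definition G :: "('a \<Rightarrow> 'a) set" where "G = Aut V E"
definition D :: "'a \<Rightarrow> 'a \<Rightarrow> bool" where
  "D u w \<longleftrightarrow> u \<noteq> w \<and> \<not> E u w \<and> (\<exists>v. E u v \<and> E v w)"

lemma E_V: assumes "E x y" shows "x \<in> V" "y \<in> V"
  using simple assms unfolding simple_graph_def by blast+

lemma E_sym: "E x y \<Longrightarrow> E y x"
  using simple unfolding simple_graph_def by blast

lemma E_commute: "E x y \<longleftrightarrow> E y x"
  using E_sym by blast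

lemma E_irrefl [simp]: "\<not> E x x"
  using simple unfolding simple_graph_def by blast

lemma E_neq: "E x y \<Longrightarrow> x \<noteq> y"
  by auto

lemma in_N [simp]: "v \<in> N u \<longleftrightarrow> E u v"
  by (simp add: N_def)

lemma nbhd_eq: "nbhd V E u = N u"
  using E_V by (auto simp: nbhd_def)

lemma N_subset: "N u \<subseteq> V"
  using E_V by auto

lemma fin_N [simp]: "finite (N u)"
  using N_subset fin finite_subset by blast

lemma card_N: "u \<in> V \<Longrightarrow> card (N u) = k"
  using reg nbhd_eq by (simp add: regular_of_valency_def)

lemma V_nonempty: "V \<noteq> {}"
  using conn by (simp add: connected_graph_def)

lemma D_sym: "D u w \<Longrightarrow> D w u"
  unfolding D_def using E_sym by blast

lemma D_V: assumes "D u w" shows "u \<in> V" "w \<in> V"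
  using assms E_V unfolding D_def by blast+

lemma fin_sub [simp]: "finite {y. E v y \<and> P y}" "finite {y. P y \<and> E v y}"
  by (rule finite_subset[OF _ fin_N[of v]]; auto)+

lemma fin_D [simp]: "finite {w. D u w}"
  by (rule finite_subset[OF _ fin]) (auto dest: D_V)

lemma G_inj [simp]: "g \<in> G \<Longrightarrow> g x = g y \<longleftrightarrow> x = y"
proof
  assume g: "g \<in> G" and eq: "g x = g y"
  have b: "bij_betw g V V" and out: "\<And>x. x \<notin> V \<Longrightarrow> g x = x"
    using g by (auto simp: G_def Aut_def)
  show "x = y"
    using eq out b bij_betwE[OF b] by (metis bij_betw_inv_into_left)
qed simp

lemma G_V [simp]: "g \<in> G \<Longrightarrow> g x \<in> V \<longleftrightarrow> x \<in> V"
  unfolding G_def Aut_def using bij_betwE by fastforce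

lemma G_E [simp]: "g \<in> G \<Longrightarrow> E (g x) (g y) \<longleftrightarrow> E x y"
proof (cases "x \<in> V \<and> y \<in> V")
  case True
  assume "g \<in> G"
  then show ?thesis using True unfolding G_def Aut_def by blast
next
  case False
  assume "g \<in> G"
  then show ?thesis using False E_V by (metis G_V)
qed

lemma bij_betw_imp_bij:
  assumes "bij_betw g V V" "\<And>x. x \<notin> V \<Longrightarrow> g x = x"
  shows "bij g"
proof -
  have "bij_betw g (- V) (- V)"
    using assms(2) by (auto simp: bij_betw_def inj_on_def image_iff)
  then have "bij_betw g (V \<union> - V) (V \<union> - V)"
    using assms(1) by (intro bij_betw_combine) auto
  then show ?thesis by simp
qed

lemma G_bij: "g \<in> G \<Longrightarrow> bij g"
  by (rule bij_betw_imp_bij) (auto simp: G_def Aut_def)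

text \<open>Preserving adjacency in one direction suffices by finiteness: the map injects the finite
  set of arcs into itself, hence onto itself. Every automorphism built by hand below is certified
  this way.\<close>

lemma G_I:
  assumes "bij g" "\<And>x. x \<notin> V \<Longrightarrow> g x = x" "\<And>x y. E x y \<Longrightarrow> E (g x) (g y)"
  shows "g \<in> G"
proof -
  have gV: "x \<in> V" if "g x \<in> V" for x
    using assms(2)[of x] that by (cases "x \<in> V") auto
  have inj: "inj g" using assms(1) bij_is_inj by blast
  have sub: "V \<subseteq> g ` V"
  proof
    fix y assume "y \<in> V"
    moreover obtain x where "y = g x" using assms(1) by (metis bij_pointE)
    ultimately show "y \<in> g ` V" using gV by blast
  qed
  have "card (g ` V) = card V" using inj by (simp add: card_image inj_on_def)
  then have eq: "g ` V = V"
    using sub fin by (metis card_subset_eq finite_imageI)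
  have bb: "bij_betw g V V" using eq inj by (auto simp: bij_betw_def inj_on_def)
  let ?S = "{(x, y). E x y}"
  have finS: "finite ?S"
    by (rule finite_subset[of _ "V \<times> V"]) (use E_V fin in auto)
  have "map_prod g g ` ?S \<subseteq> ?S" using assms(3) by auto
  moreover have "inj (map_prod g g)" using inj by (simp add: prod.inj_map)
  ultimately have eqS: "map_prod g g ` ?S = ?S"
    using finS by (metis endo_inj_surj inj_on_subset subset_UNIV)
  have "E x y" if "E (g x) (g y)" for x y
  proof -
    have "(g x, g y) \<in> map_prod g g ` ?S" using that eqS by simp
    then obtain a b where "g x = g a" "g y = g b" "E a b" by auto
    then show ?thesis using inj by (metis injD)
  qed
  then have "\<forall>x\<in>V. \<forall>y\<in>V. E x y = E (g x) (g y)" using assms(3) by blast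
  then show ?thesis using bb assms(2) unfolding G_def Aut_def by blast
qed

lemma G_id [simp]: "id \<in> G" "(\<lambda>x. x) \<in> G"
  by (rule G_I; auto simp: bij_def)+

lemma G_out: "g \<in> G \<Longrightarrow> x \<notin> V \<Longrightarrow> g x = x"
  by (auto simp: G_def Aut_def)

lemma G_comp: "g \<in> G \<Longrightarrow> f \<in> G \<Longrightarrow> g \<circ> f \<in> G"
  by (rule G_I) (auto simp: G_bij bij_comp G_out)

lemma G_inv_apply [simp]: "g \<in> G \<Longrightarrow> g (inv g x) = x" "g \<in> G \<Longrightarrow> inv g (g x) = x"
  using G_bij bij_is_surj surj_f_inv_f bij_is_inj inv_f_f by metis+

lemma G_inv: assumes "g \<in> G" shows "inv g \<in> G"
proof (rule G_I)
  show "bij (inv g)" using assms G_bij bij_imp_bij_inv by blast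
  show "inv g x = x" if "x \<notin> V" for x
    using assms that by (metis G_out G_inv_apply(2))
  show "E (inv g x) (inv g y)" if "E x y" for x y
    using assms that by (metis G_E G_inv_apply(1))
qed

lemma G_D [simp]: "g \<in> G \<Longrightarrow> D (g x) (g y) \<longleftrightarrow> D x y"
proof -
  have *: "D (g x) (g y)" if "g \<in> G" "D x y" for g x y
    using that unfolding D_def by (metis G_E G_inj)
  assume "g \<in> G"
  then show ?thesis using * by (metis G_inv G_inv_apply(2))
qed

lemma vt: "x \<in> V \<Longrightarrow> y \<in> V \<Longrightarrow> \<exists>g\<in>G. g x = y"
  using dt unfolding two_distance_transitive_def transitive_on_def G_def by blast

lemma nt: assumes "E u x" "E u y" shows "\<exists>g\<in>G. g u = u \<and> g x = y"
proof -
  have "transitive_on (stabilizer (Aut V E) u) (nbhd V E u)"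
    using dt E_V[OF assms(1)] unfolding two_distance_transitive_def by blast
  then show ?thesis using assms unfolding transitive_on_def stabilizer_def nbhd_eq G_def by (auto simp: Bex_def)
qed

lemma arc_trans: assumes "E u x" "E v y" shows "\<exists>g\<in>G. g u = v \<and> g x = y"
proof -
  obtain g where g: "g \<in> G" "g u = v" using vt E_V assms by blast
  have "E v (g x)" using g assms by (metis G_E)
  then obtain f where f: "f \<in> G" "f v = v" "f (g x) = y" using nt assms by blast
  show ?thesis using g f G_comp[OF f(1) g(1)] by (intro bexI[of _ "f \<circ> g"]) auto
qed

lemma edge_rel_eq: "edge_rel V E = {(x, y). E x y}"
  using E_V by (auto simp: edge_rel_def)

lemma connected: "u \<in> V \<Longrightarrow> v \<in> V \<Longrightarrow> (u, v) \<in> {(x, y). E x y}\<^sup>*"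
  using conn by (simp add: connected_graph_def edge_rel_eq)

lemma conn_induct:
  assumes "u \<in> V" "P u" "\<And>x y. P x \<Longrightarrow> E x y \<Longrightarrow> P y" "v \<in> V"
  shows "P v"
  using connected[OF assms(1,4)] by (induction rule: rtrancl_induct) (use assms in auto)

lemma sphere2: assumes "u \<in> V" shows "sphere V E 2 u = {w. D u w}"
proof -
  let ?R = "{(x, y). E x y}"
  have g: "gdist V E u w = (LEAST n. (u, w) \<in> ?R ^^ n)" for w
    by (simp add: gdist_def edge_rel_eq)
  have e2: "(u, w) \<in> ?R ^^ 2 \<longleftrightarrow> (\<exists>v. E u v \<and> E v w)" for w
    by (auto simp: numeral_2_eq_2)
  have "gdist V E u w = 2 \<longleftrightarrow> D u w" if w: "w \<in> V" for w
  proof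
    assume l: "gdist V E u w = 2"
    obtain n where "(u, w) \<in> ?R ^^ n"
      using connected[OF assms w] rtrancl_imp_relpow by blast
    then have "(u, w) \<in> ?R ^^ 2" using l g by (metis LeastI)
    moreover have "(u, w) \<notin> ?R ^^ 0" "(u, w) \<notin> ?R ^^ 1"
      using l g by (metis not_less_Least zero_less_numeral, metis not_less_Least one_less_numeral_iff semiring_norm(76))
    ultimately show "D u w" using e2 by (auto simp: D_def)
  next
    assume d: "D u w"
    show "gdist V E u w = 2" unfolding g
    proof (rule Least_equality)
      show "(u, w) \<in> ?R ^^ 2" using d e2 by (auto simp: D_def)
      fix n assume n: "(u, w) \<in> ?R ^^ n"
      have "n \<noteq> 0" using n d by (intro notI) (simp add: D_def)
      moreover have "n \<noteq> 1" using n d by (intro notI) (simp add: D_def)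
      ultimately show "2 \<le> n" by simp
    qed
  qed
  then show ?thesis
    using connected[OF assms] D_V unfolding sphere_def edge_rel_eq by blast
qed

lemma d2t: assumes "D u w" "D v x" shows "\<exists>g\<in>G. g u = v \<and> g w = x"
proof -
  obtain g where g: "g \<in> G" "g u = v" using vt D_V assms by blast
  have d: "D v (g w)" using g assms by (metis G_D)
  have "transitive_on (stabilizer (Aut V E) v) (sphere V E 2 v)"
    using dt D_V[OF d] unfolding two_distance_transitive_def by blast
  then obtain f where f: "f \<in> G" "f v = v" "f (g w) = x"
    using assms d D_V[OF d] unfolding sphere2[OF D_V(1)[OF d]] transitive_on_def stabilizer_def G_def by auto
  show ?thesis using g f G_comp[OF f(1) g(1)] by (intro bexI[of _ "f \<circ> g"]) auto
qed

lemma D_ex: "u \<in> V \<Longrightarrow> \<exists>w. D u w"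
proof -
  obtain x y where xy: "x \<in> V" "y \<in> V" "gdist V E x y \<ge> 2"
    using dt unfolding two_distance_transitive_def diameter_ge_2_def by blast
  have "\<exists>a b. D a b"
  proof (rule ccontr)
    assume no: "\<not> ?thesis"
    have "y = x \<or> E x y"
    proof (rule conn_induct[of x "\<lambda>z. z = x \<or> E x z" y])
      show "b = x \<or> E x b" if "a = x \<or> E x a" "E a b" for a b
      proof -
        have "\<not> D x b" using no by blast
        then show ?thesis unfolding D_def using that(1)[THEN disjE] that(2) by metis
      qed
    qed (use xy in auto)
    then have "\<exists>n\<le>1. (x, y) \<in> edge_rel V E ^^ n"
      unfolding edge_rel_eq by (auto intro: exI[of _ 0] exI[of _ 1])
    then have "gdist V E x y \<le> 1" unfolding gdist_def by (meson Least_le order_trans)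
    then show False using xy by simp
  qed
  then obtain a b where ab: "D a b" by blast
  assume "u \<in> V"
  then obtain g where "g \<in> G" "g a = u" using vt D_V(1)[OF ab] by blast
  then show ?thesis using ab by (metis G_D)
qed

section \<open>Invariant relations on neighbourhoods, and primitivity\<close>

definition inv3 :: "('a \<Rightarrow> 'a \<Rightarrow> 'a \<Rightarrow> bool) \<Rightarrow> bool" where
  "inv3 R \<longleftrightarrow> (\<forall>g\<in>G. \<forall>v x y. R v x y \<longrightarrow> R (g v) (g x) (g y)) \<and>
     (\<forall>v x y. R v x y \<longrightarrow> E v x \<and> E v y)"

lemma inv3_iff: assumes "inv3 R" "g \<in> G" shows "R (g v) (g x) (g y) \<longleftrightarrow> R v x y"
proof
  assume "R (g v) (g x) (g y)"
  then have "R (inv g (g v)) (inv g (g x)) (inv g (g y))"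
    using assms G_inv[OF assms(2)] unfolding inv3_def by blast
  then show "R v x y" using assms by simp
qed (use assms in \<open>auto simp: inv3_def\<close>)

lemma inv3_E: assumes "inv3 R" "R v x y" shows "E v x" "E v y"
  using assms unfolding inv3_def by blast+

lemma card_image_G: "g \<in> G \<Longrightarrow> card (g ` A) = card A"
  by (rule card_image) (simp add: inj_on_def)

lemma G_image_Collect: "g \<in> G \<Longrightarrow> (\<And>y. P (g y) \<longleftrightarrow> Q y) \<Longrightarrow> {y. P y} = g ` {y. Q y}"
  by (auto simp: image_iff) (metis G_inv_apply(1))

lemma card_Collect_G:
  assumes "g \<in> G" "\<And>y. P (g y) \<longleftrightarrow> Q y"
  shows "card {y. P y} = card {y. Q y}"
proof -
  have "{y. P y} = g ` {y. Q y}" using assms by (rule G_image_Collect)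
  then show ?thesis by (simp add: card_image_G assms(1))
qed

lemma inv3_val:
  assumes R: "inv3 R" and "E u x" "E v y"
  shows "card {z. R u x z} = card {z. R v y z}"
proof -
  obtain g where g: "g \<in> G" "g v = u" "g y = x" using arc_trans[OF assms(3,2)] by blast
  show ?thesis
    by (rule card_Collect_G[OF g(1)]) (simp flip: g(2,3) add: inv3_iff[OF R g(1)])
qed

lemma inv3_fin [simp]: "inv3 R \<Longrightarrow> finite {z. R u x z}" "inv3 R \<Longrightarrow> finite {z. R u z x}"
  by (rule finite_subset[OF _ fin_N[of u]]; auto dest: inv3_E)+

text \<open>The class of \<open>x\<close> is a block with at least the two elements \<open>x\<close>
  and \<open>y\<close>, so primitivity makes it the whole neighbourhood.\<close>

lemma block_dichotomy:
  assumes S: "inv3 S" and v: "v \<in> V"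
    and refl: "\<And>x. E v x \<Longrightarrow> S v x x"
    and sym: "\<And>x y. S v x y \<Longrightarrow> S v y x"
    and trans: "\<And>x y z. S v x y \<Longrightarrow> S v y z \<Longrightarrow> S v x z"
    and xy: "S v x y" "x \<noteq> y" and ab: "E v a" "E v b"
  shows "S v a b"
proof -
  let ?H = "stabilizer (Aut V E) v"
  let ?B = "{z. S v x z}"
  have "is_block ?H (nbhd V E v) ?B" unfolding is_block_def nbhd_eq
  proof (intro conjI ballI)
    show "?B \<subseteq> N v" using inv3_E[OF S] by auto
    fix g assume "g \<in> ?H"
    then have g: "g \<in> G" "g v = v" by (auto simp: stabilizer_def G_def)
    have im: "S v (g x) (g z)" if "S v x z" for z using inv3_iff[OF S g(1), of v x z] g that by simp
    have im2: "{z. S v (g x) z} = g ` ?B"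
      by (rule G_image_Collect[OF g(1)]) (use inv3_iff[OF S g(1), of v x] g in simp)
    show "g ` ?B = ?B \<or> g ` ?B \<inter> ?B = {}"
    proof (cases "S v x (g x)")
      case True
      then have "{z. S v (g x) z} = ?B" using sym trans by blast
      then show ?thesis using im2 by simp
    next
      case False
      then have "{z. S v (g x) z} \<inter> ?B = {}" using sym trans by blast
      then show ?thesis using im2 by simp
    qed
  qed
  moreover have "primitive_on ?H (nbhd V E v)"
    using lp v unfolding locally_primitive_def by blast
  ultimately have "card ?B \<le> 1 \<or> ?B = N v" unfolding primitive_on_def nbhd_eq by blast
  moreover have "S v x x" using refl inv3_E[OF S xy(1)] by blast
  then have "{x, y} \<subseteq> ?B" using xy by auto
  then have "card ?B \<ge> 2" using xy card_mono[OF inv3_fin(1)[OF S], of "{x,y}" v x] by simp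
  ultimately have "?B = N v" by linarith
  then show ?thesis using ab sym trans by (metis in_N mem_Collect_eq)
qed

section \<open>The constants of the graph and the count of 2-arc orbits\<close>

definition a1 :: nat where "a1 = (THE n. \<forall>u v. E u v \<longrightarrow> card (N u \<inter> N v) = n)"
definition c2 :: nat where "c2 = (THE n. \<forall>u v. D u v \<longrightarrow> card (N u \<inter> N v) = n)"
definition k2 :: nat where "k2 = (THE n. \<forall>u\<in>V. card {w. D u w} = n)"

lemma Int_N: "N u \<inter> N v = {z. E u z \<and> E v z}"
  unfolding N_def by (rule Collect_conj_eq[symmetric])

lemma edge_ex: "u \<in> V \<Longrightarrow> \<exists>v. E u v"
proof -
  assume "u \<in> V"
  then have "\<exists>w. D u w" by (rule D_ex)
  then show ?thesis unfolding D_def by (elim exE conjE) (rule exI)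
qed

lemma card_a1: "E u v \<Longrightarrow> card (N u \<inter> N v) = a1"
proof -
  have *: "card (N u \<inter> N v) = card (N x \<inter> N y)" if e: "E u v" "E x y" for u v x y
  proof -
    obtain g where g: "g \<in> G" "g x = u" "g y = v" using arc_trans[OF e(2,1)] by blast
    show ?thesis unfolding Int_N by (rule card_Collect_G[OF g(1)]) (simp flip: g(2,3) add: g(1))
  qed
  obtain x y where xy: "E x y" using edge_ex V_nonempty by blast
  have "\<forall>u v. E u v \<longrightarrow> card (N u \<inter> N v) = a1"
    unfolding a1_def by (rule theI[of _ "card (N x \<inter> N y)"]) (use * xy in blast)+
  then show "E u v \<Longrightarrow> card (N u \<inter> N v) = a1" by blast
qed

lemma card_c2: "D u v \<Longrightarrow> card (N u \<inter> N v) = c2"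
proof -
  have *: "card (N u \<inter> N v) = card (N x \<inter> N y)" if e: "D u v" "D x y" for u v x y
  proof -
    obtain g where g: "g \<in> G" "g x = u" "g y = v" using d2t[OF e(2,1)] by blast
    show ?thesis unfolding Int_N by (rule card_Collect_G[OF g(1)]) (simp flip: g(2,3) add: g(1))
  qed
  obtain x y where xy: "D x y" using D_ex V_nonempty by blast
  have "\<forall>u v. D u v \<longrightarrow> card (N u \<inter> N v) = c2"
    unfolding c2_def by (rule theI[of _ "card (N x \<inter> N y)"]) (use * xy in blast)+
  then show "D u v \<Longrightarrow> card (N u \<inter> N v) = c2" by blast
qed

lemma card_k2: "u \<in> V \<Longrightarrow> card {w. D u w} = k2"
proof -
  have *: "card {w. D u w} = card {w. D x w}" if e: "u \<in> V" "x \<in> V" for u x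
  proof -
    obtain g where g: "g \<in> G" "g x = u" using vt[OF e(2,1)] by blast
    show ?thesis by (rule card_Collect_G[OF g(1)]) (simp flip: g(2) add: g(1))
  qed
  obtain x where x: "x \<in> V" using V_nonempty by blast
  have "\<forall>u\<in>V. card {w. D u w} = k2"
    unfolding k2_def
  proof (rule theI)
    show "\<forall>u\<in>V. card {w. D u w} = card {w. D x w}" using *[OF _ x] by blast
    show "n = card {w. D x w}" if "\<forall>u\<in>V. card {w. D u w} = n" for n using that x by simp
  qed
  then show "u \<in> V \<Longrightarrow> card {w. D u w} = k2" by blast
qed

text \<open>Both sides count the pairs \<open>(u, w)\<close> with \<open>R u y w\<close> for a fixed
  \<open>y\<close>. Transitivity on vertices at distance 2 from \<open>y\<close> makes the number of
  middle vertices \<open>u\<close> independent of \<open>w\<close>.\<close>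

lemma inv3_double_count:
  assumes R: "inv3 R" and d: "\<And>v x y. R v x y \<Longrightarrow> D x y"
    and "E v x" "D y z"
  shows "k2 * card {u. R u y z} = k * card {w. R v x w}"
proof -
  have y: "y \<in> V" using D_V assms by blast
  have eqm: "card {u. R u y w} = card {u. R u y z}" if w: "D y w" for w
  proof -
    obtain g where g: "g \<in> G" "g y = y" "g z = w" using d2t[OF assms(4) w] by blast
    show ?thesis by (rule card_Collect_G[OF g(1)]) (rule inv3_iff[OF R g(1), of _ y z, unfolded g(2,3)])
  qed
  have "card {w. D y w} * card {u. R u y z} = card (N y) * card {w. R v x w}"
  proof (rule card_eq_double_count[where r = "\<lambda>w u. R u y w"])
    fix w assume "w \<in> {w. D y w}"
    moreover have "{u \<in> N y. R u y w} = {u. R u y w}"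
      using inv3_E[OF R] E_sym by auto
    ultimately show "card {u \<in> N y. R u y w} = card {u. R u y z}" using eqm by simp
  next
    fix u assume "u \<in> N y"
    then have "E u y" using E_sym by simp
    moreover have "{w \<in> {w. D y w}. R u y w} = {w. R u y w}" using d by auto
    ultimately show "card {w \<in> {w. D y w}. R u y w} = card {w. R v x w}"
      using inv3_val[OF R _ assms(3), of u y] by simp
  qed auto
  then show ?thesis using y by (simp add: card_N card_k2)
qed

lemma k2_c2: "k2 * c2 = k * (k - 1 - a1)"
proof -
  define R where "R = (\<lambda>v x y. E v x \<and> E v y \<and> D x y)"
  have R: "inv3 R" unfolding inv3_def R_def by simp
  obtain y z where yz: "D y z" using D_ex V_nonempty by blast
  obtain v x where vx: "E v x" using edge_ex V_nonempty by blast
  have "{u. R u y z} = N y \<inter> N z" using yz E_sym unfolding R_def by auto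
  moreover have "{w. R v x w} = N v - (insert x (N v \<inter> N x))"
    using vx E_sym[OF vx] unfolding R_def D_def by auto
  moreover have "card (N v - (insert x (N v \<inter> N x))) = k - (Suc a1)"
    using vx E_V(1)[OF vx] by (subst card_Diff_subset) (auto simp: card_N card_a1)
  ultimately show ?thesis
    using inv3_double_count[OF R _ vx yz] card_c2[OF yz] unfolding R_def by auto
qed

text \<open>This is the double count for \<open>R\<close> divided by the double count for all 2-arcs
  with ends at distance 2. It yields the basic restriction: \<open>k - 1 - a1\<close> divides the
  valency of \<open>R\<close> times \<open>c2\<close>.\<close>

lemma inv3_count:
  assumes "inv3 R" "\<And>v x y. R v x y \<Longrightarrow> D x y" "E v x" "D y z"
  shows "card {u. R u y z} * (k - 1 - a1) = card {w. R v x w} * c2"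
proof -
  have "k2 > 0" using assms(4) card_k2[OF D_V(1)[OF assms(4)]]
    by (metis (mono_tags) card_gt_0_iff empty_iff fin_D mem_Collect_eq)
  moreover have "k > 0" using assms(3) card_N[OF E_V(1)[OF assms(3)]]
    by (metis card_gt_0_iff empty_iff fin_N in_N)
  moreover have "k * k2 * (card {u. R u y z} * (k - 1 - a1)) = k * k2 * (card {w. R v x w} * c2)"
  proof -
    have "k * k2 * (card {u. R u y z} * (k - 1 - a1)) = (k2 * card {u. R u y z}) * (k * (k - 1 - a1))" by simp
    also have "\<dots> = (k * card {w. R v x w}) * (k2 * c2)"
      by (simp only: inv3_double_count[OF assms] k2_c2)
    finally show ?thesis by (simp only: mult_ac)
  qed
  ultimately show ?thesis by simp
qed

lemma c2_pos: "c2 > 0"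
proof -
  obtain y z where yz: "D y z" using D_ex V_nonempty by blast
  then have "N y \<inter> N z \<noteq> {}" unfolding D_def using E_sym by fastforce
  then show ?thesis using card_c2[OF yz] by (metis card_gt_0_iff fin_N finite_Int)
qed

lemma c2_le: "c2 \<le> k"
proof -
  obtain y z where yz: "D y z" using D_ex V_nonempty by blast
  then show ?thesis using card_c2[OF yz] card_N[OF D_V(1)[OF yz]]
    by (metis card_mono fin_N inf_le1)
qed

lemma a1_less: "a1 < k - 1"
proof -
  have "k2 > 0"
  proof -
    obtain y z where yz: "D y z" using D_ex V_nonempty by blast
    then show ?thesis using card_k2[OF D_V(1)[OF yz]]
      by (metis (mono_tags) card_gt_0_iff empty_iff fin_D mem_Collect_eq)
  qed
  then show ?thesis using k2_c2 c2_pos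
    by (metis gr0I mult_0_right mult_is_0 not_less0 zero_less_diff)
qed

text \<open>\<open>orb v x y\<close> is the orbit of the 2-arc \<open>(x, v, y)\<close>, with the middle vertex listed first.\<close>

definition orb :: "'a \<Rightarrow> 'a \<Rightarrow> 'a \<Rightarrow> 'a \<Rightarrow> 'a \<Rightarrow> 'a \<Rightarrow> bool" where
  "orb v x y v' x' y' \<longleftrightarrow> (\<exists>g\<in>G. g v = v' \<and> g x = x' \<and> g y = y')"

lemma orb_I: "g \<in> G \<Longrightarrow> orb v x y (g v) (g x) (g y)"
  unfolding orb_def by blast

lemma orb_refl [simp]: "orb v x y v x y"
  using orb_I[OF G_id(1)] by simp

lemma orb_trans: assumes "orb a b c d e f" "orb d e f p q r" shows "orb a b c p q r"
proof -
  obtain g h where "g \<in> G" "g a = d" "g b = e" "g c = f" "h \<in> G" "h d = p" "h e = q" "h f = r"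
    using assms unfolding orb_def by metis
  then show ?thesis using orb_I[OF G_comp[of h g], of a b c] by simp
qed

lemma orb_sym: assumes "orb a b c d e f" shows "orb d e f a b c"
proof -
  obtain g where g: "g \<in> G" "g a = d" "g b = e" "g c = f"
    using assms unfolding orb_def by metis
  show ?thesis using orb_I[OF G_inv[OF g(1)], of d e f] g by auto
qed

lemma orb_swap: assumes "orb a b c d e f" shows "orb a c b d f e"
  using assms unfolding orb_def by metis

lemma orb_inv3: assumes "E v x" "E v y" shows "inv3 (orb v x y)"
  unfolding inv3_def
proof (intro conjI ballI allI impI)
  fix g a b c assume "g \<in> G" "orb v x y a b c"
  then show "orb v x y (g a) (g b) (g c)" using orb_I orb_trans by blast
next
  fix a b c assume "orb v x y a b c"
  then obtain g where g: "g \<in> G" "g v = a" "g x = b" "g y = c" unfolding orb_def by metis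
  show "E a b" "E a c" using G_E[OF g(1), of v x] G_E[OF g(1), of v y] assms unfolding g(2-4) by simp_all
qed

lemma orb_neq: assumes "orb v x y a b c" "x \<noteq> y" shows "b \<noteq> c"
  using assms G_inj unfolding orb_def by metis

section \<open>Suborbits of an arc stabilizer on a neighbourhood\<close>

definition sub :: "'a \<Rightarrow> 'a \<Rightarrow> 'a \<Rightarrow> 'a set" where "sub v x y = {z. orb v x y v x z}"

lemma sub_subset: assumes "E v x" "E v y" "x \<noteq> y" shows "sub v x y \<subseteq> N v - {x}"
  using inv3_E[OF orb_inv3[OF assms(1,2)]] unfolding sub_def by (auto dest: orb_neq[OF _ assms(3)])

lemma sub_self [simp]: "y \<in> sub v x y"
  by (simp add: sub_def)

lemma sub_eq: "z \<in> sub v x y \<Longrightarrow> sub v x z = sub v x y"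
  unfolding sub_def using orb_trans orb_sym by blast

lemma sub_disj: "z \<notin> sub v x y \<Longrightarrow> sub v x z \<inter> sub v x y = {}"
  using sub_eq sub_self by blast

lemma fin_sub_orb: "E v x \<Longrightarrow> E v y \<Longrightarrow> finite (sub v x y)"
  unfolding sub_def using inv3_fin(1)[OF orb_inv3] by blast

lemma card_sub_pos: "E v x \<Longrightarrow> E v y \<Longrightarrow> card (sub v x y) > 0"
  using fin_sub_orb sub_self card_gt_0_iff by blast

lemma card_sub_orb: assumes "E v x" "E v y" "orb v x y a b c"
  shows "card (sub a b c) = card (sub v x y)"
proof -
  have "{z. orb a b c a b z} = {z. orb v x y a b z}"
    using assms(3) orb_trans orb_sym by blast
  moreover have "card {z. orb v x y a b z} = card {z. orb v x y v x z}"
    using inv3_val[OF orb_inv3[OF assms(1,2)]] inv3_E[OF orb_inv3[OF assms(1,2)] assms(3)] assms(1) by blast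
  ultimately show ?thesis unfolding sub_def by simp
qed

lemma orb_transport: assumes "E v x" "E v' x'" "E v' w" "w \<noteq> x'"
  shows "\<exists>w0. E v w0 \<and> w0 \<noteq> x \<and> orb v x w0 v' x' w"
proof -
  obtain g where g: "g \<in> G" "g v' = v" "g x' = x" using arc_trans[OF assms(2,1)] by blast
  have "E v (g w)" using G_E[OF g(1), of v' w] assms(3) unfolding g(2) by simp
  moreover have "g w \<noteq> x" using G_inj[OF g(1), of w x'] assms(4) unfolding g(3) by simp
  moreover have "orb v x (g w) v' x' w" using orb_I[OF g(1), of v' x' w] orb_sym unfolding g(2,3) by blast
  ultimately show ?thesis by blast
qed

lemma sub_pair_rev: assumes "sub v x y = {y, z}" "y \<noteq> z"
  shows "orb v y z v z y"
proof -
  have "orb v x y v x z" using assms unfolding sub_def by blast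
  then obtain g where g: "g \<in> G" "g v = v" "g x = x" "g y = z" unfolding orb_def by metis
  have "orb v x y v x (g z)" using orb_I[OF g(1), of v x z] orb_trans[OF \<open>orb v x y v x z\<close>] unfolding g(2,3) by blast
  then have "g z \<in> {y, z}" using assms(1) unfolding sub_def by blast
  moreover have "g z \<noteq> z" using G_inj[OF g(1), of z y] assms(2) unfolding g(4) by blast
  ultimately have "g z = y" by blast
  then show ?thesis using orb_I[OF g(1), of v y z] unfolding g(2,4) by simp
qed

text \<open>If the two points \<open>p\<close>, \<open>q\<close> related to \<open>x\<close> are
  themselves related, the reflexive closure of the orbital is an equivalence relation with classes
  of size three, which primitivity forbids for \<open>k > 3\<close>.\<close>

lemma triangle_block:
  assumes "E v x" "E v p" "p \<noteq> q" "x \<noteq> p" "sub v x p = {p, q}" "orb v x p v p x" "orb v x p v p q" "k > 3"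
  shows False
proof -
  let ?O = "orb v x p"
  have O: "inv3 ?O" using orb_inv3 assms by blast
  have rev: "?O a c b" if "?O a b c" for a b c
  proof -
    have "?O a b c" by (rule that)
    then have "orb v p x a c b" by (rule orb_swap)
    then show ?thesis using orb_trans[OF assms(6)] by blast
  qed
  have tri: "?O a c d" if bc: "?O a b c" and bd: "?O a b d" and cd: "c \<noteq> d" for a b c d
  proof -
    obtain g where g: "g \<in> G" "g v = a" "g x = b" "g p = c" using bc unfolding orb_def by metis
    have e: "b = g x" "a = g v" using g by simp_all
    have "?O (inv g a) (inv g b) (inv g d)" using inv3_iff[OF O G_inv[OF g(1)]] bd by blast
    then have "?O v x (inv g d)" using g(1) unfolding e by simp
    then have "inv g d \<in> {p, q}" using assms(5) unfolding sub_def by blast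
    moreover have "inv g d \<noteq> p" using cd g(1,4) G_inv_apply(1) by metis
    ultimately have "d = g q" using G_inv_apply(1)[OF g(1), of d] by simp
    then show ?thesis using inv3_iff[OF O g(1), of v p q] assms(7) g by simp
  qed
  define S where "S = (\<lambda>a b c. E a b \<and> E a c \<and> (b = c \<or> ?O a b c))"
  have S: "inv3 S" unfolding inv3_def S_def using inv3_iff[OF O] by simp
  have all: "S v a b" if "E v a" "E v b" for a b
  proof (rule block_dichotomy[OF S, of v x p a b])
    show "S v c b" if "S v b c" for b c using that rev unfolding S_def by blast
    show "S v a d" if "S v a b" "S v b d" for a b d
      using that tri[OF rev[of v a b], of d] rev unfolding S_def by blast
  qed (use assms that E_V in \<open>auto simp: S_def\<close>)
  have "N v \<subseteq> insert x {p, q}" using all[OF assms(1)] unfolding assms(5)[symmetric] S_def sub_def by fastforce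
  then have "card (N v) \<le> card (insert x {p, q})" by (intro card_mono) auto
  also have "\<dots> \<le> 3" by (simp add: card_insert_if)
  finally show False using card_N E_V assms by fastforce
qed

lemma two_arc_trans_if_orb:
  assumes vx: "E v x" and all: "\<And>y z. E v y \<Longrightarrow> E v z \<Longrightarrow> y \<noteq> x \<Longrightarrow> z \<noteq> x \<Longrightarrow> orb v x y v x z"
  shows "two_arc_transitive V E"
proof -
  have "\<exists>g\<in>G. g a = a' \<and> g b = b' \<and> g c = c'"
    if h: "E a b" "E b c" "a \<noteq> c" "E a' b'" "E b' c'" "a' \<noteq> c'" for a b c a' b' c'
  proof -
    obtain w where w: "E v w" "w \<noteq> x" "orb v x w b a c"
      using orb_transport[OF vx E_sym[OF h(1)] h(2)] h(3) by metis
    obtain w' where w': "E v w'" "w' \<noteq> x" "orb v x w' b' a' c'"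
      using orb_transport[OF vx E_sym[OF h(4)] h(5)] h(6) by metis
    have "orb b a c b' a' c'"
      using orb_trans[OF orb_sym[OF w(3)] orb_trans[OF all[OF w(1) w'(1) w(2) w'(2)] w'(3)]] .
    then show ?thesis unfolding orb_def by blast
  qed
  then show ?thesis
    using dt unfolding two_arc_transitive_def two_distance_transitive_def two_arcs_def G_def by auto
qed

section \<open>Triangle-free graphs: the case \<open>c2 = k - 1\<close> and self-paired
  orbits\<close>

lemma tfree_D: assumes "a1 = 0" "E v x" "E v y" "x \<noteq> y" shows "D x y"
proof -
  have "\<not> E x y"
  proof
    assume "E x y"
    then have "N x \<inter> N y = {}" using card_a1 assms(1) by (metis card_0_eq fin_N finite_Int)
    then show False using assms(2,3) E_sym by fastforce
  qed
  then show ?thesis using assms E_sym unfolding D_def by blast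
qed

lemma tfree_no_triangle: assumes "a1 = 0" "E v x" "E v y" shows "\<not> E x y"
  using tfree_D[OF assms] E_irrefl unfolding D_def by blast

lemma sub_count:
  assumes "a1 = 0" "E v x" "E v y" "x \<noteq> y" "D p q"
  shows "card {u. orb v x y u p q} * (k - 1) = card (sub v x y) * c2"
proof -
  have "D b c" if o: "orb v x y a b c" for a b c
    using tfree_D[OF assms(1)] inv3_E[OF orb_inv3[OF assms(2,3)] o] orb_neq[OF o assms(4)] by blast
  then show ?thesis
    using inv3_count[OF orb_inv3[OF assms(2,3)] _ assms(2,5)] assms(1) unfolding sub_def by simp
qed

text \<open>Each neighbour of \<open>u\<close> has exactly one non-neighbour at distance 2 from \<open>u\<close>. Swapping \<open>y, z\<close>
  together with these partners is an automorphism.\<close>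

lemma km_orb:
  assumes a: "a1 = 0" and c: "c2 = k - 1" and k: "k \<ge> 3"
    and ux: "E u x" and uy: "E u y" and uz: "E u z" and xyz: "x \<noteq> y" "x \<noteq> z" "y \<noteq> z"
  shows "orb u x y u x z"
proof -
  have uV: "u \<in> V" using E_V ux by blast
  have "k2 * (k - 1) = k * (k - 1)" using k2_c2 a c by simp
  then have k2: "k2 = k" using k by simp
  \<comment> \<open>Since \<open>k2 = k\<close> and \<open>t\<close> has \<open>k - 1\<close>
    neighbours at distance 2 from \<open>u\<close>, exactly one vertex \<open>w\<close> there is
    missed. The \<open>k - 1\<close> common neighbours of \<open>u\<close> and \<open>w\<close> are
    then all neighbours of \<open>u\<close> except \<open>t\<close>.\<close>
  have miss: "\<exists>w. D u w \<and> \<not> E t w \<and> (\<forall>w'. D u w' \<longrightarrow> w' \<noteq> w \<longrightarrow> E t w') \<and> (\<forall>x. E u x \<longrightarrow> x \<noteq> t \<longrightarrow> E x w)"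
    if ut: "E u t" for t
  proof -
    have sub: "N t - {u} \<subseteq> {w. D u w}" using ut tfree_D[OF a E_sym[OF ut]] by auto
    have "card ({w. D u w} - (N t - {u})) = card {w. D u w} - card (N t - {u})"
      using sub by (intro card_Diff_subset) auto
    also have "card (N t - {u}) = k - 1" using ut E_sym[OF ut] E_V(2)[OF ut] card_N by simp
    finally have "card ({w. D u w} - (N t - {u})) = 1" using card_k2[OF uV] k2 k by simp
    then obtain w where w: "{w. D u w} - (N t - {u}) = {w}" using card_1_singletonE by blast
    have 1: "D u w" "\<not> E t w"
    proof -
      have "w \<in> {w. D u w} - (N t - {u})" using w by blast
      then show "D u w" "\<not> E t w" unfolding D_def by auto
    qed
    have 2: "E t w'" if "D u w'" "w' \<noteq> w" for w'
    proof (rule ccontr)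
      assume "\<not> E t w'"
      then have "w' \<in> {w. D u w} - (N t - {u})" using that by simp
      then show False using w that by blast
    qed
    have "N u \<inter> N w \<subseteq> N u - {t}" using 1(2) E_sym by auto
    moreover have "card (N u - {t}) = k - 1" using ut card_N[OF uV] by simp
    ultimately have "N u \<inter> N w = N u - {t}" using card_c2[OF 1(1)] c
      by (intro card_subset_eq) auto
    then have "x \<in> N u \<inter> N w" if "E u x" "x \<noteq> t" for x using that by simp
    then have "E x w" if "E u x" "x \<noteq> t" for x using that E_sym by simp
    then show ?thesis using 1 2 by blast
  qed
  obtain wy where wy: "D u wy" "\<not> E y wy" "\<And>w'. D u w' \<Longrightarrow> w' \<noteq> wy \<Longrightarrow> E y w'" "\<And>x. E u x \<Longrightarrow> x \<noteq> y \<Longrightarrow> E x wy"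
    using miss[OF uy] by blast
  obtain wz where wz: "D u wz" "\<not> E z wz" "\<And>w'. D u w' \<Longrightarrow> w' \<noteq> wz \<Longrightarrow> E z w'" "\<And>x. E u x \<Longrightarrow> x \<noteq> z \<Longrightarrow> E x wz"
    using miss[OF uz] by blast
  have ww: "wy \<noteq> wz" using wy(2) wz(4)[OF uy] xyz by blast
  have distinct: "y \<noteq> wy" "y \<noteq> wz" "z \<noteq> wy" "z \<noteq> wz" "x \<noteq> wy" "x \<noteq> wz" "u \<noteq> y" "u \<noteq> z" "u \<noteq> wy" "u \<noteq> wz"
    using wy(1) wz(1) uy uz ux unfolding D_def by auto
  define f where "f = (\<lambda>t. if t = y then z else if t = z then y else if t = wy then wz else if t = wz then wy else t)"
  define A where "A = {y, z, wy, wz}"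
  have f_simps [simp]: "f y = z" "f z = y" "f wy = wz" "f wz = wy" using distinct ww xyz unfolding f_def by auto
  have f_out [simp]: "t \<notin> A \<Longrightarrow> f t = t" for t unfolding A_def f_def by simp
  have ff: "f (f t) = t" for t
    by (cases "t \<in> A") (auto simp: A_def)
  have yz: "\<not> E y z" "\<not> E z y" using tfree_no_triangle[OF a] uy uz by blast+
  have "\<not> E wy wz" by (rule tfree_no_triangle[OF a, of x]) (use wy(4)[OF ux] wz(4)[OF ux] xyz in auto)
  then have wyz: "\<not> E wy wz" "\<not> E wz wy" using E_sym by blast+
  have ywz: "E y wz" "E z wy" using wy(4)[OF uz] wz(4)[OF uy] xyz by auto
  have nb: "E t q" if t: "t \<notin> A" "E t p" and pq: "E u p" "E u q" and q: "\<And>w'. D u w' \<Longrightarrow> w' \<notin> A \<Longrightarrow> E q w'" for t p q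
  proof (cases "t = u")
    case True then show ?thesis using pq by simp
  next
    case False
    have "D u t" by (rule tfree_D[OF a, of p]) (use that False E_sym in auto)
    then show ?thesis using q t E_sym by blast
  qed
  \<comment> \<open>If \<open>t\<close> is not adjacent to \<open>u\<close>, then \<open>x\<close>
    and \<open>t\<close> are at distance 2 because of \<open>wp\<close>. Their \<open>k - 1\<close>
    common neighbours must be all neighbours of \<open>x\<close> except \<open>u\<close>, and
    \<open>wq\<close> is among them.\<close>
  have nb2: "E t wq" if t: "t \<notin> A" "E t wp" and p: "\<And>x. E u x \<Longrightarrow> x \<notin> A \<Longrightarrow> E x wp" "D u wp"
    and q: "\<And>x. E u x \<Longrightarrow> x \<notin> A \<Longrightarrow> E x wq" "D u wq" for t wp wq
  proof (cases "E u t")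
    case True then show ?thesis using q t by blast
  next
    case False
    have xA: "x \<notin> A" using xyz distinct unfolding A_def by auto
    have xw: "E x wp" "E x wq" using p q ux xA by blast+
    have "D x t" by (rule tfree_D[OF a, of wp]) (use xw E_sym t False ux in auto)
    then have "card (N x \<inter> N t) = k - 1" using card_c2 c by simp
    moreover have "N x \<inter> N t \<subseteq> N x - {u}" using False E_sym by auto
    moreover have "card (N x - {u}) = k - 1" using E_sym[OF ux] card_N[OF E_V(2)[OF ux]] by simp
    ultimately have "N x \<inter> N t = N x - {u}" by (intro card_subset_eq) auto
    moreover have "wq \<in> N x - {u}" using xw q(2) unfolding D_def by auto
    ultimately have "wq \<in> N x \<inter> N t" by simp
    then show ?thesis by simp
  qed
  have out: "E s (f t)" if s: "s \<notin> A" and t: "t \<in> A" and e: "E s t" for s t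
  proof -
    consider "t = y" | "t = z" | "t = wy" | "t = wz" using t unfolding A_def by blast
    then show ?thesis
    proof cases
      case 1
      have "E s z" by (rule nb[OF s e[unfolded 1] uy uz]) (use wz(3) A_def in auto)
      then show ?thesis using 1 by simp
    next
      case 2
      have "E s y" by (rule nb[OF s e[unfolded 2] uz uy]) (use wy(3) A_def in auto)
      then show ?thesis using 2 by simp
    next
      case 3
      have "E s wz" by (rule nb2[OF s e[unfolded 3]]) (use wz wy A_def in auto)
      then show ?thesis using 3 by simp
    next
      case 4
      have "E s wy" by (rule nb2[OF s e[unfolded 4]]) (use wz wy A_def in auto)
      then show ?thesis using 4 by simp
    qed
  qed
  have inn: "E (f s) (f t)" if s: "s \<in> A" and t: "t \<in> A" and e: "E s t" for s t
  proof -
    have n: "\<not> E wy y" "\<not> E wz z" using wy(2) wz(2) E_sym by blast+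
    have p: "E wz y" "E wy z" using ywz E_sym by blast+
    show ?thesis using s t e yz wyz ywz wy(2) wz(2) n p unfolding A_def
      by (elim insertE emptyE) simp_all
  qed
  have "f \<in> G"
  proof (rule G_I)
    show "bij f" by (rule o_bij[of f f]) (use ff in auto)
    have "A \<subseteq> V" using E_V[OF uy] E_V[OF uz] D_V(2)[OF wy(1)] D_V(2)[OF wz(1)] unfolding A_def by blast
    then show "f t = t" if "t \<notin> V" for t using that f_out[of t] by blast
    show "E (f s) (f t)" if e: "E s t" for s t
    proof (cases "s \<in> A")
      case True
      show ?thesis
      proof (cases "t \<in> A")
        case False
        then have "E t (f s)" using out True E_sym[OF e] by blast
        then show ?thesis using False E_sym by simp
      qed (use True inn e in blast)
    next
      case False
      then show ?thesis by (cases "t \<in> A") (use out e in auto)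
    qed
  qed
  moreover have "f u = u" "f x = x" "f y = z" using distinct xyz by (auto simp: A_def f_def)
  ultimately show ?thesis unfolding orb_def by blast
qed

text \<open>An automorphism swapping \<open>u\<close> and \<open>w\<close> fixes all their common neighbours, so it identifies the
  2-arcs \<open>(x1, u, x2)\<close> and \<open>(x1, w, x2)\<close>.\<close>

lemma self_paired_contra:
  assumes a: "a1 = 0" and c: "c2 \<ge> 2"
    and rev: "\<And>v x y. E v x \<Longrightarrow> E v y \<Longrightarrow> x \<noteq> y \<Longrightarrow> orb v x y v y x"
    and uniq: "\<And>u w x y. D u w \<Longrightarrow> E x u \<Longrightarrow> E x w \<Longrightarrow> orb x u w y u w \<Longrightarrow> x = y"
  shows False
proof -
  obtain u w where uw: "D u w" using D_ex V_nonempty by blast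
  have "card (N u \<inter> N w) \<ge> 2" using card_c2[OF uw] c by simp
  then obtain x1 x2 where x: "x1 \<in> N u \<inter> N w" "x2 \<in> N u \<inter> N w" "x1 \<noteq> x2"
    by (metis card_le_Suc0_iff_eq fin_N finite_Int not_less_eq_eq numeral_2_eq_2)
  obtain g where g: "g \<in> G" "g u = w" "g w = u" using d2t[OF uw D_sym[OF uw]] by blast
  have fix_x: "g x = x" if xx: "x \<in> N u \<inter> N w" for x
  proof -
    have e: "E x u" "E x w" using xx E_sym by auto
    have "orb x w u x u w" using rev[OF e(2,1)] uw unfolding D_def by blast
    moreover have "orb x u w (g x) w u" using orb_I[OF g(1), of x u w] unfolding g(2,3) .
    ultimately have "orb x w u (g x) w u" using orb_trans by blast
    then show ?thesis using uniq[OF D_sym[OF uw] e(2,1)] by metis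
  qed
  have "orb u x1 x2 w x1 x2" using orb_I[OF g(1), of u x1 x2] fix_x x unfolding g(2) by metis
  moreover have "D x1 x2" using tfree_D[OF a, of u] x by auto
  ultimately have "u = w" using uniq[of x1 x2 u w] x by simp
  then show False using uw unfolding D_def by blast
qed

end

section \<open>Triangle-free graphs: reduction to valency 7\<close>

locale non_2at_graph = dt_graph +
  assumes not_2at: "\<not> two_arc_transitive V E" and k_le: "k \<le> 8"
begin

lemma two_orbits: assumes "E v x"
  shows "\<exists>y z. E v y \<and> E v z \<and> y \<noteq> x \<and> z \<noteq> x \<and> z \<notin> sub v x y"
  using two_arc_trans_if_orb[OF assms] not_2at unfolding sub_def by blast

lemma other_orbit: assumes "E v x" shows "\<exists>z. E v z \<and> z \<noteq> x \<and> z \<notin> sub v x y"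
proof -
  obtain a b where ab: "E v a" "E v b" "a \<noteq> x" "b \<noteq> x" "b \<notin> sub v x a" using two_orbits[OF assms] by blast
  show ?thesis
  proof (cases "a \<in> sub v x y")
    case True
    then have "b \<notin> sub v x y" using ab(5) sub_eq by simp
    then show ?thesis using ab by blast
  qed (use ab in blast)
qed

lemma sub_sum: assumes "E v x" "E v y" "E v z" "y \<noteq> x" "z \<noteq> x" "z \<notin> sub v x y"
  shows "card (sub v x y) + card (sub v x z) \<le> k - 1"
    and "card (sub v x y) + card (sub v x z) = k - 1 \<Longrightarrow> sub v x y \<union> sub v x z = N v - {x}"
proof -
  have s: "sub v x y \<union> sub v x z \<subseteq> N v - {x}" using sub_subset assms by blast
  have c: "card (sub v x y \<union> sub v x z) = card (sub v x y) + card (sub v x z)"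
    using sub_disj[OF assms(6)] fin_sub_orb assms by (intro card_Un_disjoint) auto
  have n: "card (N v - {x}) = k - 1" using assms(1) card_N[OF E_V(1)[OF assms(1)]] by simp
  show "card (sub v x y) + card (sub v x z) \<le> k - 1"
    using card_mono[OF _ s] c n by simp
  show "sub v x y \<union> sub v x z = N v - {x}" if "card (sub v x y) + card (sub v x z) = k - 1"
    using card_subset_eq[OF _ s] c n that by simp
qed

lemma sub_less: assumes "E v x" "E v y" "y \<noteq> x" shows "card (sub v x y) < k - 1"
proof -
  obtain z where z: "E v z" "z \<noteq> x" "z \<notin> sub v x y" using other_orbit[OF assms(1)] by blast
  then show ?thesis using sub_sum(1)[OF assms(1,2) z(1) assms(3) z(2,3)] card_sub_pos[OF assms(1) z(1)] by linarith
qed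

lemma rev_orb: assumes "orb v x y v' x' y'" "orb v' x' y' v' y' x'" shows "orb v x y v y x"
  using orb_trans[OF assms(1) orb_trans[OF assms(2) orb_sym[OF orb_swap[OF assms(1)]]]] .

lemma k_ge3: "k \<ge> 3"
proof -
  obtain v x where vx: "E v x" using edge_ex V_nonempty by blast
  then obtain y where "E v y" "y \<noteq> x" using other_orbit by blast
  then show ?thesis using sub_less[OF vx] card_sub_pos[OF vx] by fastforce
qed

end

locale tfree_graph = non_2at_graph +
  assumes tf: "a1 = 0"
begin

lemma c2_neq: "c2 \<noteq> k - 1"
proof
  assume c: "c2 = k - 1"
  obtain v x where vx: "E v x" using edge_ex V_nonempty by blast
  obtain y z where yz: "E v y" "E v z" "y \<noteq> x" "z \<noteq> x" "z \<notin> sub v x y" using two_orbits[OF vx] by blast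
  then have "y \<noteq> z" by auto
  then have "orb v x y v x z" using km_orb[OF tf c k_ge3 vx yz(1,2)] yz(3,4) by blast
  then show False using yz(5) unfolding sub_def by blast
qed

text \<open>A suborbit of length 1 would make \<open>c2\<close> a multiple of \<open>k - 1\<close>.
  As \<open>c2 <= k < 2 (k - 1)\<close>, this would be \<open>k - 1\<close> itself, which
  \<open>c2_neq\<close> excludes.\<close>

lemma sub_neq1: assumes "E v x" "E v y" "y \<noteq> x" shows "card (sub v x y) \<noteq> 1"
proof
  assume 1: "card (sub v x y) = 1"
  obtain p q where pq: "D p q" using D_ex V_nonempty by blast
  define m where "m = card {u. orb v x y u p q}"
  have e: "m * (k - 1) = c2" using sub_count[OF tf assms(1,2) _ pq] assms(3) 1 unfolding m_def by auto
  have "m \<noteq> 0"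
  proof
    assume "m = 0"
    then have "c2 = 0" using e by simp
    then show False using c2_pos by simp
  qed
  moreover have "m \<noteq> 1" using e c2_neq by auto
  ultimately have "2 * (k - 1) \<le> m * (k - 1)" by (intro mult_right_mono) auto
  then show False using e c2_le k_ge3 by linarith
qed

lemma sub_ge2: assumes "E v x" "E v y" "y \<noteq> x" shows "card (sub v x y) \<ge> 2"
  using sub_neq1[OF assms] card_sub_pos[OF assms(1,2)] by linarith

lemma sub_dvd: assumes "E v x" "E v y" "y \<noteq> x" shows "(k - 1) dvd card (sub v x y) * c2"
proof -
  obtain p q where pq: "D p q" using D_ex V_nonempty by blast
  show ?thesis using sub_count[OF tf assms(1,2) _ pq] assms(3) by (metis dvd_triv_right)
qed

lemma uniq_orbit:
  assumes all: "\<And>v x y. E v x \<Longrightarrow> E v y \<Longrightarrow> y \<noteq> x \<Longrightarrow> card (sub v x y) * c2 = k - 1"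
    and uw: "D u w" "E x u" "E x w" "orb x u w y u w"
  shows "x = y"
proof -
  have ne: "u \<noteq> w" using uw(1) unfolding D_def by blast
  have "card {z. orb x u w z u w} * (k - 1) = k - 1"
    using sub_count[OF tf uw(2,3) ne uw(1)] all[OF uw(2,3)] ne by simp
  then have "card {z. orb x u w z u w} = 1" using k_ge3 by simp
  then obtain t where "{z. orb x u w z u w} = {t}" using card_1_singletonE by blast
  then show ?thesis using uw(4) orb_refl by (metis mem_Collect_eq singletonD)
qed

text \<open>The hypothesis on the suborbit lengths says that each orbit of 2-arcs has a single
  middle vertex over each pair at distance 2, which is the uniqueness that
  \<open>self_paired_contra\<close> requires.\<close>

lemma nonrev_ex:
  assumes all: "\<And>v x y. E v x \<Longrightarrow> E v y \<Longrightarrow> y \<noteq> x \<Longrightarrow> card (sub v x y) * c2 = k - 1" and "c2 \<ge> 2"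
  shows "\<exists>v x y. E v x \<and> E v y \<and> x \<noteq> y \<and> \<not> orb v x y v y x"
proof (rule ccontr)
  assume n: "\<not> ?thesis"
  show False
  proof (rule self_paired_contra[OF tf assms(2)])
    show "orb v x y v y x" if "E v x" "E v y" "x \<noteq> y" for v x y using n that by blast
    show "x = y" if "D u w" "E x u" "E x w" "orb x u w y u w" for u w x y
      by (rule uniq_orbit[OF _ that]) (rule all)
  qed
qed

text \<open>A suborbit length \<open>s\<close> satisfies \<open>2 <= s < k - 1\<close>, which is
  impossible for \<open>k = 3\<close>. For \<open>k\<close> equal to 4, 6 or 8 the prime
  \<open>k - 1\<close> divides \<open>s * c2\<close> but not \<open>s\<close>, so it divides
  \<open>c2\<close>; then \<open>c2 = k - 1\<close>, which is excluded.\<close>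

lemma k_cases: "k = 5 \<or> k = 7"
proof -
  obtain v x where vx: "E v x" using edge_ex V_nonempty by blast
  obtain y where y: "E v y" "y \<noteq> x" using other_orbit[OF vx] by blast
  define s where "s = card (sub v x y)"
  have s: "2 \<le> s" "s < k - 1" "(k - 1) dvd s * c2"
    unfolding s_def using sub_ge2[OF vx y] sub_less[OF vx y] sub_dvd[OF vx y] .
  have c: "0 < c2" "c2 \<le> k" "c2 \<noteq> k - 1" using c2_pos c2_le c2_neq .
  have "k \<in> {3, 4, 5, 6, 7, 8}" using k_ge3 k_le by auto
  moreover have "\<not> k = 3" using s by auto
  moreover have "\<not> k = 4"
  proof
    assume k: "k = 4"
    then have "s = 2" using s by simp
    then show False using s c k by simp presburger
  qed
  moreover have "\<not> k = 6"
  proof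
    assume k: "k = 6"
    then have "s = 2 \<or> s = 3 \<or> s = 4" using s by auto
    then show False using s(3) c k by (elim disjE; simp; presburger)
  qed
  moreover have "\<not> k = 8"
  proof
    assume k: "k = 8"
    then have "s = 2 \<or> s = 3 \<or> s = 4 \<or> s = 5 \<or> s = 6" using s by auto
    then show False using s(3) c k by (elim disjE; simp; presburger)
  qed
  ultimately show ?thesis by auto
qed

lemma transport: assumes "E v x" "E v y" "E v z" "y \<noteq> z"
  shows "\<exists>t. E v t \<and> t \<noteq> x \<and> orb v x t v y z"
  using orb_transport[OF assms(1,2,3)] assms(4) by blast

lemma in_sub_orb: "t \<in> sub v x y \<Longrightarrow> orb v x t v' x' y' \<Longrightarrow> orb v x y v' x' y'"
  unfolding sub_def using orb_trans by blast

text \<open>For \<open>k = 5\<close> there are two suborbits of length 2. If one is not self-paired,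
  the other is its reverse, so no pair of distinct neighbours of \<open>v\<close> is reversible. But
  the two points of a suborbit of length 2 are interchanged by \<open>sub_pair_rev\<close>.\<close>

lemma k_neq5: "k \<noteq> 5"
proof
  assume k: "k = 5"
  have s2: "card (sub v x y) = 2" if e: "E v x" "E v y" "y \<noteq> x" for v x y
  proof -
    obtain z where z: "E v z" "z \<noteq> x" "z \<notin> sub v x y" using other_orbit[OF e(1)] by blast
    show ?thesis using sub_sum(1)[OF e(1,2) z(1) e(3) z(2,3)] sub_ge2[OF e] sub_ge2[OF e(1) z(1,2)] k by linarith
  qed
  obtain v x where vx: "E v x" using edge_ex V_nonempty by blast
  obtain y where y: "E v y" "y \<noteq> x" using other_orbit[OF vx] by blast
  have "4 dvd 2 * c2" using sub_dvd[OF vx y] s2[OF vx y] k by simp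
  moreover have "c2 > 0" "c2 \<le> 5" "c2 \<noteq> 4" using c2_pos c2_le c2_neq k by auto
  ultimately have c2: "c2 = 2" by presburger
  obtain v x y where vx: "E v x" and y: "E v y" and xy: "x \<noteq> y" and nr: "\<not> orb v x y v y x"
    using nonrev_ex s2 c2 k by fastforce
  obtain z where z: "E v z" "z \<noteq> x" "z \<notin> sub v x y" using other_orbit[OF vx] by blast
  have cov: "sub v x y \<union> sub v x z = N v - {x}"
    using sub_sum(2)[OF vx y z(1) _ z(2,3)] s2[OF vx y] s2[OF vx z(1,2)] xy k by simp
  have cov': "t \<in> sub v x y \<or> t \<in> sub v x z" if "E v t" "t \<noteq> x" for t
  proof -
    have "t \<in> N v - {x}" using that by simp
    then show ?thesis unfolding cov[symmetric] by simp
  qed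
  obtain y' where y': "sub v x y = {y, y'}" "y' \<noteq> y"
    using s2[OF vx y] xy sub_self by (metis card_2_iff doubleton_eq_iff insertE singletonD)
  have rev': "orb v y y' v y' y" using sub_pair_rev y' by metis
  have y'E: "E v y'" using sub_subset[OF vx y xy] y' by auto
  obtain t where t: "E v t" "t \<noteq> x" "orb v x t v y x" using transport[OF vx y vx] xy by metis
  have "t \<notin> sub v x y" using in_sub_orb[OF _ t(3)] nr by blast
  then have zx: "orb v x z v y x" using cov'[OF t(1,2)] in_sub_orb[OF _ t(3)] by blast
  obtain r where r: "E v r" "r \<noteq> x" "orb v x r v y y'" using transport[OF vx y y'E] y'(2) by metis
  have "r \<notin> sub v x y" using in_sub_orb[OF _ r(3)] rev_orb rev' nr by blast
  then have "orb v x z v y y'" using cov'[OF r(1,2)] in_sub_orb[OF _ r(3)] by blast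
  then have "orb v x z v z x" using rev_orb rev' by blast
  then have "orb v y x v x y" using rev_orb[OF orb_sym[OF zx]] by blast
  then show False using nr orb_sym by blast
qed

lemma k7: "k = 7"
  using k_cases k_neq5 by blast

text \<open>Two suborbits of length at least 2 fit into six points, so if one has length other than
  3, some suborbit {\<open>p\<close>, \<open>q\<close>} has length 2, and divisibility gives
  \<open>c2 = 3\<close>. The pair \<open>p\<close>, \<open>q\<close> is reversible and by
  \<open>triangle_block\<close> lies in a different orbit, represented by \<open>w\<close>. The
  count then makes the suborbit of \<open>w\<close> of length 2 or 4.\<close>

lemma all_sub3: assumes "E v x" "E v y" "y \<noteq> x" shows "card (sub v x y) = 3"
proof (rule ccontr)
  assume n3: "\<not> ?thesis"
  have "\<exists>p. E v p \<and> p \<noteq> x \<and> card (sub v x p) = 2"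
  proof -
    obtain z where z: "E v z" "z \<noteq> x" "z \<notin> sub v x y" using other_orbit[OF assms(1)] by blast
    have "card (sub v x y) = 2 \<or> card (sub v x z) = 2"
      using sub_sum(1)[OF assms(1,2) z(1) assms(3) z(2,3)] sub_ge2[OF assms] sub_ge2[OF assms(1) z(1,2)] k7 n3 by linarith
    then show ?thesis using z assms by blast
  qed
  then obtain p where p: "E v p" "p \<noteq> x" "card (sub v x p) = 2" by blast
  have vx: "E v x" by (rule assms(1))
  have "6 dvd 2 * c2" using sub_dvd[OF vx p(1,2)] p(3) k7 by simp
  then have c2: "c2 = 3" using c2_pos c2_le c2_neq k7 by presburger
  have pair: "\<exists>q. sub v x p = {p, q} \<and> q \<noteq> p \<and> E v q \<and> q \<noteq> x \<and> orb v p q v q p"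
    if p: "E v p" "p \<noteq> x" and c: "card (sub v x p) = 2" for p
  proof -
    obtain q where q: "sub v x p = {p, q}" "q \<noteq> p"
      using c sub_self by (metis card_2_iff doubleton_eq_iff insertE singletonD)
    then show ?thesis using sub_subset[OF vx p(1)] sub_pair_rev[OF q(1)] p(2) by auto
  qed
  obtain q where q: "sub v x p = {p, q}" "q \<noteq> p" "E v q" "q \<noteq> x" "orb v p q v q p" using pair[OF p] by blast
  have notri: "\<not> orb v x p v p q" if p: "E v p" "p \<noteq> x" and q: "sub v x p = {p, q}" "q \<noteq> p" "orb v p q v q p" for p q
  proof
    assume o: "orb v x p v p q"
    show False by (rule triangle_block[OF vx p(1) q(2)[symmetric] p(2)[symmetric] q(1) rev_orb[OF o q(3)] o]) (simp add: k7)
  qed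
  obtain w where w: "E v w" "w \<noteq> x" "orb v x w v p q" using transport[OF vx p(1) q(3)] q(2) by metis
  have wp: "w \<notin> sub v x p" using in_sub_orb[OF _ w(3)] notri[OF p(1,2) q(1,2,5)] by blast
  have wrev: "orb v x w v w x" using rev_orb[OF w(3) q(5)] .
  have "6 dvd card (sub v x w) * 3" using sub_dvd[OF vx w(1,2)] k7 c2 by simp
  moreover have "card (sub v x w) \<le> 4" using sub_sum(1)[OF vx p(1) w(1) p(2) w(2) wp] p(3) k7 by simp
  ultimately have "card (sub v x w) = 2 \<or> card (sub v x w) = 4" using sub_ge2[OF vx w(1,2)] by presburger
  then show False
  proof
    \<comment> \<open>Here the orbital of \<open>(x, p)\<close> is self-paired of valency 2. Each of
      \<open>p\<close>, \<open>q\<close> has only one neighbour in it besides \<open>x\<close>, so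
      at most two points are reached from \<open>x\<close> in two such steps without returning to
      \<open>x\<close>. The whole suborbit of \<open>w\<close> would have to consist of such
      points.\<close>
    assume w4: "card (sub v x w) = 4"
    have "sub v x p \<union> sub v x w = N v - {x}"
      using sub_sum(2)[OF vx p(1) w(1) p(2) w(2) wp] p(3) w4 k7 by simp
    then have cov: "t \<in> sub v x p \<or> t \<in> sub v x w" if "E v t" "t \<noteq> x" for t
      using that by (metis DiffI UnE in_N singletonD)
    obtain t where t: "E v t" "t \<noteq> x" "orb v x t v p x" using transport[OF vx p(1) vx p(2)] by blast
    have prev: "orb v x p v p x"
    proof (cases "t \<in> sub v x p")
      case True then show ?thesis using in_sub_orb[OF _ t(3)] by blast
    next
      case False
      then have "orb v x w v p x" using cov[OF t(1,2)] in_sub_orb[OF _ t(3)] by blast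
      then have "orb v p x v x p" using rev_orb[OF orb_sym] wrev by blast
      then show ?thesis using orb_sym by blast
    qed
    let ?O = "orb v x p"
    have O: "inv3 ?O" using orb_inv3 vx p by blast
    have card2: "card {z. ?O v r z} = 2" if "E v r" for r
      using inv3_val[OF O that vx] p(3) unfolding sub_def by simp
    have nb: "\<exists>r'. {z. ?O v r z} \<subseteq> {x, r'} \<and> (r' \<noteq> x \<and> ?O v r r')" if "?O v x r" for r
    proof -
      have "orb v p x v r x" using that by (rule orb_swap)
      then have "?O v r x" using prev orb_trans by blast
      moreover have "E v r" using inv3_E[OF O that] by blast
      ultimately have 1: "x \<in> {z. ?O v r z}" "card {z. ?O v r z} = 2" using card2 by auto
      then obtain a b where ab: "{z. ?O v r z} = {a, b}" "a \<noteq> b" using card_2_iff by metis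
      define r' where "r' = (if x = a then b else a)"
      have "{z. ?O v r z} = {x, r'}" "r' \<noteq> x" using 1(1) ab unfolding r'_def by auto
      then show ?thesis by blast
    qed
    obtain p' where p': "{z. ?O v p z} \<subseteq> {x, p'}" "p' \<noteq> x" "?O v p p'" using nb[of p] by auto
    have "?O v x q" using q(1) unfolding sub_def by blast
    then obtain q' where q': "{z. ?O v q z} \<subseteq> {x, q'}" using nb[of q] by auto
    have "p' \<noteq> q" using p'(3) notri[OF p(1,2) q(1,2,5)] by blast
    moreover have "p' \<noteq> p" using orb_neq[OF p'(3)] p(2) by blast
    ultimately have "p' \<notin> sub v x p" using q(1) by blast
    then have p'w: "p' \<in> sub v x w" using cov inv3_E[OF O p'(3)] p'(2) by blast
    have "sub v x w \<subseteq> {p', q'}"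
    proof
      fix z assume z: "z \<in> sub v x w"
      then have "orb v x p' v x z" using sub_eq[OF p'w] unfolding sub_def by blast
      then obtain g where g: "g \<in> G" "g v = v" "g x = x" "g p' = z" unfolding orb_def by metis
      have "?O v x (g p)" using orb_I[OF g(1), of v x p] unfolding g(2,3) .
      then have "g p = p \<or> g p = q" using q(1) unfolding sub_def by blast
      moreover have "?O v (g p) z" using inv3_iff[OF O g(1), of v p p'] p'(3) unfolding g(2,4) by blast
      moreover have "z \<noteq> x" using z sub_subset[OF vx w(1)] w(2) by blast
      ultimately have "?O v p z \<or> ?O v q z" "z \<noteq> x" by auto
      then show "z \<in> {p', q'}" using p'(1) q' by blast
    qed
    then have "card (sub v x w) \<le> card {p', q'}" by (intro card_mono) auto
    then show False using w4 by (simp add: card_insert_if split: if_splits)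
  next
    \<comment> \<open>Now all suborbits have length 2. The point \<open>y\<close> is not reversible
      with \<open>x\<close>, and \<open>z\<close> represents the reverse orbit; \<open>r\<close>
      comes from the reversible pair inside the suborbit of \<open>y\<close>, and \<open>t\<close>
      from the one inside the suborbit of \<open>r\<close>. Four disjoint suborbits do not fit, so
      \<open>t\<close> lies in that of \<open>r\<close>, and \<open>triangle_block\<close>
      applies.\<close>
    assume w2: "card (sub v x w) = 2"
    have fs: "finite (sub v x p)" "finite (sub v x w)" using fin_sub_orb vx p w by blast+
    have s2: "card (sub v x y) = 2" if y: "E v y" "y \<noteq> x" for y
    proof (cases "y \<in> sub v x p \<union> sub v x w")
      case True
      then show ?thesis using sub_eq p(3) w2 by (metis UnE)
    next
      case False
      have "sub v x y \<inter> (sub v x p \<union> sub v x w) = {}"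
        using False sub_disj by blast
      moreover have "sub v x y \<union> (sub v x p \<union> sub v x w) \<subseteq> N v - {x}"
        using sub_subset[OF vx] y p w by blast
      moreover have "card (sub v x p \<union> sub v x w) = 4"
        using card_Un_disjoint[of "sub v x p" "sub v x w"] sub_disj[OF wp] fs p(3) w2 by (simp add: Int_commute)
      moreover have "card (N v - {x}) = 6" using vx card_N[OF E_V(1)[OF vx]] k7 by simp
      moreover have "finite (sub v x y)" using fin_sub_orb vx y by blast
      ultimately have "card (sub v x y) \<le> 2"
        using card_mono[of "N v - {x}" "sub v x y \<union> (sub v x p \<union> sub v x w)"] fs
        by (simp add: card_Un_disjoint)
      then show ?thesis using sub_ge2[OF vx y] by simp
    qed
    have s2': "card (sub a b c) = 2" if abc: "E a b" "E a c" "c \<noteq> b" for a b c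
    proof -
      obtain y where y: "E v y" "y \<noteq> x" "orb v x y a b c" using orb_transport[OF vx abc] by blast
      show ?thesis using card_sub_orb[OF vx y(1,3)] s2[OF y(1,2)] by simp
    qed
    obtain a b c where abc: "E a b" "E a c" "b \<noteq> c" "\<not> orb a b c a c b"
      using nonrev_ex s2' c2 k7 by fastforce
    obtain y where y: "E v y" "y \<noteq> x" "orb v x y a b c" using orb_transport[OF vx abc(1,2)] abc(3) by metis
    have nr: "\<not> orb v x y v y x" using abc(4) rev_orb[OF orb_sym[OF y(3)]] by blast
    obtain z where z: "E v z" "z \<noteq> x" "orb v x z v y x" using transport[OF vx y(1) vx y(2)] by blast
    have nrz: "\<not> orb v x z v z x"
    proof
      assume "orb v x z v z x"
      then have "orb v y x v x y" using rev_orb[OF orb_sym[OF z(3)]] by blast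
      then show False using nr orb_sym by blast
    qed
    have zy: "z \<notin> sub v x y" using in_sub_orb[OF _ z(3)] nr by blast
    obtain y' where y': "sub v x y = {y, y'}" "y' \<noteq> y" "E v y'" "y' \<noteq> x" "orb v y y' v y' y"
      using pair[OF y(1,2) s2[OF y(1,2)]] by blast
    obtain r where r: "E v r" "r \<noteq> x" "orb v x r v y y'" using transport[OF vx y(1) y'(3)] y'(2) by metis
    have rrev: "orb v x r v r x" using rev_orb[OF r(3) y'(5)] .
    have nosub: "t \<notin> sub v x y" "t \<notin> sub v x z" if "orb v x t v t x" for t
    proof -
      have "orb v x s v s x" if "t \<in> sub v x s" for s
        using rev_orb[of v x s v x t] \<open>orb v x t v t x\<close> that unfolding sub_def by blast
      then show "t \<notin> sub v x y" "t \<notin> sub v x z" using nr nrz by blast+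
    qed
    obtain r' where r': "sub v x r = {r, r'}" "r' \<noteq> r" "E v r'" "r' \<noteq> x" "orb v r r' v r' r"
      using pair[OF r(1,2) s2[OF r(1,2)]] by blast
    obtain t where t: "E v t" "t \<noteq> x" "orb v x t v r r'" using transport[OF vx r(1) r'(3)] r'(2) by metis
    have trev: "orb v x t v t x" using rev_orb[OF t(3) r'(5)] .
    have f: "finite (sub v x y)" "finite (sub v x z)" "finite (sub v x r)" "finite (sub v x t)"
      using fin_sub_orb[OF vx] y z r t by blast+
    have "t \<in> sub v x r"
    proof (rule ccontr)
      assume tr: "t \<notin> sub v x r"
      have d: "sub v x y \<inter> sub v x z = {}" "(sub v x y \<union> sub v x z) \<inter> (sub v x r \<union> sub v x t) = {}"
        "sub v x r \<inter> sub v x t = {}"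
        using sub_disj[OF zy] sub_disj[OF nosub(1)[OF rrev]] sub_disj[OF nosub(2)[OF rrev]]
          sub_disj[OF nosub(1)[OF trev]] sub_disj[OF nosub(2)[OF trev]] sub_disj[OF tr] by blast+
      have "card ((sub v x y \<union> sub v x z) \<union> (sub v x r \<union> sub v x t)) = 8"
        using d f s2[OF y(1,2)] s2[OF z(1,2)] s2[OF r(1,2)] s2[OF t(1,2)] by (simp add: card_Un_disjoint)
      moreover have "(sub v x y \<union> sub v x z) \<union> (sub v x r \<union> sub v x t) \<subseteq> N v"
        using sub_subset[OF vx] y z r t by blast
      ultimately have "8 \<le> card (N v)" by (metis card_mono fin_N)
      then show False using card_N[OF E_V(1)[OF vx]] k7 by simp
    qed
    then have "orb v x r v r r'" using in_sub_orb t(3) by blast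
    then show False using notri[OF r(1,2) r'(1,2,5)] by blast
  qed
qed

text \<open>Divisibility by 6 makes \<open>c2\<close> even, and 6 is excluded. The value 4 fails
  because \<open>k2 * c2 = 42\<close>.\<close>

lemma c2_2: "c2 = 2"
proof -
  obtain v x where vx: "E v x" using edge_ex V_nonempty by blast
  obtain y where y: "E v y" "y \<noteq> x" using other_orbit[OF vx] by blast
  have "6 dvd 3 * c2" using sub_dvd[OF vx y] all_sub3[OF vx y] k7 by simp
  moreover have "k2 * c2 = 42" using k2_c2[unfolded k7 tf] by (simp del: One_nat_def)
  then have "c2 dvd 42" by (metis dvd_triv_right)
  ultimately show ?thesis
  proof -
    assume d: "6 dvd 3 * c2" "c2 dvd 42"
    have "c2 = 2 \<or> c2 = 4" using d(1) c2_pos c2_le c2_neq k7 by presburger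
    then show ?thesis using d(2) by auto
  qed
qed

lemma two_arc_orbit:
  obtains v x y where "E v x" "E v y" "x \<noteq> y" "\<not> orb v x y v y x"
  using nonrev_ex all_sub3 c2_2 k7 by fastforce

end

section \<open>Graphs with triangles\<close>

lemma even_card_involution:
  assumes "finite A" "\<And>x. x \<in> A \<Longrightarrow> f x \<in> A" "\<And>x. x \<in> A \<Longrightarrow> f (f x) = x" "\<And>x. x \<in> A \<Longrightarrow> f x \<noteq> x"
  shows "even (card A)"
  using assms
proof (induction "card A" arbitrary: A rule: less_induct)
  case less
  show ?case
  proof (cases "A = {}")
    case False
    then obtain x where x: "x \<in> A" by blast
    let ?B = "A - {x, f x}"
    have c: "card ?B + 2 = card A"
    proof -
      have "card {x, f x} = 2" using less.prems(4)[OF x] by auto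
      moreover have "{x, f x} \<subseteq> A" using x less.prems(2) by blast
      ultimately show ?thesis
        using card_Diff_subset[of "{x, f x}" A] card_mono[OF less.prems(1), of "{x, f x}"] by simp
    qed
    have "even (card ?B)"
    proof (rule less.hyps)
      show "card ?B < card A" using c by simp
      show "finite ?B" using less.prems(1) by simp
      show "f (f y) = y" "f y \<noteq> y" if "y \<in> ?B" for y using that less.prems by auto
      show "f y \<in> ?B" if "y \<in> ?B" for y
        using that less.prems(2,3) x by (metis DiffD1 DiffD2 DiffI insert_iff singletonD)
    qed
    then show ?thesis using c by (metis even_add even_numeral)
  qed simp
qed

text \<open>The labelling walks along the relation and never turns back: \<open>oth x p\<close> is
  the neighbour of \<open>x\<close> other than \<open>p\<close>. It is periodic on all natural
  numbers, and \<open>i + card A - 1\<close> stands for \<open>i - 1\<close> so that no subtraction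
  below zero occurs.\<close>

lemma cycle_labelling:
  fixes r :: "'a \<Rightarrow> 'a \<Rightarrow> bool"
  assumes finA: "finite A" and ne: "A \<noteq> {}"
    and rA: "\<And>x y. r x y \<Longrightarrow> x \<in> A \<and> y \<in> A"
    and sym: "\<And>x y. r x y \<Longrightarrow> r y x" and irr: "\<And>x. \<not> r x x"
    and val: "\<And>x. x \<in> A \<Longrightarrow> card {y. r x y} = 2"
    and conn: "\<And>C. C \<subseteq> A \<Longrightarrow> C \<noteq> {} \<Longrightarrow> (\<And>x y. x \<in> C \<Longrightarrow> r x y \<Longrightarrow> y \<in> C) \<Longrightarrow> C = A"
  obtains l :: "nat \<Rightarrow> 'a" where "\<And>i j. l i = l j \<longleftrightarrow> i mod card A = j mod card A"
    "range l = A" "\<And>i y. r (l i) y \<longleftrightarrow> y = l (i + 1) \<or> y = l (i + card A - 1)"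
proof -
  define oth where "oth = (\<lambda>x p. SOME y. r x y \<and> y \<noteq> p)"
  have oth: "{y. r x y} = {p, oth x p} \<and> oth x p \<noteq> p" if xp: "r x p" for x p
  proof -
    obtain a b where ab: "{y. r x y} = {a, b}" "a \<noteq> b" using val[of x] rA[OF xp] card_2_iff by metis
    have "p \<in> {a, b}" using ab xp by blast
    then have "\<exists>y. r x y \<and> y \<noteq> p" using ab by auto
    then have o: "r x (oth x p) \<and> oth x p \<noteq> p" unfolding oth_def by (rule someI_ex)
    then have "oth x p \<in> {a, b}" using ab by blast
    then show ?thesis using ab \<open>p \<in> {a, b}\<close> o by auto
  qed
  obtain a0 where a0: "a0 \<in> A" using ne by blast
  obtain b0 where b0: "r a0 b0" using val[OF a0] by (metis card.empty empty_Collect_eq zero_neq_numeral)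
  define s where "s = (\<lambda>n. ((\<lambda>(a, b). (b, oth b a)) ^^ n) (a0, b0))"
  define l where "l = (\<lambda>n. fst (s n))"
  have s_Suc: "s (Suc n) = (snd (s n), oth (snd (s n)) (fst (s n)))" for n
    unfolding s_def by (simp add: case_prod_beta)
  have s_l: "s n = (l n, l (Suc n))" for n
    unfolding l_def by (simp add: s_Suc)
  have r_l: "r (l n) (l (Suc n))" for n
  proof (induction n)
    case 0
    show ?case using b0 s_l[of 0] by (simp add: s_def)
  next
    case (Suc n)
    have "l (Suc (Suc n)) = oth (l (Suc n)) (l n)" using s_Suc[of n] s_Suc[of "Suc n"] s_l by (metis fst_conv l_def snd_conv)
    then show ?case using oth[OF sym[OF Suc]] by (metis insertI1 insert_commute mem_Collect_eq)
  qed
  have l_SS: "l (Suc (Suc n)) = oth (l (Suc n)) (l n)" for n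
    using s_Suc[of n] s_Suc[of "Suc n"] s_l by (metis fst_conv l_def snd_conv)
  have nb: "{y. r (l (Suc n)) y} = {l n, l (Suc (Suc n))}" "l (Suc (Suc n)) \<noteq> l n" for n
    using oth[OF sym[OF r_l[of n]]] l_SS by auto
  have lA: "l n \<in> A" for n using rA r_l by blast
  have l1: "l (Suc n) \<noteq> l n" for n using r_l irr by metis
  have "\<not> inj l"
    using finA lA by (metis finite_imageD finite_subset image_subsetI infinite_UNIV_nat)
  then have "\<exists>j. \<exists>i<j. l j = l i" unfolding inj_def by (metis linorder_neqE_nat)
  then obtain j where j: "\<exists>i<j. l j = l i" "\<And>j'. j' < j \<Longrightarrow> \<not> (\<exists>i<j'. l j' = l i)"
    using exists_least_iff[of "\<lambda>j. \<exists>i<j. l j = l i"] by blast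
  then obtain i where i: "i < j" "l j = l i" by blast
  have inj: "a = b" if "a < j" "b < j" "l a = l b" for a b
    using j(2) that by (metis linorder_neqE_nat)
  have i0: "i = 0"
  proof (rule ccontr)
    assume "i \<noteq> 0"
    then obtain i' where i': "i = Suc i'" by (cases i) auto
    obtain j' where j': "j = Suc j'" using i by (cases j) auto
    have "r (l i) (l j')" using r_l[of j'] sym i(2) j' by simp
    then have "l j' = l i' \<or> l j' = l (Suc i)" using nb(1)[of i'] i' by blast
    then show False
    proof
      assume "l j' = l i'"
      then show False using inj[of j' i'] i j' i' by simp
    next
      assume e: "l j' = l (Suc i)"
      show False
      proof (cases "Suc i < j")
        case True
        then have "j' = Suc i" using inj[OF _ True e] j' by simp
        then show False using nb(2)[of i] i j' by simp
      next
        case False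
        then have "j = Suc i" using i by simp
        then show False using l1[of i] i by simp
      qed
    qed
  qed
  have lj: "l j = l 0" using i i0 by simp
  have j3: "j \<ge> 3"
  proof -
    have "j \<noteq> 0" "j \<noteq> 1" "j \<noteq> 2" using i i0 lj l1[of 0] nb(2)[of 0] by (auto simp: numeral_2_eq_2)
    then show ?thesis by simp
  qed
  define m where "m = j - 1"
  have m: "j = Suc m" "m \<ge> 2" using j3 unfolding m_def by auto
  have r0m: "r (l 0) (l m)" using r_l[of m] sym lj m by simp
  have "l 1 \<noteq> l m" using inj[of 1 m] m by auto
  have nb0: "{y. r (l 0) y} = {l 1, l m}"
  proof -
    have "{y. r (l 0) y} = {l m, oth (l 0) (l m)}" using oth[OF r0m] by simp
    moreover have "l 1 \<in> {y. r (l 0) y}" using r_l[of 0] by simp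
    ultimately show ?thesis using \<open>l 1 \<noteq> l m\<close> by auto
  qed
  have "l (Suc j) = l 1"
  proof -
    have "{l 1, l m} = {l m, l (Suc j)}" using nb[of m] lj m nb0 by simp
    then show ?thesis using nb(2)[of m] m by (metis doubleton_eq_iff)
  qed
  then have sj: "s j = s 0" using s_l lj by simp
  have per: "s (n + j) = s n" for n
    unfolding s_def using sj unfolding s_def by (simp add: funpow_add)
  have lper: "l (n + j) = l n" for n unfolding l_def using per by simp
  have lmod: "l n = l (n mod j)" for n
  proof -
    have "l (a + b * j) = l a" for a b
      by (induction b) (simp_all add: lper[of "a + _ * j", symmetric] algebra_simps)
    then show ?thesis by (metis mod_mult_div_eq mult.commute)
  qed
  have nbr: "r (l i) y \<longleftrightarrow> y = l (i + 1) \<or> y = l (i + j - 1)" for i y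
  proof (cases i)
    case 0
    then show ?thesis using nb0 m by auto
  next
    case (Suc i')
    then show ?thesis using nb(1)[of i'] lper[of i'] by auto
  qed
  have "range l = A"
    by (rule conn) (use lA nbr in auto)
  moreover have lj': "l ` {..<j} = range l"
  proof
    show "range l \<subseteq> l ` {..<j}" using lmod j3 by (metis image_subsetI imageI lessThan_iff mod_less_divisor not_gr0 not_numeral_le_zero)
  qed auto
  moreover have "card (l ` {..<j}) = j"
    using card_image[of l "{..<j}"] inj unfolding inj_on_def by (metis card_lessThan lessThan_iff)
  ultimately have cA: "card A = j" by simp
  have eqs: "l a = l b \<longleftrightarrow> a mod card A = b mod card A" for a b
    unfolding cA using lmod inj j3 by (metis mod_less_divisor not_gr0 not_numeral_le_zero)
  show ?thesis
    by (rule that[OF eqs \<open>range l = A\<close>]) (use nbr cA in simp)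
qed

section \<open>Symmetric invariant relations of small valency\<close>

context dt_graph
begin

definition symrel :: "('a \<Rightarrow> 'a \<Rightarrow> 'a \<Rightarrow> bool) \<Rightarrow> nat \<Rightarrow> bool" where
  "symrel R d \<longleftrightarrow> inv3 R \<and> (\<forall>v x y. R v x y \<longrightarrow> R v y x) \<and> (\<forall>v x. \<not> R v x x) \<and>
     (\<forall>v x. E v x \<longrightarrow> card {y. R v x y} = d)"

lemma symrel_I:
  assumes R: "inv3 R" and "\<And>v x y. R v x y \<Longrightarrow> R v y x" "\<And>v x. \<not> R v x x"
    and "E v x" "card {y. R v x y} = d"
  shows "symrel R d"
proof -
  have "card {y. R a b y} = d" if "E a b" for a b using inv3_val[OF R that assms(4)] assms(5) by simp
  then show ?thesis unfolding symrel_def using R assms(2,3) by blast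
qed

lemma symrelD:
  assumes "symrel R d"
  shows "inv3 R" "R v x y \<Longrightarrow> R v y x" "\<not> R v x x" "E v x \<Longrightarrow> card {y. R v x y} = d"
    "R v x y \<Longrightarrow> E v x" "R v x y \<Longrightarrow> E v y"
  using assms inv3_E unfolding symrel_def by blast+

text \<open>Being joined by a path is an invariant equivalence relation, and positive valency makes
  it nontrivial. So primitivity makes every such relation connected on the neighbourhood.\<close>

lemma symrel_connected:
  assumes R: "symrel R d" and d: "d > 0" and C: "x \<in> C" "E v x" "\<And>a b. a \<in> C \<Longrightarrow> R v a b \<Longrightarrow> b \<in> C"
    and y: "E v y"
  shows "y \<in> C"
proof -
  define S where "S = (\<lambda>v a b. E v a \<and> E v b \<and> (a, b) \<in> {(a, b). R v a b}\<^sup>*)"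
  have S: "inv3 S"
  proof -
    have "(g a, g b) \<in> {(a, b). R (g v) a b}\<^sup>*" if "g \<in> G" "(a, b) \<in> {(a, b). R v a b}\<^sup>*" for g v a b
      using that(2)
    proof (induction rule: rtrancl_induct)
      case (step b c)
      have "R (g v) (g b) (g c)" using inv3_iff[OF symrelD(1)[OF R] that(1)] step by simp
      then show ?case using step by (meson case_prodI mem_Collect_eq rtrancl.rtrancl_into_rtrancl)
    qed simp
    then show ?thesis unfolding inv3_def S_def by simp
  qed
  have s: "S v b a" if "S v a b" for a b
  proof -
    have "sym {(a, b). R v a b}" using symrelD(2)[OF R] unfolding sym_def by blast
    from symD[OF sym_rtrancl[OF this], of a b] show ?thesis using that unfolding S_def by blast
  qed
  have t: "S v a c" if "S v a b" "S v b c" for a b c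
    using that unfolding S_def by (meson rtrancl_trans)
  have "card {z. R v x z} > 0" using symrelD(4)[OF R C(2)] d by simp
  then obtain z where z: "R v x z" by (metis card.empty empty_Collect_eq less_irrefl)
  have "S v x y"
  proof (rule block_dichotomy[OF S])
    show "S v b a" if "S v a b" for a b by (rule s[OF that])
    show "S v a c" if "S v a b" "S v b c" for a b c by (rule t[OF that])
    show "S v x z" using z symrelD(5,6)[OF R z] unfolding S_def by blast
    show "x \<noteq> z" using z symrelD(3)[OF R] by blast
  qed (use E_V C y in \<open>auto simp: S_def\<close>)
  then have "(x, y) \<in> {(a, b). R v a b}\<^sup>*" unfolding S_def by blast
  then show ?thesis by (induction rule: rtrancl_induct) (use C in auto)
qed

lemma symrel_closed_card:
  assumes R: "symrel R d" and d: "d > 0" and C: "x \<in> C" "E v x" "\<And>a b. a \<in> C \<Longrightarrow> R v a b \<Longrightarrow> b \<in> C"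
    and fin: "finite C"
  shows "k \<le> card C"
proof -
  have "N v \<subseteq> C" using symrel_connected[OF R d C(1,2,3)] by auto
  then show ?thesis using card_mono[OF fin] card_N[OF E_V(1)[OF C(2)]] by metis
qed

text \<open>A perfect matching is disconnected as soon as there are more than two points.\<close>

lemma symrel_not1: assumes R: "symrel R 1" and k: "k \<ge> 3" shows False
proof -
  obtain v x where vx: "E v x" using edge_ex V_nonempty by blast
  obtain y where y: "{y. R v x y} = {y}" using symrelD(4)[OF R vx] card_1_singletonE by blast
  have vy: "E v y" "R v y x" using y symrelD(2,6)[OF R] by blast+
  obtain z where z: "{z. R v y z} = {z}" using symrelD(4)[OF R vy(1)] card_1_singletonE by blast
  have "x \<in> {z. R v y z}" using vy by simp
  then have zx: "z = x" unfolding z by simp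
  have "k \<le> card {x, y}"
  proof (rule symrel_closed_card[OF R _ _ vx])
    fix a b assume "a \<in> {x, y}" "R v a b"
    then show "b \<in> {x, y}" using y z zx by blast
  qed auto
  then show False using k by (simp add: card_insert_if split: if_splits)
qed

lemma symrel2_labelling:
  assumes R: "symrel R 2" and v: "v \<in> V"
  obtains l :: "nat \<Rightarrow> 'a" where "\<And>i j. l i = l j \<longleftrightarrow> i mod k = j mod k" "range l = N v"
    "\<And>i y. R v (l i) y \<longleftrightarrow> y = l (i + 1) \<or> y = l (i + k - 1)"
proof -
  have ne: "N v \<noteq> {}" using edge_ex[OF v] by auto
  have "C = N v" if C: "C \<subseteq> N v" "C \<noteq> {}" "\<And>x y. x \<in> C \<Longrightarrow> R v x y \<Longrightarrow> y \<in> C" for C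
  proof -
    obtain x where x: "x \<in> C" using C(2) by blast
    have "y \<in> C" if "E v y" for y
      by (rule symrel_connected[OF R _ x _ C(3) that]) (use x C(1) in auto)
    then show ?thesis using C(1) by auto
  qed
  then obtain l where l: "\<And>i j. l i = l j \<longleftrightarrow> i mod card (N v) = j mod card (N v)"
    "range l = N v" "\<And>i y. R v (l i) y \<longleftrightarrow> y = l (i + 1) \<or> y = l (i + card (N v) - 1)"
    using cycle_labelling[of "N v" "R v"] ne symrelD[OF R] by (smt (verit) fin_N in_N)
  show ?thesis by (rule that[of l]) (use l card_N[OF v] in simp_all)
qed

text \<open>A cycle of even length is bipartite, and its two colour classes, the classes generated
  by steps of length two, are blocks.\<close>

lemma symrel2_not_even: assumes R: "symrel R 2" and k: "even k" "k \<ge> 3" shows False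
proof -
  obtain v where v: "v \<in> V" using V_nonempty by blast
  obtain l :: "nat \<Rightarrow> 'a" where l: "\<And>i j. l i = l j \<longleftrightarrow> i mod k = j mod k" "range l = N v"
    "\<And>i y. R v (l i) y \<longleftrightarrow> y = l (i + 1) \<or> y = l (i + k - 1)"
    by (rule symrel2_labelling[OF R v], rule that, assumption+)
  define S where "S = (\<lambda>v a b. E v a \<and> E v b \<and> (a, b) \<in> {(a, c). \<exists>b. R v a b \<and> R v b c}\<^sup>*)"
  have S: "inv3 S"
  proof -
    have "(g a, g b) \<in> {(a, c). \<exists>b. R (g v) a b \<and> R (g v) b c}\<^sup>*"
      if "g \<in> G" "(a, b) \<in> {(a, c). \<exists>b. R v a b \<and> R v b c}\<^sup>*" for g v a b
      using that(2)
    proof (induction rule: rtrancl_induct)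
      case (step b c)
      then obtain d where "R v b d" "R v d c" by blast
      then have "R (g v) (g b) (g d)" "R (g v) (g d) (g c)"
        using inv3_iff[OF symrelD(1)[OF R] that(1)] by simp_all
      then show ?case using step(3) by (intro rtrancl_into_rtrancl[OF step(3)]) blast
    qed simp
    then show ?thesis unfolding inv3_def S_def by simp
  qed
  have s: "S v b a" if "S v a b" for a b
  proof -
    have "sym {(a, c). \<exists>b. R v a b \<and> R v b c}" using symrelD(2)[OF R] unfolding sym_def by blast
    from symD[OF sym_rtrancl[OF this], of a b] show ?thesis using that unfolding S_def by blast
  qed
  have t: "S v a c" if "S v a b" "S v b c" for a b c
    using that unfolding S_def by (meson rtrancl_trans)
  have E: "E v (l i)" for i using l(2) by auto
  have "S v (l 0) (l 1)"
  proof (rule block_dichotomy[OF S v])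
    show "S v b a" if "S v a b" for a b by (rule s[OF that])
    show "S v a c" if "S v a b" "S v b c" for a b c by (rule t[OF that])
    have "R v (l 0) (l 1)" "R v (l 1) (l 2)" using l(3) by (simp_all add: numeral_2_eq_2)
    then show "S v (l 0) (l 2)" using E unfolding S_def by blast
    show "l 0 \<noteq> l 2" using k by (auto simp: l(1))
  qed (use E in \<open>auto simp: S_def\<close>)
  then have "(l 0, l 1) \<in> {(a, c). \<exists>b. R v a b \<and> R v b c}\<^sup>*" unfolding S_def by blast
  then have "\<exists>i. even i \<and> l 1 = l i"
  proof (induction rule: rtrancl_induct)
    case (step y z)
    then obtain i where i: "even i" "y = l i" by blast
    have "\<exists>b. R v y b \<and> R v b z" using step(2) by simp
    then obtain b where "R v (l i) b" "R v b z" unfolding i(2) by blast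
    have o: "odd (i + 1)" "odd (i + k - 1)" using i(1) k by auto
    then obtain i' where i': "odd i'" "b = l i'" using l(3)[of i b] \<open>R v (l i) b\<close> by blast
    have "even (i' + 1)" "even (i' + k - 1)" using i'(1) k by auto
    then obtain i'' where "even i''" "z = l i''" using l(3)[of i' z] \<open>R v b z\<close> i'(2) by blast
    then show ?case by blast
  qed (auto intro: exI[of _ 0])
  then obtain i where "even i" "i mod k = 1 mod k" using l(1) by metis
  then show False using k by (metis One_nat_def dvd_mod_iff odd_one)
qed

text \<open>The number of ordered related pairs would be 21, but swapping the entries shows that it
  is even.\<close>

lemma symrel3_not7: assumes R: "symrel R 3" and k: "k = 7" shows False
proof -
  obtain v where v: "v \<in> V" using V_nonempty by blast
  let ?P = "SIGMA x:N v. {y. R v x y}"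
  have "card ?P = 21" using symrelD(4)[OF R] card_N[OF v] k inv3_fin(1)[OF symrelD(1)[OF R]]
    by (simp add: card_SigmaI)
  moreover have "even (card ?P)"
  proof (rule even_card_involution[where f = prod.swap])
    show "finite ?P" using inv3_fin(1)[OF symrelD(1)[OF R]] by simp
    fix p assume "p \<in> ?P"
    then obtain a b where ab: "p = (a, b)" "R v a b" by blast
    have "R v b a" "E v b" "a \<noteq> b" using symrelD(2,3,6)[OF R] ab(2) by blast+
    then show "prod.swap p \<in> ?P" "prod.swap p \<noteq> p" using ab(1) by auto
  qed simp
  ultimately show False by simp
qed

text \<open>Such a graph is triangle-free, and the pairs of non-adjacent vertices with a given number of common
  neighbours form an invariant relation; counting forces one of these to have valency 1 or 2.\<close>

lemma symrel3_not8: assumes R: "symrel R 3" and k: "k = 8" shows False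
proof -
  have R': "inv3 R" using symrelD(1)[OF R] .
  obtain v x where vx: "E v x" using edge_ex V_nonempty by blast
  have vV: "v \<in> V" using E_V vx by blast
  define lam where "lam = (\<lambda>v x y. card {z. R v x z \<and> R v y z})"
  have lam_G: "lam (g v) (g x) (g y) = lam v x y" if "g \<in> G" for g v x y
    unfolding lam_def by (rule card_Collect_G[OF that]) (simp add: inv3_iff[OF R' that])
  have lam_sym: "lam v x y = lam v y x" for v x y
    unfolding lam_def by (rule arg_cong[of _ _ card]) blast
  define Q where "Q = (\<lambda>i v x y. E v x \<and> E v y \<and> x \<noteq> y \<and> R v x y \<and> lam v x y = i)"
  define P where "P = (\<lambda>i v x y. E v x \<and> E v y \<and> x \<noteq> y \<and> \<not> R v x y \<and> lam v x y = i)"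
  have Rs: "R v y x \<longleftrightarrow> R v x y" for v x y using symrelD(2)[OF R] by blast
  have Qs: "symrel (Q i) (card {y. Q i v x y})" for i
  proof (rule symrel_I[OF _ _ _ vx])
    show "Q i v y x" if "Q i v x y" for v x y
      using that lam_sym[of v y x] Rs[of v y x] unfolding Q_def by blast
  qed (simp_all add: inv3_def Q_def lam_G inv3_iff[OF R'])
  have Ps: "symrel (P i) (card {y. P i v x y})" for i
  proof (rule symrel_I[OF _ _ _ vx])
    show "P i v y x" if "P i v x y" for v x y
      using that lam_sym[of v y x] Rs[of v y x] unfolding P_def by blast
  qed (simp_all add: inv3_def P_def lam_G inv3_iff[OF R'])
  have Q1: "card {y. Q i v x y} \<noteq> 1" for i using symrel_not1 Qs[of i] k by force
  have P1: "card {y. P i v x y} \<noteq> 1" for i using symrel_not1 Ps[of i] k by force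
  have P2: "card {y. P i v x y} \<noteq> 2" for i using symrel2_not_even Ps[of i] k by force
  have fR: "finite {y. R v z y}" for z using inv3_fin(1)[OF R'] .
  obtain a b c where abc: "{y. R v x y} = {a, b, c}" "a \<noteq> b" "b \<noteq> c" "a \<noteq> c"
    using symrelD(4)[OF R vx] by (auto simp: card_3_iff)
  have xa: "R v x a" "R v x b" "R v x c" using abc by blast+
  have Rx: "R v x z \<longleftrightarrow> z = a \<or> z = b \<or> z = c" for z using abc(1) by blast
  have xabc: "x \<noteq> a" "x \<noteq> b" "x \<noteq> c" using xa symrelD(3)[OF R] by metis+
  have card4: "card {x, a, b, c} = 4" using xabc abc by simp
  have sy: "R v y z \<longleftrightarrow> R v z y" for y z using symrelD(2)[OF R] by blast
  have irr: "\<not> R v z z" for z using symrelD(3)[OF R] .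
  have Qset: "{y. Q i v x y} = {y \<in> {a, b, c}. lam v x y = i}" for i
  proof -
    have "E v a" "E v b" "E v c" "x \<noteq> a" "x \<noteq> b" "x \<noteq> c" using symrelD(6)[OF R] xa irr by blast+
    then show ?thesis using vx unfolding Q_def by (auto simp: Rx)
  qed
  have lam_x: "lam v x y = card {z \<in> {a, b, c}. R v y z}" for y
    unfolding lam_def by (rule arg_cong[of _ _ card]) (auto simp: Rx)
  \<comment> \<open>With exactly one or two related pairs among \<open>a\<close>, \<open>b\<close>,
    \<open>c\<close>, the value 0 or 2 of \<open>lam\<close> is taken exactly once, which gives an
    invariant relation of valency 1. With all three, {\<open>x\<close>, \<open>a\<close>,
    \<open>b\<close>, \<open>c\<close>} is a connected component of size 4.\<close>
  have free: "\<not> R v a b \<and> \<not> R v b c \<and> \<not> R v a c"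
  proof (rule ccontr)
    assume n: "\<not> ?thesis"
    have la: "lam v x a = of_bool (R v a b) + of_bool (R v a c)"
      "lam v x b = of_bool (R v a b) + of_bool (R v b c)"
      "lam v x c = of_bool (R v a c) + of_bool (R v b c)"
    proof -
      have S: "{z \<in> {a, b, c}. R v y z} = (if R v y a then {a} else {}) \<union> (if R v y b then {b} else {}) \<union> (if R v y c then {c} else {})" for y
        by auto
      show "lam v x a = of_bool (R v a b) + of_bool (R v a c)"
        "lam v x b = of_bool (R v a b) + of_bool (R v b c)"
        "lam v x c = of_bool (R v a c) + of_bool (R v b c)"
        unfolding lam_x S using abc irr sy[of b a] sy[of c a] sy[of c b] by auto
    qed
    have Qc: "card {y \<in> {a, b, c}. lam v x y = i} = of_bool (lam v x a = i) + of_bool (lam v x b = i) + of_bool (lam v x c = i)" for i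
    proof -
      have "{y \<in> {a, b, c}. lam v x y = i} = (if lam v x a = i then {a} else {}) \<union> (if lam v x b = i then {b} else {}) \<union> (if lam v x c = i then {c} else {})"
        by auto
      then show ?thesis using abc by auto
    qed
    have "R v a b \<and> R v b c \<and> R v a c"
      using n Q1[of 0] Q1[of 2] unfolding Qset Qc la
      by (cases "R v a b"; cases "R v b c"; cases "R v a c") simp_all
    then have all: "R v a b" "R v b c" "R v a c" by blast+
    have nbs: "{y. R v p y} \<subseteq> {x, a, b, c}" if "p \<in> {a, b, c}" for p
    proof -
      have vp: "E v p" using that symrelD(6)[OF R] xa by blast
      have "card ({x, a, b, c} - {p}) = 3" using that card4 by (simp add: card_Diff_singleton_if)
      moreover have "{x, a, b, c} - {p} \<subseteq> {y. R v p y}" using that all xa sy by auto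
      ultimately have "{x, a, b, c} - {p} = {y. R v p y}"
        using card_subset_eq[OF fR] symrelD(4)[OF R vp] by metis
      then show ?thesis by blast
    qed
    have "k \<le> card {x, a, b, c}"
    proof (rule symrel_closed_card[OF R _ _ vx])
      fix p q assume "p \<in> {x, a, b, c}" "R v p q"
      then show "q \<in> {x, a, b, c}" using nbs Rx by blast
    qed auto
    also have "\<dots> \<le> 4" by (simp add: card_insert_if)
    finally show False using k by simp
  qed
  \<comment> \<open>Three common neighbours make \<open>x\<close> and \<open>y\<close> twins. Being
    twins is an equivalence relation, so by primitivity \<open>x\<close> would be a twin of its own
    neighbour \<open>a\<close>, and \<open>a\<close> would be related to itself.\<close>
  have l3: "lam v x y \<noteq> 3" if vy: "E v y" and xy: "x \<noteq> y" for y
  proof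
    assume l: "lam v x y = 3"
    define T where "T = (\<lambda>v a b. E v a \<and> E v b \<and> (\<forall>z. R v a z \<longleftrightarrow> R v b z))"
    have T: "inv3 T" unfolding inv3_def T_def
    proof (intro conjI ballI allI impI)
      fix g v a b z assume g: "g \<in> G" and t: "E v a \<and> E v b \<and> (\<forall>z. R v a z \<longleftrightarrow> R v b z)"
      have "R (g v) (g a) (g (inv g z)) \<longleftrightarrow> R (g v) (g b) (g (inv g z))"
        unfolding inv3_iff[OF R' g] using t by blast
      then show "R (g v) (g a) z \<longleftrightarrow> R (g v) (g b) z" using g by simp
    qed auto
    have "{z. R v x z \<and> R v y z} = {z. R v x z}"
      by (rule card_subset_eq[OF fR]) (use l symrelD(4)[OF R vx] lam_def in auto)
    moreover have "{z. R v x z \<and> R v y z} = {z. R v y z}"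
      by (rule card_subset_eq[OF fR]) (use l symrelD(4)[OF R vy] lam_def in auto)
    ultimately have "T v x y" using vx vy unfolding T_def by blast
    moreover have "E v a" using symrelD(6)[OF R xa(1)] .
    ultimately have "T v x a"
    proof (intro block_dichotomy[OF T vV _ _ _ _ xy, where a = x and b = a])
      show "T v c b" if "T v b c" for b c using that unfolding T_def by blast
      show "T v b d" if "T v b c" "T v c d" for b c d using that unfolding T_def by blast
      show "T v b b" if "E v b" for b using that unfolding T_def by blast
    qed (assumption | rule vx)+
    then show False using xa(1) irr unfolding T_def by blast
  qed
  define A where "A = {y. E v y \<and> x \<noteq> y \<and> \<not> R v x y}"
  have finA: "finite A" unfolding A_def by simp
  have cA: "card A = 4"
  proof -
    have "y \<in> A \<longleftrightarrow> y \<in> N v - {x, a, b, c}" for y by (simp add: A_def Rx) metis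
    then have "A = N v - {x, a, b, c}" by blast
    moreover have "{x, a, b, c} \<subseteq> N v" using vx symrelD(6)[OF R] xa by auto
    moreover note card4
    ultimately show ?thesis using card_N[OF vV] k by (simp add: card_Diff_subset)
  qed
  have sum6: "(\<Sum>y\<in>A. lam v x y) = 6"
  proof -
    have "(\<Sum>y\<in>A. card {z \<in> {a, b, c}. R v y z}) = (\<Sum>z\<in>{a, b, c}. 2)"
    proof (rule sum_multicount_gen[OF finA])
      show "\<forall>z\<in>{a, b, c}. card {y \<in> A. R v y z} = 2"
      proof
        fix z assume z: "z \<in> {a, b, c}"
        then have vz: "E v z" "R v x z" using symrelD(6)[OF R] xa by blast+
        have "{y \<in> A. R v y z} = {y. R v z y} - {x}"
          using z free sy symrelD(6)[OF R] irr unfolding A_def Rx by auto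
        moreover have "x \<in> {y. R v z y}" using vz sy by blast
        ultimately show "card {y \<in> A. R v y z} = 2" using symrelD(4)[OF R vz(1)] fR by simp
      qed
    qed simp
    then show ?thesis using abc by (simp add: lam_x)
  qed
  have le2: "lam v x y \<le> 2" if "y \<in> A" for y
  proof -
    have "lam v x y \<le> card {a, b, c}" unfolding lam_x by (rule card_mono) auto
    then have "lam v x y \<le> 3" using abc by simp
    then show ?thesis using l3 that unfolding A_def by force
  qed
  have PA: "{y. P i v x y} = {y \<in> A. lam v x y = i}" for i unfolding P_def A_def using vx by auto
  have cnt: "card {y \<in> A. lam v x y = i} = (\<Sum>y\<in>A. of_bool (lam v x y = i))" for i
  proof -
    have "{y \<in> A. lam v x y = i} = A \<inter> {y. lam v x y = i}" by blast
    then show ?thesis using finA by (simp add: sum_of_bool_eq)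
  qed
  have "(\<Sum>y\<in>A. lam v x y) = (\<Sum>y\<in>A. of_bool (lam v x y = 1) + 2 * of_bool (lam v x y = 2))"
  proof (rule sum.cong)
    fix y assume "y \<in> A"
    then show "lam v x y = of_bool (lam v x y = 1) + 2 * of_bool (lam v x y = 2)" using le2[of y] by auto
  qed simp
  then have 1: "card {y \<in> A. lam v x y = 1} + 2 * card {y \<in> A. lam v x y = 2} = 6"
    unfolding cnt sum6 by (simp add: sum.distrib sum_distrib_left)
  have "card A = (\<Sum>y\<in>A. of_bool (lam v x y = 0) + of_bool (lam v x y = 1) + of_bool (lam v x y = 2))"
  proof -
    have "card A = (\<Sum>y\<in>A. 1)" by simp
    also have "\<dots> = (\<Sum>y\<in>A. of_bool (lam v x y = 0) + of_bool (lam v x y = 1) + of_bool (lam v x y = 2))"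
    proof (rule sum.cong)
      fix y assume "y \<in> A"
      then show "1 = of_bool (lam v x y = 0) + of_bool (lam v x y = 1) + (of_bool (lam v x y = 2) :: nat)" using le2[of y] by auto
    qed simp
    finally show ?thesis .
  qed
  then have 2: "card {y \<in> A. lam v x y = 0} + card {y \<in> A. lam v x y = 1} + card {y \<in> A. lam v x y = 2} = 4"
    unfolding cnt cA by (simp add: sum.distrib)
  \<comment> \<open>The numbers of points of \<open>A\<close> with \<open>lam\<close> equal to 0, 1,
    2 are (0, 2, 2) or (1, 0, 3). The first has a relation of valency 2 on an even number of points,
    the second one of valency 1.\<close>
  show False using 1 2 P1[of 0] P1[of 1] P1[of 2] P2[of 2] unfolding PA by presburger
qed

definition adj :: "'a \<Rightarrow> 'a \<Rightarrow> 'a \<Rightarrow> bool" where "adj v x y \<longleftrightarrow> E v x \<and> E v y \<and> E x y"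
definition nonadj :: "'a \<Rightarrow> 'a \<Rightarrow> 'a \<Rightarrow> bool" where "nonadj v x y \<longleftrightarrow> E v x \<and> E v y \<and> x \<noteq> y \<and> \<not> E x y"

lemma symrel_adj: "symrel adj a1"
proof -
  obtain v x where vx: "E v x" using edge_ex V_nonempty by blast
  have "{y. adj v x y} = N v \<inter> N x" using vx by (auto simp: adj_def)
  then show ?thesis
    by (intro symrel_I[OF _ _ _ vx]) (auto simp: inv3_def adj_def card_a1[OF vx] intro: E_sym)
qed

lemma symrel_nonadj: "symrel nonadj (k - 1 - a1)"
proof -
  obtain v x where vx: "E v x" using edge_ex V_nonempty by blast
  have "{y. nonadj v x y} = N v - insert x (N v \<inter> N x)" using vx by (auto simp: nonadj_def)
  moreover have "card (N v - insert x (N v \<inter> N x)) = k - Suc a1"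
    using vx E_V(1)[OF vx] by (subst card_Diff_subset) (auto simp: card_N card_a1)
  ultimately show ?thesis
    by (intro symrel_I[OF _ _ _ vx]) (auto simp: inv3_def nonadj_def dest: E_sym)
qed

lemma triangle_cases:
  assumes "a1 > 0" "k \<le> 8"
  shows "k = 5 \<and> a1 = 2 \<or> k = 7 \<and> a1 = 2 \<or> k = 7 \<and> a1 = 4"
proof -
  have k3: "k \<ge> 3" using a1_less assms by simp
  have 1: "a1 \<noteq> 1" "k - 1 - a1 \<noteq> 1"
    using symrel_not1[OF _ k3] symrel_adj symrel_nonadj by metis+
  have 2: "a1 \<noteq> 2 \<or> odd k" "k - 1 - a1 \<noteq> 2 \<or> odd k"
    using symrel2_not_even[OF _ _ k3] symrel_adj symrel_nonadj by metis+
  have 3: "a1 \<noteq> 3 \<or> k \<noteq> 7 \<and> k \<noteq> 8" "k - 1 - a1 \<noteq> 3 \<or> k \<noteq> 7 \<and> k \<noteq> 8"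
    using symrel3_not7 symrel3_not8 symrel_adj symrel_nonadj by metis+
  have "k \<in> {3, 4, 5, 6, 7, 8}" using k3 assms by auto
  moreover have "a1 \<in> {1, 2, 3, 4, 5, 6}" using a1_less assms by auto
  ultimately show ?thesis using 1 2 3 a1_less by (elim insertE emptyE) simp_all
qed

end

lemma add_mod_cancel: "(i + a) mod n = (i + b) mod n \<longleftrightarrow> a mod n = b mod n" for i :: nat
  unfolding nat_mod_eq_iff by (simp add: add.assoc)

lemma mod_shift:
  fixes i :: nat
  shows "(i + a) mod n = (i + b) mod n \<longleftrightarrow> a mod n = b mod n"
    "i mod n = (i + b) mod n \<longleftrightarrow> 0 = b mod n" "(i + a) mod n = i mod n \<longleftrightarrow> a mod n = 0"
    "Suc i mod n = (i + b) mod n \<longleftrightarrow> 1 mod n = b mod n" "(i + a) mod n = Suc i mod n \<longleftrightarrow> a mod n = 1 mod n"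
    "Suc i mod n = i mod n \<longleftrightarrow> 1 mod n = 0" "i mod n = Suc i mod n \<longleftrightarrow> 0 = 1 mod n"
  using add_mod_cancel[of i a n b] add_mod_cancel[of i 0 n b] add_mod_cancel[of i a n 0]
    add_mod_cancel[of i 1 n b] add_mod_cancel[of i a n 1] add_mod_cancel[of i 1 n 0] add_mod_cancel[of i 0 n 1]
  by simp_all

section \<open>Neighbourhoods that are heptagons or complements of heptagons\<close>

context dt_graph
begin

lemma card_common_edge: "E u v \<Longrightarrow> card {z. E u z \<and> E v z} = a1"
  using card_a1 by (simp add: Int_N)

lemma card_common_D: "D u v \<Longrightarrow> card {z. E u z \<and> E v z} = c2"
  using card_c2 by (simp add: Int_N)

lemma N_eq_if_c2_k: assumes "D u w" "c2 = k" shows "N u = N w"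
proof -
  have "N u \<inter> N w = N u" "N u \<inter> N w = N w"
    by (rule card_subset_eq; use assms card_c2[OF assms(1)] card_N D_V[OF assms(1)] in simp)+
  then show ?thesis by simp
qed

text \<open>The number \<open>c2\<close> divides 14 and is at least 4, so it equals
  \<open>k\<close>, and vertices at distance 2 have equal neighbourhoods. Consecutive labels are
  non-adjacent, so \<open>l 0\<close>, \<open>l 1\<close>, \<open>l 2\<close> all have the same
  neighbourhood; yet \<open>l 0\<close> and \<open>l 2\<close> are adjacent.\<close>

lemma no_7_4: assumes k: "k = 7" and a: "a1 = 4" shows False
proof -
  have "symrel nonadj 2" using symrel_nonadj k a by simp
  note na = this
  obtain v where v: "v \<in> V" using V_nonempty by blast
  obtain l :: "nat \<Rightarrow> 'a" where l: "\<And>i j. l i = l j \<longleftrightarrow> i mod 7 = j mod 7" "range l = N v"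
    "\<And>i y. nonadj v (l i) y \<longleftrightarrow> y = l (i + 1) \<or> y = l (i + 7 - 1)"
    by (rule symrel2_labelling[OF na v, unfolded k], rule that, assumption+)
  have E: "E v (l i)" for i using l(2) by auto
  have adj: "E (l i) (l j) \<longleftrightarrow> l j \<noteq> l i \<and> l j \<noteq> l (i + 1) \<and> l j \<noteq> l (i + 6)" for i j
  proof -
    have "l i \<noteq> l j \<and> \<not> E (l i) (l j) \<longleftrightarrow> l j = l (i + 1) \<or> l j = l (i + 6)"
      using l(3)[of i "l j"] E by (simp add: nonadj_def add.commute)
    moreover have "E (l i) (l j) \<Longrightarrow> l i \<noteq> l j" by (rule E_neq)
    ultimately show ?thesis by metis
  qed
  have D: "D (l i) (l (i + 1))" for i
  proof -
    have "l i \<noteq> l (i + 1)" by (simp add: l(1) mod_shift)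
    then show ?thesis using adj[of i "i + 1"] E E_sym unfolding D_def by blast
  qed
  have "k2 * c2 = 14" using k2_c2 unfolding k a by simp
  then have "c2 dvd 14" by (metis dvd_triv_right)
  moreover have "c2 \<ge> 4"
  proof -
    have n: "\<not> E v v" by simp
    have "v \<noteq> l i" for i using E n by metis
    then have "card {v, l 3, l 4, l 5} = 4" by (simp add: l(1))
    moreover have "{v, l 3, l 4, l 5} \<subseteq> {z. E (l 0) z \<and> E (l 1) z}"
      using E E_sym by (auto simp: adj l(1))
    moreover have "finite {z. E (l 0) z \<and> E (l 1) z}" by simp
    ultimately show ?thesis using card_common_D[OF D[of 0]] by (metis add_0 card_mono)
  qed
  moreover have "c2 \<in> {0, 1, 2, 3, 4, 5, 6, 7}" using c2_le k by auto
  ultimately have c: "c2 = k" using k by (elim insertE emptyE) simp_all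
  have "N (l 0) = N (l 1)" using N_eq_if_c2_k[OF D[of 0] c] by simp
  moreover have "N (l 1) = N (l 2)" using N_eq_if_c2_k[OF D[of 1] c] by (simp add: numeral_2_eq_2)
  moreover have "l 2 \<in> N (l 0)" using adj[of 0 2] by (simp add: l(1))
  ultimately have "l 2 \<in> N (l 2)" by metis
  then show False by simp
qed

lemma link_cycle:
  assumes a: "a1 = 2" and v: "v \<in> V"
  obtains l :: "nat \<Rightarrow> 'a" where "\<And>i j. l i = l j \<longleftrightarrow> i mod k = j mod k" "range l = N v"
    "\<And>i y. E v y \<Longrightarrow> E (l i) y \<longleftrightarrow> y = l (i + 1) \<or> y = l (i + k - 1)"
proof -
  obtain l :: "nat \<Rightarrow> 'a" where l: "\<And>i j. l i = l j \<longleftrightarrow> i mod k = j mod k" "range l = N v"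
    "\<And>i y. adj v (l i) y \<longleftrightarrow> y = l (i + 1) \<or> y = l (i + k - 1)"
    by (rule symrel2_labelling[OF symrel_adj[unfolded a] v], rule that, assumption+)
  have "E v (l i)" for i using l(2) by auto
  then show ?thesis using that[of l] l unfolding adj_def by blast
qed

lemma D_link:
  assumes k: "k = 5 \<or> k = 7" and l: "\<And>i j. l i = l j \<longleftrightarrow> i mod k = j mod k" "range l = N v"
    "\<And>i y. E v y \<Longrightarrow> E (l i) y \<longleftrightarrow> y = l (i + 1) \<or> y = l (i + k - 1)"
  shows "D (l i) (l (i + 2))"
proof -
  have E: "E v (l i)" for i using l(2) by auto
  have "(i + 2) mod k \<noteq> i mod k \<and> (i + 2) mod k \<noteq> (i + 1) mod k \<and> (i + 2) mod k \<noteq> (i + k - 1) mod k"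
  proof -
    have "(i + 2) mod 5 \<noteq> i mod 5" "(i + 2) mod 5 \<noteq> (i + 1) mod 5" "(i + 2) mod 5 \<noteq> (i + 4) mod 5"
      "(i + 2) mod 7 \<noteq> i mod 7" "(i + 2) mod 7 \<noteq> (i + 1) mod 7" "(i + 2) mod 7 \<noteq> (i + 6) mod 7"
      by (simp_all add: mod_shift del: add_2_eq_Suc')
    moreover have "i + 5 - 1 = i + 4" "i + 7 - 1 = i + 6" by simp_all
    ultimately show ?thesis using k by (elim disjE) (simp_all only: simp_thms)
  qed
  then have "l (i + 2) \<noteq> l i" "\<not> E (l i) (l (i + 2))"
    unfolding l(3)[OF E] l(1) by blast+
  then show ?thesis using E E_sym[OF E] unfolding D_def by metis
qed

text \<open>On a heptagonal neighbourhood \<open>P\<close> relates the points two steps apart, so it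
  has valency 2 and \<open>inv3_count\<close> makes \<open>c2\<close> twice the number of middle
  vertices of \<open>P\<close> over a pair. As \<open>c2\<close> divides 28, it is 2 or 4. The value
  2 fails since \<open>u\<close> and \<open>x 1\<close> are both middle vertices over
  \<open>x 0\<close>, \<open>x 2\<close>; the value 4 determines so many adjacencies that the edge
  from \<open>x 0\<close> to \<open>w 2\<close> lies in too few triangles.\<close>

lemma no_7_2: assumes k: "k = 7" and a: "a1 = 2" shows False
proof -
  have k2c: "k2 * c2 = 28" using k2_c2 unfolding k a by simp
  define P where "P = (\<lambda>t x y. E t x \<and> E t y \<and> D x y \<and> (\<exists>z. E t z \<and> E x z \<and> E y z))"
  have P: "inv3 P" unfolding inv3_def P_def
  proof (intro conjI ballI allI impI)
    fix g t x y assume "g \<in> G" "E t x \<and> E t y \<and> D x y \<and> (\<exists>z. E t z \<and> E x z \<and> E y z)"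
    then show "\<exists>z. E (g t) z \<and> E (g x) z \<and> E (g y) z" by (metis G_E)
  qed auto
  obtain u where u: "u \<in> V" using V_nonempty by blast
  obtain x :: "nat \<Rightarrow> 'a" where x: "\<And>i j. x i = x j \<longleftrightarrow> i mod 7 = j mod 7" "range x = N u"
    "\<And>i y. E u y \<Longrightarrow> E (x i) y \<longleftrightarrow> y = x (i + 1) \<or> y = x (i + 7 - 1)"
    by (rule link_cycle[OF a u, unfolded k], rule that, assumption+)
  have ux: "E u (x i)" for i using x(2) by auto
  have xu: "E (x i) u" for i using E_sym[OF ux] .
  have x_adj: "E (x i) (x j) \<longleftrightarrow> x j = x (i + 1) \<or> x j = x (i + 6)" for i j
    using x(3)[OF ux, of i j] by (simp add: add.commute)
  have Dx: "D (x i) (x (i + 2))" for i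
    using D_link[of x u i, unfolded k] x by blast
  have "{y. P u (x 0) y} = {x 2, x 5}"
  proof
    show "{x 2, x 5} \<subseteq> {y. P u (x 0) y}"
    proof -
      have "P u (x 0) (x 2)" unfolding P_def
        using ux Dx[of 0, unfolded add_0] by (auto intro!: exI[of _ "x 1"] simp: x_adj x(1))
      moreover have "x 7 = x 0" by (simp add: x(1))
      then have "D (x 0) (x 5)" using Dx[of 5] D_sym by simp
      then have "P u (x 0) (x 5)" unfolding P_def
        using ux by (auto intro!: exI[of _ "x 6"] simp: x_adj x(1))
      ultimately show ?thesis by simp
    qed
    show "{y. P u (x 0) y} \<subseteq> {x 2, x 5}"
    proof
      fix y assume "y \<in> {y. P u (x 0) y}"
      then obtain z where y: "E u y" "D (x 0) y" "E u z" "E (x 0) z" "E y z" unfolding P_def by auto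
      have zy: "E z y" using y(5) by (rule E_sym)
      have n: "y \<noteq> x 0" "\<not> E (x 0) y" using y(2) unfolding D_def by auto
      have "z = x 1 \<or> z = x 6" using y(4) x(3)[OF y(3), of 0] by simp
      then show "y \<in> {x 2, x 5}"
      proof
        assume "z = x 1"
        then have "y = x 2 \<or> y = x 7" using zy x(3)[OF y(1), of 1] by (simp add: numeral_2_eq_2)
        moreover have "x 7 = x 0" by (simp add: x(1))
        ultimately show ?thesis using n by auto
      next
        assume "z = x 6"
        then have "y = x 7 \<or> y = x 12" using zy x(3)[OF y(1), of 6] by simp
        moreover have "x 7 = x 0" "x 12 = x 5" by (simp_all add: x(1))
        ultimately show ?thesis using n by auto
      qed
    qed
  qed
  moreover have "x 2 \<noteq> x 5" by (simp add: x(1))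
  ultimately have cP: "card {y. P u (x 0) y} = 2" by simp
  have m: "2 * card {t. P t y z} = c2" if "D y z" for y z
    using inv3_count[OF P _ ux[of 0] that] cP k a unfolding P_def by auto
  have "even c2" using m[OF Dx[of 0, unfolded add_0]] by (metis dvd_triv_left)
  moreover have "c2 dvd 28" using k2c by (metis dvd_triv_right)
  moreover have "c2 \<in> {1, 2, 3, 4, 5, 6, 7}" using c2_le k c2_pos by auto
  ultimately have "c2 = 2 \<or> c2 = 4" by (elim insertE emptyE) simp_all
  then show False
  proof
    assume c: "c2 = 2"
    have "P u (x 0) (x 2)"
      unfolding P_def using ux Dx[of 0, unfolded add_0] by (auto intro!: exI[of _ "x 1"] simp: x_adj x(1))
    moreover have "P (x 1) (x 0) (x 2)"
      unfolding P_def using xu Dx[of 0, unfolded add_0] by (auto intro!: exI[of _ u] simp: x_adj x(1))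
    moreover have "u \<noteq> x 1" using ux E_irrefl by metis
    moreover have "finite {t. P t (x 0) (x 2)}"
      by (rule finite_subset[OF _ fin_N[of "x 0"]]) (auto simp: P_def dest: E_sym)
    ultimately have "card {u, x 1} \<le> card {t. P t (x 0) (x 2)}"
      by (intro card_mono) auto
    then show False using m[OF Dx[of 0, unfolded add_0]] c \<open>u \<noteq> x 1\<close> by simp
  next
    assume c: "c2 = 4"
    define w where "w = (\<lambda>i. SOME w. E (x i) w \<and> E (x (i + 1)) w \<and> w \<noteq> u)"
    have xx1: "E (x i) (x (i + 1))" for i by (simp add: x_adj)
    have w: "E (x i) (w i)" "E (x (i + 1)) (w i)" "w i \<noteq> u" for i
    proof -
      have "card {z. E (x i) z \<and> E (x (i + 1)) z} = 2" using card_common_edge[OF xx1] a by simp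
      then obtain p q where pq: "{z. E (x i) z \<and> E (x (i + 1)) z} = {p, q}" "p \<noteq> q" using card_2_iff by metis
      then have "\<exists>w. E (x i) w \<and> E (x (i + 1)) w \<and> w \<noteq> u" by blast
      then have "E (x i) (w i) \<and> E (x (i + 1)) (w i) \<and> w i \<noteq> u" unfolding w_def by (rule someI_ex)
      then show "E (x i) (w i)" "E (x (i + 1)) (w i)" "w i \<noteq> u" by blast+
    qed
    have nuw: "\<not> E u (w i)" for i
    proof
      assume e: "E u (w i)"
      have "w i = x (i + 1) \<or> w i = x (i + 6)" using x(3)[OF e, of i] w(1)[of i] by (simp add: add.commute)
      moreover have "w i = x (i + 2) \<or> w i = x (i + 7)" using x(3)[OF e, of "i + 1"] w(2)[of i] by (simp add: add.commute)
      ultimately have "(i + 1) mod 7 = (i + 2) mod 7 \<or> (i + 1) mod 7 = (i + 7) mod 7 \<or>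
        (i + 6) mod 7 = (i + 2) mod 7 \<or> (i + 6) mod 7 = (i + 7) mod 7" using x(1) by metis
      then show False unfolding add_mod_cancel by simp
    qed
    have Duw: "D u (w i)" for i using w[of i] nuw ux unfolding D_def by metis
    define T where "T = (\<lambda>i. {z. E u z \<and> E (w i) z})"
    have cT: "card (T i) = 4" for i unfolding T_def using card_common_D[OF Duw] c by simp
    \<comment> \<open>Exactly two of the four common neighbours of \<open>u\<close> and
      \<open>w i\<close> are middle vertices of \<open>P\<close>, and these are \<open>x i\<close>
      and \<open>x (i + 1)\<close>. The other two are isolated among the four, so on the heptagon
      they can only be \<open>x (i + 3)\<close> and \<open>x (i + 5)\<close>.\<close>
    have Tset: "T i = {x i, x (i + 1), x (i + 3), x (i + 5)}" for i
    proof -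
      have xT: "x i \<in> T i" "x (i + 1) \<in> T i" unfolding T_def using ux w E_sym by auto
      have PT: "{t. P t u (w i)} = {t \<in> T i. \<exists>z \<in> T i. E t z}"
        unfolding P_def T_def using Duw[of i] E_sym by blast
      have "card {t. P t u (w i)} = 2" using m[OF Duw] c by simp
      moreover have "{x i, x (i + 1)} \<subseteq> {t. P t u (w i)}" unfolding PT using xT xx1[of i] E_sym[OF xx1[of i]] by blast
      moreover have "x i \<noteq> x (i + 1)" using xx1[of i] E_irrefl by metis
      moreover have "finite {t. P t u (w i)}" unfolding PT T_def by simp
      ultimately have Peq: "{t. P t u (w i)} = {x i, x (i + 1)}" by (metis card_2_iff card_subset_eq)
      have iso: "\<not> E t z" if "t \<in> T i" "t \<noteq> x i" "t \<noteq> x (i + 1)" "z \<in> T i" for t z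
        using that Peq unfolding PT by blast
      have adj1: "E (x (i + a)) (x (i + b))" if "b = a + 1 \<or> b = a + 6 \<or> a = b + 1" for a b
      proof -
        have "b mod 7 = (a + 1) mod 7 \<or> b mod 7 = (a + 6) mod 7" using that by auto
        then show ?thesis unfolding x_adj x(1) add.assoc add_mod_cancel .
      qed
      have ne: "x (i + a) \<noteq> x (i + b)" if "a < b" "b < 7" for a b
      proof -
        show ?thesis using that unfolding x(1) add_mod_cancel by simp
      qed
      have ne': "x (i + b) \<noteq> x i" "x (i + c) \<noteq> x (i + 1)" if "0 < b" "b < 7" "1 < c" "c < 7" for b c
        using ne[of 0 b] ne[of 1 c] that by auto
      have n2: "x (i + 2) \<notin> T i"
      proof
        assume t: "x (i + 2) \<in> T i"
        have "\<not> E (x (i + 2)) (x (i + 1))" by (rule iso[OF t _ _ xT(2)]) (rule ne'[of 2 2]; simp)+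
        moreover have "E (x (i + 2)) (x (i + 1))" by (rule adj1) simp
        ultimately show False by blast
      qed
      have n6: "x (i + 6) \<notin> T i"
      proof
        assume t: "x (i + 6) \<in> T i"
        have "\<not> E (x (i + 6)) (x i)" by (rule iso[OF t _ _ xT(1)]) (rule ne'[of 6 6]; simp)+
        moreover have "E (x (i + 0)) (x (i + 6))" by (rule adj1) simp
        then have "E (x (i + 6)) (x i)" using E_sym by simp
        ultimately show False by blast
      qed
      have sub: "T i \<subseteq> {x (i + 0), x (i + 1), x (i + 3), x (i + 4), x (i + 5)}"
      proof
        fix t assume t: "t \<in> T i"
        then have "t \<in> range x" unfolding T_def x(2) by simp
        then obtain j where j: "t = x j" by blast
        define a where "a = (j + 6 * i) mod 7"
        have "(i + a) mod 7 = (j + 7 * i) mod 7" unfolding a_def by (simp add: mod_simps)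
        then have ta: "t = x (i + a)" unfolding j x(1) by simp
        have "a < 7" unfolding a_def by simp
        then have "a = 0 \<or> a = 1 \<or> a = 2 \<or> a = 3 \<or> a = 4 \<or> a = 5 \<or> a = 6" by linarith
        note this ta
        then show "t \<in> {x (i + 0), x (i + 1), x (i + 3), x (i + 4), x (i + 5)}" using t n2 n6 by (elim disjE) simp_all
      qed
      have "x (i + 4) \<notin> T i"
      proof
        assume 4: "x (i + 4) \<in> T i"
        have "x (i + 3) \<notin> T i" using iso[OF 4 ne'(1)[of 4 4] ne'(2)[of 4 4]] E_sym[OF adj1[of 4 3]] by auto
        moreover have "x (i + 5) \<notin> T i" using iso[OF 4 ne'(1)[of 4 4] ne'(2)[of 4 4]] adj1[of 5 4] by auto
        ultimately have "T i \<subseteq> {x i, x (i + 1), x (i + 4)}" using sub by auto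
        then have "card (T i) \<le> card {x i, x (i + 1), x (i + 4)}" by (intro card_mono) auto
        also have "\<dots> \<le> 3" by (simp add: card_insert_if)
        finally show False using cT[of i] by simp
      qed
      then have "T i \<subseteq> {x i, x (i + 1), x (i + 3), x (i + 5)}" using sub by auto
      moreover have "card {x i, x (i + 1), x (i + 3), x (i + 5)} \<le> 4" by (simp add: card_insert_if)
      ultimately show ?thesis using cT[of i] by (intro card_seteq) auto
    qed
    have wx: "E (w i) (x j) \<longleftrightarrow> j mod 7 = i mod 7 \<or> j mod 7 = (i + 1) mod 7 \<or> j mod 7 = (i + 3) mod 7 \<or> j mod 7 = (i + 5) mod 7" for i j
    proof -
      have "E (w i) (x j) \<longleftrightarrow> x j \<in> T i" unfolding T_def using ux by simp
      then show ?thesis unfolding Tset by (simp add: x(1))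
    qed
    have xw: "E (x j) (w i) \<longleftrightarrow> j mod 7 = i mod 7 \<or> j mod 7 = (i + 1) mod 7 \<or> j mod 7 = (i + 3) mod 7 \<or> j mod 7 = (i + 5) mod 7" for i j
      using wx E_commute by blast
    have ww: "w i \<noteq> w j" if "\<exists>a. E (w i) (x a) \<noteq> E (w j) (x a)" for i j using that by auto
    have d1: "w 0 \<noteq> w 6" by (rule ww) (auto simp: wx intro!: exI[of _ 1])
    have d2: "w 0 \<noteq> w 4" by (rule ww) (auto simp: wx intro!: exI[of _ 1])
    have d3: "w 0 \<noteq> w 2" by (rule ww) (auto simp: wx intro!: exI[of _ 1])
    have d4: "w 6 \<noteq> w 4" by (rule ww) (auto simp: wx intro!: exI[of _ 6])
    have d5: "w 6 \<noteq> w 2" by (rule ww) (auto simp: wx intro!: exI[of _ 6])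
    have d6: "w 4 \<noteq> w 2" by (rule ww) (auto simp: wx intro!: exI[of _ 4])
    have d7: "x j \<noteq> w i" "u \<noteq> w i" for i j using nuw[of i] ux[of j] w(3)[of i] by metis+
    have d8: "x j \<noteq> u" for j using ux E_irrefl by metis
    have cardN: "card {u, x 1, x 6, w 0, w 6, w 4, w 2} = 7"
      using d1 d2 d3 d4 d5 d6 d7 d8 d8[symmetric] by (simp add: x(1))
    have "{u, x 1, x 6, w 0, w 6, w 4, w 2} \<subseteq> N (x 0)"
      using xu by (simp add: x_adj x(1) xw)
    then have N0: "{u, x 1, x 6, w 0, w 6, w 4, w 2} = N (x 0)"
      using cardN card_N[OF E_V(1)[OF xu[of 0]]] k by (intro card_subset_eq) auto
    \<comment> \<open>Adjacent vertices have only two common neighbours, so three common neighbours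
      on the heptagon around \<open>u\<close> rule out adjacency.\<close>
    have few: "\<not> E (w 2) (w i)" if "E (w 2) (x p)" "E (w 2) (x q)" "E (w 2) (x r)"
      "E (w i) (x p)" "E (w i) (x q)" "E (w i) (x r)" "x p \<noteq> x q" "x q \<noteq> x r" "x p \<noteq> x r" for i p q r
    proof
      assume e: "E (w 2) (w i)"
      have "card {x p, x q, x r} \<le> card {z. E (w 2) z \<and> E (w i) z}" using that by (intro card_mono) auto
      then show False using card_common_edge[OF e] a that by simp
    qed
    have n0: "\<not> E (w 2) (w 0)" by (rule few[of 0 3 5]) (simp_all add: wx x(1))
    have n4: "\<not> E (w 2) (w 4)" by (rule few[of 2 5 0]) (simp_all add: wx x(1))
    have "{z. E (x 0) z \<and> E (w 2) z} \<subseteq> {w 6}"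
    proof
      fix z assume z: "z \<in> {z. E (x 0) z \<and> E (w 2) z}"
      then have "z \<in> {u, x 1, x 6, w 0, w 6, w 4, w 2}" unfolding N0 by simp
      moreover have "\<not> E (w 2) u" "\<not> E (w 2) (x 1)" "\<not> E (w 2) (x 6)"
        using nuw[of 2] E_sym by (blast, simp_all add: wx)
      ultimately show "z \<in> {w 6}" using z n0 n4 by auto
    qed
    then have "card {z. E (x 0) z \<and> E (w 2) z} \<le> card {w 6}" by (intro card_mono) auto
    moreover have "E (x 0) (w 2)" by (simp add: xw)
    ultimately show False using card_common_edge a by simp
  qed
qed

end

section \<open>The icosahedron\<close>

lemma ico_edges_eq:
  "ico_edges = {(0, 1), (11, 6), (1, 2), (6, 7), (1, 6), (1, 7), (0, 2), (11, 7), (2, 3), (7, 8), (2, 7), (2, 8),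
    (0, 3), (11, 8), (3, 4), (8, 9), (3, 8), (3, 9), (0, 4), (11, 9), (4, 5), (9, 10), (4, 9), (4, 10),
    (0, 5), (11, 10), (5, 1), (10, 6), (5, 10), (5, 6)}"
proof -
  have "{0..<5::nat} = {0, 1, 2, 3, 4}" by auto
  then show ?thesis unfolding ico_edges_def by (simp add: insert_commute del: One_nat_def add_2_eq_Suc add_2_eq_Suc')
qed

lemma ico_degree: assumes "a < 12" shows "card {b. b < 12 \<and> ico_adj a b} = 5"
proof -
  have "{b. b < 12 \<and> ico_adj a b} = set (filter (ico_adj a) [0..<12])" by auto
  then have "card {b. b < 12 \<and> ico_adj a b} = length (filter (ico_adj a) [0..<12])"
    by (simp add: distinct_card del: set_filter)
  moreover have "[0..<12] = [0, 1, 2, 3, 4, 5, 6, 7, 8, 9, 10, 11]" by (simp add: upt_conv_Cons)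
  moreover have "a = 0 \<or> a = 1 \<or> a = 2 \<or> a = 3 \<or> a = 4 \<or> a = 5 \<or> a = 6 \<or> a = 7 \<or> a = 8 \<or> a = 9 \<or> a = 10 \<or> a = 11"
    using assms by presburger
  ultimately show ?thesis by (elim disjE) (simp_all add: ico_adj_def ico_edges_eq)
qed

lemma ico_vertex_cases: "a < 12 \<Longrightarrow> a = 0 \<or> (\<exists>i<5. a = 1 + i) \<or> (\<exists>i<5. a = 6 + i) \<or> a = (11::nat)"
  by presburger

context dt_graph
begin

text \<open>The common neighbours \<open>u\<close>, \<open>x 1\<close> of \<open>x 0\<close>,
  \<open>x 2\<close> give \<open>c2 >= 2\<close>, and \<open>c2\<close> divides 10. The value 5
  would give \<open>x 0\<close>, \<open>x 2\<close>, \<open>x 4\<close> one common neighbourhood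
  although \<open>x 0\<close> and \<open>x 4\<close> are adjacent. With \<open>a1 = c2 = 2\<close>
  the layers around \<open>u\<close> are forced, and twelve vertices of full valency close up under
  adjacency.\<close>

lemma pentagon_imp_icosahedron: assumes k: "k = 5" and a: "a1 = 2"
  shows "isomorphic_to_icosahedron V E"
proof -
  have k2c: "k2 * c2 = 10" using k2_c2 unfolding k a by simp
  obtain u where u: "u \<in> V" using V_nonempty by blast
  obtain x :: "nat \<Rightarrow> 'a" where x: "\<And>i j. x i = x j \<longleftrightarrow> i mod 5 = j mod 5" "range x = N u"
    "\<And>i y. E u y \<Longrightarrow> E (x i) y \<longleftrightarrow> y = x (i + 1) \<or> y = x (i + 5 - 1)"
    by (rule link_cycle[OF a u, unfolded k], rule that, assumption+)
  have ux: "E u (x i)" for i using x(2) by auto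
  have xu: "E (x i) u" for i using E_sym[OF ux] .
  have x_adj: "E (x i) (x j) \<longleftrightarrow> x j = x (i + 1) \<or> x j = x (i + 4)" for i j
    using x(3)[OF ux, of i j] by (simp add: add.commute)
  have Dx: "D (x i) (x (i + 2))" for i
    using D_link[of x u i, unfolded k] x by blast
  have d8: "x j \<noteq> u" for j using ux E_irrefl by metis
  have fin2: "finite {z. E p z \<and> E q z}" for p q by simp
  have "c2 \<ge> 2"
  proof -
    have "{u, x 1} \<subseteq> {z. E (x 0) z \<and> E (x 2) z}" using xu by (simp add: x_adj x(1))
    then have "card {u, x 1} \<le> card {z. E (x 0) z \<and> E (x 2) z}" by (intro card_mono fin2)
    then show ?thesis using card_common_D[OF Dx[of 0, unfolded add_0]] d8[of 1] by simp
  qed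
  moreover have "c2 dvd 10" using k2c by (metis dvd_triv_right)
  moreover have "c2 \<noteq> 5"
  proof
    assume c: "c2 = 5"
    have "N (x 0) = N (x 2)" "N (x 2) = N (x 4)"
      using N_eq_if_c2_k[OF Dx[of 0, unfolded add_0]] N_eq_if_c2_k[OF Dx[of 2]] c k by simp_all
    moreover have "x 4 \<in> N (x 0)" by (simp add: x_adj x(1))
    ultimately have "x 4 \<in> N (x 4)" by metis
    then show False by simp
  qed
  moreover have "c2 \<in> {0, 1, 2, 3, 4, 5}" using c2_le k by auto
  ultimately have c: "c2 = 2" by (elim insertE emptyE) simp_all
  have two: "z = s \<or> z = t" if "card {z. E p z \<and> E q z} = 2" "E p s" "E q s" "E p t" "E q t" "s \<noteq> t" "E p z" "E q z" for p q s t z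
  proof -
    have "{s, t} = {z. E p z \<and> E q z}" using that by (intro card_subset_eq fin2) auto
    then show ?thesis using that by blast
  qed
  have edge2: "z = s \<or> z = t" if "E p q" "E p s" "E q s" "E p t" "E q t" "s \<noteq> t" "E p z" "E q z" for p q s t z
    using two[of p q s t z] card_common_edge[OF that(1)] a that by simp
  have D2: "z = s \<or> z = t" if "D p q" "E p s" "E q s" "E p t" "E q t" "s \<noteq> t" "E p z" "E q z" for p q s t z
    using two[of p q s t z] card_common_D[OF that(1)] c that by simp
  have edge_eq: "E p t" "E q t" if e: "E p q" and sub: "\<And>z. E p z \<Longrightarrow> E q z \<Longrightarrow> z = s \<or> z = t" for p q s t
  proof -
    have "{z. E p z \<and> E q z} \<subseteq> {s, t}" using sub by blast
    moreover have "card {z. E p z \<and> E q z} = 2" using card_common_edge[OF e] a by simp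
    moreover have "card {s, t} \<le> 2" by (simp add: card_insert_if)
    ultimately have "{z. E p z \<and> E q z} = {s, t}" by (intro card_seteq) auto
    then show "E p t" "E q t" by blast+
  qed
  define w where "w = (\<lambda>i. SOME w. E (x i) w \<and> E (x (i + 1)) w \<and> w \<noteq> u)"
  have xx1: "E (x i) (x (i + 1))" for i by (simp add: x_adj)
  have w: "E (x i) (w i)" "E (x (i + 1)) (w i)" "w i \<noteq> u" for i
  proof -
    have "card {z. E (x i) z \<and> E (x (i + 1)) z} = 2" using card_common_edge[OF xx1] a by simp
    then obtain p q where pq: "{z. E (x i) z \<and> E (x (i + 1)) z} = {p, q}" "p \<noteq> q" using card_2_iff by metis
    then have "\<exists>w. E (x i) w \<and> E (x (i + 1)) w \<and> w \<noteq> u" by blast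
    then have "E (x i) (w i) \<and> E (x (i + 1)) (w i) \<and> w i \<noteq> u" unfolding w_def by (rule someI_ex)
    then show "E (x i) (w i)" "E (x (i + 1)) (w i)" "w i \<noteq> u" by blast+
  qed
  have w_cong: "w i = w j" if ij: "i mod 5 = j mod 5" for i j
  proof -
    have "x i = x j" using ij x(1) by blast
    moreover have "(i + 1) mod 5 = (j + 1) mod 5" using mod_add_cong[OF ij refl] .
    then have "x (i + 1) = x (j + 1)" using x(1) by blast
    ultimately show ?thesis unfolding w_def by simp
  qed
  have nuw: "\<not> E u (w i)" for i
  proof
    assume e: "E u (w i)"
    have "w i = x (i + 1) \<or> w i = x (i + 4)" using x(3)[OF e, of i] w(1) by (simp add: add.commute)
    moreover have "w i = x (i + 2) \<or> w i = x (i + 5)" using x(3)[OF e, of "i + 1"] w(2)[of i] by (simp add: add.commute)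
    ultimately have "(i + 1) mod 5 = (i + 2) mod 5 \<or> (i + 1) mod 5 = (i + 5) mod 5 \<or>
      (i + 4) mod 5 = (i + 2) mod 5 \<or> (i + 4) mod 5 = (i + 5) mod 5" using x(1) by metis
    then show False unfolding add_mod_cancel by simp
  qed
  have nwu: "\<not> E (w i) u" for i using nuw E_sym by blast
  have Duw: "D u (w i)" for i using w[of i] nuw ux unfolding D_def by metis
  have wx: "E (w i) (x j) \<longleftrightarrow> j mod 5 = i mod 5 \<or> j mod 5 = (i + 1) mod 5" for i j
  proof
    assume e: "E (w i) (x j)"
    have "x i \<noteq> x (i + 1)" using xx1[of i] E_irrefl by metis
    then have "x j = x i \<or> x j = x (i + 1)"
      using D2[OF Duw[of i] ux E_sym[OF w(1)] ux E_sym[OF w(2)] _ ux e] by blast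
    then show "j mod 5 = i mod 5 \<or> j mod 5 = (i + 1) mod 5" using x(1) by blast
  next
    assume "j mod 5 = i mod 5 \<or> j mod 5 = (i + 1) mod 5"
    then have "x j = x i \<or> x j = x (i + 1)" using x(1) by blast
    then show "E (w i) (x j)" using E_sym[OF w(1)[of i]] E_sym[OF w(2)[of i]] by auto
  qed
  have xw: "E (x j) (w i) \<longleftrightarrow> j mod 5 = i mod 5 \<or> j mod 5 = (i + 1) mod 5" for i j
    using wx E_commute by blast
  have w_inj: "w i = w j \<longleftrightarrow> i mod 5 = j mod 5" for i j
  proof
    assume e: "w i = w j"
    have "j mod 5 = i mod 5 \<or> j mod 5 = (i + 1) mod 5" using wx[of i j] wx[of j j] e by simp
    moreover have "(j + 1) mod 5 = i mod 5 \<or> (j + 1) mod 5 = (i + 1) mod 5"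
      using wx[of i "j + 1"] wx[of j "j + 1"] e by simp
    ultimately show "i mod 5 = j mod 5"
    proof (elim disjE)
      assume 1: "j mod 5 = (i + 1) mod 5"
      have s: "(j + 1) mod 5 = (i + 2) mod 5" using mod_add_cong[OF 1 refl, of 1] by (simp add: numeral_2_eq_2)
      { assume "(j + 1) mod 5 = i mod 5"
        then have "(i + 2) mod 5 = (i + 0) mod 5" using s by simp
        then show ?thesis unfolding add_mod_cancel by simp }
      { assume "(j + 1) mod 5 = (i + 1) mod 5"
        then have "(i + 2) mod 5 = (i + 1) mod 5" using s by simp
        then show ?thesis unfolding add_mod_cancel by simp }
    qed simp_all
  qed (rule w_cong)
  have d7: "x j \<noteq> w i" "u \<noteq> w i" for i j using nuw[of i] ux[of j] w(3)[of i] by metis+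
  have wsh: "w (i + p) = w (i + q) \<longleftrightarrow> p mod 5 = q mod 5" for i p q unfolding w_inj add_mod_cancel ..
  have xsh: "x (i + p) = x (i + q) \<longleftrightarrow> p mod 5 = q mod 5" for i p q unfolding x(1) add_mod_cancel ..
  have wxs: "E (w (i + p)) (x (i + q)) \<longleftrightarrow> q mod 5 = p mod 5 \<or> q mod 5 = (p + 1) mod 5" for i p q
    unfolding wx add.assoc add_mod_cancel ..
  have xws: "E (x (i + q)) (w (i + p)) \<longleftrightarrow> q mod 5 = p mod 5 \<or> q mod 5 = (p + 1) mod 5" for i p q
    unfolding xw add.assoc add_mod_cancel ..
  have xxs: "E (x (i + p)) (x (i + q)) \<longleftrightarrow> q mod 5 = (p + 1) mod 5 \<or> q mod 5 = (p + 4) mod 5" for i p q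
    unfolding x_adj x(1) add.assoc add_mod_cancel ..
  have Nx: "{u, x (i + 0), x (i + 2), w (i + 0), w (i + 1)} = N (x (i + 1))" for i
  proof (rule card_subset_eq)
    show "{u, x (i + 0), x (i + 2), w (i + 0), w (i + 1)} \<subseteq> N (x (i + 1))"
      using xu[of "i + 1"] xxs[of i 1 0] xxs[of i 1 2] xws[of i 1 0] xws[of i 1 1] by simp
    show "card {u, x (i + 0), x (i + 2), w (i + 0), w (i + 1)} = card (N (x (i + 1)))"
      using d7 d8 d8[symmetric] xsh[of i 0 2] wsh[of i 0 1] card_N[OF E_V(1)[OF xu[of "i + 1"]]] k by simp
  qed simp
  have ww1: "E (w (i + 0)) (w (i + 1))" for i
  proof (rule edge_eq(2)[of "x (i + 1)" "w (i + 0)" "x (i + 0)" "w (i + 1)"])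
    show "E (x (i + 1)) (w (i + 0))" unfolding xws by simp
    fix z assume z: "E (x (i + 1)) z" "E (w (i + 0)) z"
    then have "z \<in> {u, x (i + 0), x (i + 2), w (i + 0), w (i + 1)}" unfolding Nx by simp
    moreover have "\<not> E (w (i + 0)) (x (i + 2))" unfolding wxs by simp
    ultimately show "z = x (i + 0) \<or> z = w (i + 1)" using z nwu E_irrefl by blast
  qed
  have ww: "E (w (i + p)) (w (i + q))" if "q mod 5 = (p + 1) mod 5" for i p q
  proof -
    have "w (i + q) = w ((i + p) + 1)" unfolding add.assoc wsh using that .
    then show ?thesis using ww1[of "i + p"] by simp
  qed
  \<comment> \<open>This edge would close a 4-cycle inside the neighbourhood of
    \<open>w (i + 1)\<close>, on which adjacency is connected of valency 2 with five points.\<close>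
  have ww2: "\<not> E (w (i + 0)) (w (i + 2))" for i
  proof
    assume e: "E (w (i + 0)) (w (i + 2))"
    let ?C = "{w (i + 0), x (i + 1), x (i + 2), w (i + 2)}"
    have s: "E (w (i + 1)) (w (i + 0))" "E (w (i + 1)) (w (i + 2))" "E (w (i + 1)) (x (i + 1))" "E (w (i + 1)) (x (i + 2))"
      "E (w (i + 0)) (x (i + 1))" "E (x (i + 1)) (w (i + 0))" "E (x (i + 1)) (x (i + 2))" "E (x (i + 2)) (x (i + 1))"
      "E (x (i + 2)) (w (i + 2))" "E (w (i + 2)) (x (i + 2))" "E (w (i + 2)) (w (i + 0))"
      using E_sym[OF ww[of 1 0 i]] ww[of 2 1 i] E_sym[OF e] unfolding wxs xws xxs by simp_all
    have d: "x (i + 1) \<noteq> x (i + 2)" "w (i + 0) \<noteq> w (i + 2)" unfolding xsh wsh by simp_all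
    have "k \<le> card ?C"
    proof (rule symrel_closed_card[OF symrel_adj, of _ _ "w (i + 1)"])
      show "w (i + 0) \<in> ?C" by simp
      show "E (w (i + 1)) (w (i + 0))" by (rule s)
      fix p q assume p: "p \<in> ?C" and "adj (w (i + 1)) p q"
      then have q: "E (w (i + 1)) q" "E p q" unfolding adj_def by auto
      consider "p = w (i + 0)" | "p = x (i + 1)" | "p = x (i + 2)" | "p = w (i + 2)" using p by blast
      then show "q \<in> ?C"
      proof cases
        case 1 then show ?thesis using edge2[OF s(1) s(3) s(5) s(2) e d7(1) q(1)] q(2) by blast
      next
        case 2 then show ?thesis using edge2[OF s(3) s(1) s(6) s(4) s(7) d7(1)[symmetric] q(1)] q(2) by blast
      next
        case 3 then show ?thesis using edge2[OF s(4) s(3) s(8) s(2) s(9) d7(1) q(1)] q(2) by blast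
      next
        case 4 then show ?thesis using edge2[OF s(2) s(4) s(10) s(1) s(11) d7(1) q(1)] q(2) by blast
      qed
    qed (simp_all add: a)
    also have "\<dots> \<le> 4" by (simp add: card_insert_if)
    finally show False using k by simp
  qed
  have ww2': "\<not> E (w (i + p)) (w (i + q))" if "q mod 5 = (p + 2) mod 5" for i p q
  proof -
    have "w (i + q) = w ((i + p) + 2)" unfolding add.assoc wsh using that .
    then show ?thesis using ww2[of "i + p"] by simp
  qed
  have "\<exists>z. {x (i + 0), x (i + 1), w (i + 4), w (i + 1), z} = N (w (i + 0)) \<and> z \<notin> {x (i + 0), x (i + 1), w (i + 4), w (i + 1)}" for i
  proof -
    let ?C = "{x (i + 0), x (i + 1), w (i + 4), w (i + 1)}"
    have sub: "?C \<subseteq> N (w (i + 0))"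
      using wxs[of i 0 0] wxs[of i 0 1] ww1[of i] E_sym[OF ww[of 0 4 i]] by simp
    have c4: "card ?C = 4" using d7 xsh[of i 0 1] wsh[of i 4 1] by simp
    have cN: "card (N (w (i + 0))) = 5" using card_N[OF D_V(2)[OF Duw]] k by simp
    have "card (N (w (i + 0)) - ?C) = 1" using card_Diff_subset[OF _ sub] c4 cN by simp
    then obtain z where "N (w (i + 0)) - ?C = {z}" using card_1_singletonE by blast
    then have z: "z \<in> N (w (i + 0))" "z \<notin> ?C" by blast+
    have "insert z ?C = N (w (i + 0))"
      using sub z c4 cN by (intro card_subset_eq) (auto simp: card_insert_if)
    then show ?thesis using z(2) by (intro exI[of _ z]) blast
  qed
  then obtain z where Nw: "\<And>i. {x (i + 0), x (i + 1), w (i + 4), w (i + 1), z i} = N (w (i + 0))"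
    and z: "\<And>i. z i \<notin> {x (i + 0), x (i + 1), w (i + 4), w (i + 1)}" by metis
  have wz: "E (w i) (z i)" for i using Nw[of i] by auto
  have wz1: "E (w (i + 1)) (z i)" for i
  proof (rule edge_eq(2)[of "w (i + 0)" "w (i + 1)" "x (i + 1)" "z i"])
    show "E (w (i + 0)) (w (i + 1))" by (rule ww1)
    fix y assume y: "E (w (i + 0)) y" "E (w (i + 1)) y"
    then have "y \<in> {x (i + 0), x (i + 1), w (i + 4), w (i + 1), z i}" unfolding Nw by simp
    moreover have "\<not> E (w (i + 1)) (x (i + 0))" unfolding wxs by simp
    moreover have "\<not> E (w (i + 4)) (w (i + 1))" using ww2'[of 1 4 i] by simp
    then have "\<not> E (w (i + 1)) (w (i + 4))" using E_sym by blast
    ultimately show "y = x (i + 1) \<or> y = z i" using y E_irrefl by blast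
  qed
  \<comment> \<open>The fifth neighbour of \<open>w i\<close> is also adjacent to
    \<open>w (i + 1)\<close> and differs from its four other known neighbours. So all fifth
    neighbours coincide, giving the antipode of \<open>u\<close>.\<close>
  have z_Suc: "z (Suc i) = z i" for i
  proof -
    have "{x ((i + 1) + 0), x ((i + 1) + 1), w ((i + 1) + 4), w ((i + 1) + 1), z (i + 1)} = N (w ((i + 1) + 0))" by (rule Nw)
    moreover have "w ((i + 1) + 4) = w (i + 0)" unfolding add.assoc wsh by simp
    ultimately have "z i \<in> {x (i + 1), x (i + 2), w (i + 0), w (i + 2), z (i + 1)}" using wz1[of i] by auto
    moreover have "z i \<noteq> x (i + 1)" using z[of i] by blast
    moreover have "\<not> E (w (i + 0)) (x (i + 2))" unfolding wxs by simp
    then have "z i \<noteq> x (i + 2)" using wz[of i] by auto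
    moreover have "z i \<noteq> w (i + 0)" using wz[of i] E_irrefl by auto
    moreover have "z i \<noteq> w (i + 2)" using wz[of i] ww2[of i] by auto
    ultimately show ?thesis by auto
  qed
  have z0: "z i = z 0" for i by (induction i) (simp_all add: z_Suc)
  define t where "t = z 0"
  have wt: "E (w i) t" for i using wz[of i] z0[of i] unfolding t_def by simp
  have dt: "t \<noteq> u" "t \<noteq> w i" "t \<noteq> x i" for i
  proof -
    show "t \<noteq> u" using wt[of 0] nwu[of 0] by metis
    show "t \<noteq> w i" using wt[of i] E_irrefl by metis
    have "\<not> E (w (i + 2)) (x (i + 0))" unfolding wxs by simp
    then show "t \<noteq> x i" using wt[of "i + 2"] by auto
  qed
  \<comment> \<open>In \<open>ico_edges\<close> the upper vertex \<open>1 + i\<close> meets the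
    lower vertices \<open>6 + i\<close> and its successor, while \<open>x i\<close> meets
    \<open>w (i - 1)\<close> and \<open>w i\<close>. The index \<open>n - 2\<close> sends
    \<open>6 + i\<close> to \<open>w (i + 4)\<close>, which is \<open>w (i - 1)\<close> mod
    5.\<close>
  define g where "g = (\<lambda>n. if n = 0 then u else if n \<le> 5 then x (n - 1) else if n \<le> 10 then w (n - 2) else t)"
  have g: "g 0 = u" "g 11 = t" by (simp_all add: g_def)
  have gx: "g (1 + i) = x i" "g (6 + i) = w (i + 4)" if "i < 5" for i
    using that by (auto simp: g_def intro: arg_cong[of _ _ w])
  have gx1: "g (1 + (i + 1) mod 5) = x (i + 1)" "g (6 + (i + 1) mod 5) = w (i + 5)" for i
  proof -
    have "(i + 1) mod 5 < 5" by simp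
    note g = gx[OF this]
    show "g (1 + (i + 1) mod 5) = x (i + 1)" unfolding g x(1) by simp
    show "g (6 + (i + 1) mod 5) = w (i + 5)" unfolding g w_inj by (simp add: mod_simps)
  qed
  have gE: "E (g a) (g b)" if ab: "(a, b) \<in> ico_edges" for a b
  proof -
    obtain i where i: "i < 5" "(a, b) \<in> {(0, 1+i), (11, 6+i), (1+i, 1 + (i+1) mod 5), (6+i, 6 + (i+1) mod 5),
       (1+i, 6+i), (1+i, 6 + (i+1) mod 5)}" using ab unfolding ico_edges_def by auto
    have "E t (w (i + 4))" using E_sym[OF wt] .
    moreover have "E (w (i + 4)) (w (i + 5))" by (rule ww) simp
    moreover have "E (x i) (w (i + 4))" "E (x i) (w (i + 5))"
      using xws[of i 0 4] xws[of i 0 5] by simp_all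
    ultimately show ?thesis using i(2) ux[of i] xx1[of i] by (elim insertE emptyE) (simp_all only: prod.inject g gx[OF i(1)] gx1)
  qed
  have gadj: "E (g a) (g b)" if "ico_adj a b" for a b
    using that gE E_sym unfolding ico_adj_def by blast
  have ginj: "inj_on g {0..<12}"
  proof (rule inj_onI)
    fix a b :: nat assume ab: "a \<in> {0..<12}" "b \<in> {0..<12}" and e: "g a = g b"
    have ca: "a = 0 \<or> (\<exists>i<5. a = 1 + i) \<or> (\<exists>i<5. a = 6 + i) \<or> a = 11"
      and cb: "b = 0 \<or> (\<exists>i<5. b = 1 + i) \<or> (\<exists>i<5. b = 6 + i) \<or> b = 11"
      using ico_vertex_cases ab by auto
    have w4: "w (i + 4) = w (j + 4) \<longleftrightarrow> i = j" if "i < 5" "j < 5" for i j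
      using add_mod_cancel[of 4 i 5 j] that unfolding w_inj by (simp add: add.commute)
    have x5: "x i = x j \<longleftrightarrow> i = j" if "i < 5" "j < 5" for i j using that unfolding x(1) by simp
    show "a = b" using ca cb e
      by (elim disjE exE conjE; simp only: g gx w4 x5 d7 d7[symmetric] d8 d8[symmetric] dt dt[symmetric])
  qed
  have gN: "g ` {b. b < 12 \<and> ico_adj a b} = N (g a)" if a: "a < 12" for a
  proof (rule card_subset_eq)
    show "g ` {b. b < 12 \<and> ico_adj a b} \<subseteq> N (g a)" using gadj by auto
    have "inj_on g {b. b < 12 \<and> ico_adj a b}" by (rule inj_on_subset[OF ginj]) auto
    then have c: "card (g ` {b. b < 12 \<and> ico_adj a b}) = 5" by (simp add: card_image ico_degree[OF a])
    have "{b. b < 12 \<and> ico_adj a b} \<noteq> {}" using ico_degree[OF a] by (metis card.empty zero_neq_numeral)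
    then obtain b where "E (g a) (g b)" using gadj by blast
    then show "card (g ` {b. b < 12 \<and> ico_adj a b}) = card (N (g a))" using c card_N[OF E_V(1)] k by simp
  qed simp
  have img: "g ` {0..<12} = V"
  proof
    have step: "b \<in> g ` {0..<12}" if "a < 12" "E (g a) b" for a b
    proof -
      have "b \<in> g ` {b. b < 12 \<and> ico_adj a b}" unfolding gN[OF that(1)] using that(2) by simp
      then show ?thesis by auto
    qed
    have "y \<in> g ` {0..<12}" if "y \<in> V" for y
    proof (rule conn_induct[OF u _ _ that])
      show "u \<in> g ` {0..<12}" using g(1) by (metis atLeastLessThan_iff imageI le0 zero_less_numeral)
      show "q \<in> g ` {0..<12}" if "p \<in> g ` {0..<12}" "E p q" for p q using that step by auto
    qed
    then show "V \<subseteq> g ` {0..<12}" by blast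
    show "g ` {0..<12} \<subseteq> V"
    proof
      fix y assume "y \<in> g ` {0..<12}"
      then obtain a where a: "a < 12" "y = g a" by auto
      have "{b. b < 12 \<and> ico_adj a b} \<noteq> {}" using ico_degree[OF a(1)] by (metis card.empty zero_neq_numeral)
      then show "y \<in> V" using gadj E_V a(2) by blast
    qed
  qed
  have iff: "E (g a) (g b) \<longleftrightarrow> ico_adj a b" if ab: "a < 12" "b < 12" for a b
  proof
    assume "E (g a) (g b)"
    then have "g b \<in> g ` {b. b < 12 \<and> ico_adj a b}" unfolding gN[OF ab(1)] by simp
    then obtain b' where "b' < 12" "ico_adj a b'" "g b = g b'" by auto
    then show "ico_adj a b" using inj_onD[OF ginj, of b b'] ab by simp
  qed (rule gadj)
  have bij: "bij_betw g {0..<12} V" using ginj img by (simp add: bij_betw_def)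
  let ?f = "inv_into {0..<12} g"
  have "bij_betw ?f V {0..<12}" using bij by (rule bij_betw_inv_into)
  moreover have "E p q \<longleftrightarrow> ico_adj (?f p) (?f q)" if pq: "p \<in> V" "q \<in> V" for p q
  proof -
    have "?f p < 12" "?f q < 12" using bij_betwE[OF bij_betw_inv_into[OF bij]] pq by auto
    moreover have "g (?f p) = p" "g (?f q) = q" using bij_betw_inv_into_right[OF bij] pq by auto
    ultimately show ?thesis using iff by metis
  qed
  ultimately show ?thesis unfolding isomorphic_to_icosahedron_def graph_iso_def by blast
qed

theorem triangle_imp_icosahedron:
  assumes "a1 > 0" "k \<le> 8" shows "isomorphic_to_icosahedron V E"
  using triangle_cases[OF assms] no_7_2 no_7_4 pentagon_imp_icosahedron by blast

end

section \<open>Quadrangles closing up to cubes\<close>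

context tfree_graph
begin

text \<open>\<open>opp v x y\<close> is the vertex opposite to \<open>v\<close> in the quadrangle through \<open>x, v, y\<close>
  (junk unless \<open>x, y\<close> are distinct neighbours of \<open>v\<close>).\<close>

definition opp :: "'a \<Rightarrow> 'a \<Rightarrow> 'a \<Rightarrow> 'a" where
  "opp v x y = (THE z. E x z \<and> E y z \<and> z \<noteq> v)"

lemma opp_unique:
  assumes "E v x" "E v y" "x \<noteq> y"
  shows "E x z \<and> E y z \<and> z \<noteq> v \<longleftrightarrow> z = opp v x y"
proof -
  have "D x y" using tfree_D[OF tf assms] .
  then have "card {z. E x z \<and> E y z} = 2" using card_common_D c2_2 by simp
  then obtain p q where pq: "{z. E x z \<and> E y z} = {p, q}" "p \<noteq> q" using card_2_iff by metis
  have "v \<in> {z. E x z \<and> E y z}" using assms E_sym by blast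
  then have v: "v = p \<or> v = q" using pq by simp
  define r where "r = (if v = p then q else p)"
  have r: "E x z \<and> E y z \<and> z \<noteq> v \<longleftrightarrow> z = r" for z
  proof -
    have "E x z \<and> E y z \<longleftrightarrow> z = p \<or> z = q" using pq(1) by blast
    then show ?thesis using v pq(2) unfolding r_def by auto
  qed
  have "opp v x y = r" unfolding opp_def by (simp only: r) simp
  then show ?thesis using r by simp
qed

lemma opp:
  assumes "E v x" "E v y" "x \<noteq> y"
  shows "E x (opp v x y)" "E y (opp v x y)" "opp v x y \<noteq> v" "E (opp v x y) x" "E (opp v x y) y"
  using opp_unique[OF assms, of "opp v x y"] E_sym by blast+

lemma opp_eqI:
  assumes "E v x" "E v y" "x \<noteq> y" "E x z" "E y z" "z \<noteq> v" shows "opp v x y = z"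
  using iffD1[OF opp_unique[OF assms(1-3)], of z] assms(4-6) by simp

lemma opp_commute: "E v x \<Longrightarrow> E v y \<Longrightarrow> x \<noteq> y \<Longrightarrow> opp v x y = opp v y x"
  by (rule opp_eqI) (use opp[of v y x] in auto)

lemma opp_opp: assumes "E v x" "E v y" "x \<noteq> y" shows "opp x v (opp v x y) = y"
  using opp_eqI[of x v "opp v x y" y] opp[OF assms] assms E_sym by metis

lemma opp_G:
  assumes "g \<in> G" "E v x" "E v y" "x \<noteq> y" shows "g (opp v x y) = opp (g v) (g x) (g y)"
  by (rule opp_eqI[symmetric]) (use opp[OF assms(2-4)] assms in simp_all)

lemma opp_inj:
  assumes "E v x" "E v y" "E v z" "x \<noteq> y" "x \<noteq> z" "opp v x y = opp v x z" shows "y = z"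
  by (rule trans[OF opp_opp[OF assms(1,2,4), symmetric] opp_opp[OF assms(1,3,5), folded assms(6)]])

lemma D_opp: assumes "E v x" "E v y" "x \<noteq> y" shows "D v (opp v x y)"
proof -
  have "E x v" "E x (opp v x y)" using assms(1) E_sym opp[OF assms] by blast+
  then show ?thesis using tfree_D[OF tf] opp(3)[OF assms] by metis
qed

lemma card_N7: "v \<in> V \<Longrightarrow> card (N v) = 7"
  using card_N k7 by simp

lemma bij_N:
  assumes v: "v \<in> V" "w \<in> V" and "inj_on f (N v)" "\<And>x. E v x \<Longrightarrow> E w (f x)"
  shows "bij_betw f (N v) (N w)"
proof -
  have "f ` N v = N w"
    by (rule card_subset_eq) (use assms card_image[OF assms(3)] card_N7 in auto)
  then show ?thesis using assms(3) by (simp add: bij_betw_def)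
qed

end

text \<open>The three quadrangles at \<open>v\<close> on \<open>a\<close>, \<open>b\<close>,
  \<open>c\<close> are three faces of a would-be cube. The hypothesis says that its last corner is
  the same whether it is reached from \<open>a\<close> or from \<open>b\<close>.\<close>

locale cube_closing = tfree_graph +
  assumes closing: "\<And>v a b c. E v a \<Longrightarrow> E v b \<Longrightarrow> E v c \<Longrightarrow> a \<noteq> b \<Longrightarrow> a \<noteq> c \<Longrightarrow> b \<noteq> c \<Longrightarrow>
    opp a (opp v a b) (opp v a c) = opp b (opp v a b) (opp v b c)"
  fixes u :: 'a
  assumes uV: "u \<in> V"
begin

text \<open>A frame is a vertex together with a labelling of its neighbours by the neighbours of \<open>u\<close>.
  Moving along the edge labelled \<open>x\<close> transports labels through the squares, and cube closing makes
  these moves commute. Moves are the identity on non-frames, so that they commute outright.\<close>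

definition frame :: "'a \<times> ('a \<Rightarrow> 'a) \<Rightarrow> bool" where
  "frame F \<longleftrightarrow> fst F \<in> V \<and> bij_betw (snd F) (N u) (N (fst F))"

definition move :: "'a \<Rightarrow> 'a \<times> ('a \<Rightarrow> 'a) \<Rightarrow> 'a \<times> ('a \<Rightarrow> 'a)" where
  "move x F = (if frame F \<and> E u x
     then (snd F x, \<lambda>y. if y = x then fst F else if E u y then opp (fst F) (snd F x) (snd F y) else snd F y)
     else F)"

lemma frameD:
  assumes "frame (v, L)"
  shows "v \<in> V" "E u x \<Longrightarrow> E v (L x)" "E u x \<Longrightarrow> E u y \<Longrightarrow> L x = L y \<longleftrightarrow> x = y"
    "E v z \<Longrightarrow> \<exists>x. E u x \<and> L x = z"
proof -
  have b: "bij_betw L (N u) (N v)" and "v \<in> V" using assms by (auto simp: frame_def)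
  then show "v \<in> V" by blast
  show "E u x \<Longrightarrow> E v (L x)" using bij_betwE[OF b] by simp
  show "E u x \<Longrightarrow> E u y \<Longrightarrow> L x = L y \<longleftrightarrow> x = y" using inj_on_eq_iff[OF bij_betw_imp_inj_on[OF b]] by simp
  show "E v z \<Longrightarrow> \<exists>x. E u x \<and> L x = z" using bij_betw_imp_surj_on[OF b] by (metis imageE in_N)
qed

lemma move_eq:
  assumes "frame (v, L)" "E u x"
  shows "move x (v, L) = (L x, \<lambda>y. if y = x then v else if E u y then opp v (L x) (L y) else L y)"
  unfolding move_def fst_conv snd_conv using assms by simp

lemma frame_move: assumes "frame F" shows "frame (move x F)"
proof (cases "E u x")
  case True
  obtain v L where F: "F = (v, L)" by (cases F)
  note f = frameD[OF assms[unfolded F]]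
  let ?M = "\<lambda>y. if y = x then v else if E u y then opp v (L x) (L y) else L y"
  have e: "E v (L x)" using f True by blast
  have "bij_betw ?M (N u) (N (L x))"
  proof (rule bij_N[OF uV])
    show "L x \<in> V" using E_V e by blast
    show "E (L x) (?M y)" if "E u y" for y
      using that opp(1)[OF e f(2)[OF that]] f(3)[OF True that] E_sym[OF e] by auto
    show "inj_on ?M (N u)"
    proof (rule inj_onI)
      fix y z assume yz: "y \<in> N u" "z \<in> N u" "?M y = ?M z"
      have o: "opp v (L x) (L t) \<noteq> v" if "E u t" "t \<noteq> x" for t
        using opp(3)[OF e f(2)[OF that(1)]] f(3)[OF True that(1)] that(2) by blast
      show "y = z"
      proof (cases "y = x \<or> z = x")
        case True
        then show ?thesis using yz o[of y] o[of z] by (auto split: if_splits)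
      next
        case False
        then have "opp v (L x) (L y) = opp v (L x) (L z)" using yz by simp
        then have "L y = L z"
          by (intro opp_inj[OF e f(2) f(2)]) (use yz False f(3)[OF True] in auto)
        then show ?thesis using f(3) yz by simp
      qed
    qed
  qed
  then show ?thesis using E_V(2)[OF e] unfolding F move_eq[OF assms[unfolded F] True] by (simp add: frame_def)
qed (simp add: move_def assms)

lemma move_move: "move x (move x F) = F"
proof (cases "frame F \<and> E u x")
  case True
  obtain v L where F: "F = (v, L)" by (cases F)
  have fr: "frame (v, L)" and x: "E u x" using True F by auto
  note f = frameD[OF fr]
  have fr': "frame (L x, \<lambda>y. if y = x then v else if E u y then opp v (L x) (L y) else L y)"
    using frame_move[OF fr, of x] unfolding move_eq[OF fr x] .
  have "opp (L x) v (opp v (L x) (L y)) = L y" if "E u y" "y \<noteq> x" for y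
    by (rule opp_opp) (use f x that in auto)
  then show ?thesis unfolding F move_eq[OF fr x] move_eq[OF fr' x] by auto
qed (auto simp: move_def)

lemma move_commute: "move y (move x F) = move x (move y F)"
proof (cases "frame F \<and> E u x \<and> E u y \<and> x \<noteq> y")
  case True
  obtain v L where F: "F = (v, L)" by (cases F)
  have fr: "frame (v, L)" and x: "E u x" and y: "E u y" and xy: "x \<noteq> y" using True F by auto
  note f = frameD[OF fr]
  have fr': "frame (L p, \<lambda>y. if y = p then v else if E u y then opp v (L p) (L y) else L y)" if "E u p" for p
    using frame_move[OF fr, of p] unfolding move_eq[OF fr that] .
  have L: "E v (L x)" "E v (L y)" "L x \<noteq> L y" using f x y xy by blast+
  have oo: "opp (L x) (opp v (L x) (L y)) v = L y" "opp (L y) (opp v (L x) (L y)) v = L x"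
    "opp v (L y) (L x) = opp v (L x) (L y)"
  proof -
    show c: "opp v (L y) (L x) = opp v (L x) (L y)" using opp_commute L by metis
    have o: "E (L x) (opp v (L x) (L y))" "E (L x) v" "opp v (L x) (L y) \<noteq> v" "E (L y) (opp v (L x) (L y))" "E (L y) v"
      using opp[OF L] L E_sym by blast+
    show "opp (L x) (opp v (L x) (L y)) v = L y" using opp_opp[OF L] opp_commute[OF o(1-3)] by simp
    show "opp (L y) (opp v (L x) (L y)) v = L x"
      using opp_opp[OF L(2,1) L(3)[symmetric]] opp_commute[OF o(4,5,3)] c by simp
  qed
  have cl: "opp (L x) (opp v (L x) (L y)) (opp v (L x) (L z)) = opp (L y) (opp v (L x) (L y)) (opp v (L y) (L z))"
    if "E u z" "z \<noteq> x" "z \<noteq> y" for z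
    by (rule closing) (use f x y xy that in auto)
  show ?thesis
    unfolding F move_eq[OF fr x] move_eq[OF fr y] move_eq[OF fr'[OF x] y] move_eq[OF fr'[OF y] x]
    using xy x y by (auto simp: oo cl fun_eq_iff)
next
  case False
  then consider "\<not> frame F" | "frame F" "\<not> E u x" | "frame F" "\<not> E u y" | "x = y" by blast
  then show ?thesis by cases (simp_all add: move_def)
qed

section \<open>The covering of the graph by the 7-cube\<close>

sublocale moves: comp_fun_commute move
  by standard (simp add: fun_eq_iff move_commute)

text \<open>Subsets of \<open>N u\<close> are the vertices of the 7-cube, \<open>flip\<close>
  crosses one of its edges, and \<open>base\<close> is the covering map. Since moves commute, the
  product of moves over a set is well defined and \<open>Finite_Set.fold\<close> expresses
  it.\<close>

definition lift :: "'a set \<Rightarrow> 'a \<times> ('a \<Rightarrow> 'a) \<Rightarrow> 'a \<times> ('a \<Rightarrow> 'a)" where "lift I F = Finite_Set.fold move F I"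
definition base :: "'a set \<Rightarrow> 'a" where "base I = fst (lift I (u, id))"

definition flip :: "'a set \<Rightarrow> 'a \<Rightarrow> 'a set" where "flip I x = (if x \<in> I then I - {x} else insert x I)"

lemma lift_empty [simp]: "lift {} F = F"
  by (simp add: lift_def)

lemma lift_insert: "finite I \<Longrightarrow> x \<notin> I \<Longrightarrow> lift (insert x I) F = move x (lift I F)"
  by (simp add: lift_def)

lemma lift_flip: assumes "finite I" shows "lift (flip I x) F = move x (lift I F)"
proof (cases "x \<in> I")
  case True
  have "lift I F = move x (lift (I - {x}) F)"
    using lift_insert[of "I - {x}" x F] assms True by (simp add: insert_absorb)
  then show ?thesis using True by (simp add: flip_def move_move)
qed (simp add: flip_def lift_insert assms)

lemma frame_lift: "finite I \<Longrightarrow> frame F \<Longrightarrow> frame (lift I F)"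
  by (induction I rule: finite_induct) (simp_all add: lift_insert frame_move)

lemma frame0: "frame (u, id)"
  using uV by (simp add: frame_def)

lemma base_empty [simp]: "base {} = u"
  by (simp add: base_def)

lemma snd_lift: assumes "finite I" "E u x" shows "snd (lift I (u, id)) x = base (flip I x)"
proof -
  have "frame (lift I (u, id))" using frame_lift[OF assms(1) frame0] .
  then show ?thesis unfolding base_def lift_flip[OF assms(1)] move_def using assms(2) by simp
qed

lemma finI: "I \<subseteq> N u \<Longrightarrow> finite I"
  by (rule finite_subset[OF _ fin_N])

lemma base_nbr:
  assumes "I \<subseteq> N u"
  shows "E u x \<Longrightarrow> E (base I) (base (flip I x))"
    "E u x \<Longrightarrow> E u y \<Longrightarrow> base (flip I x) = base (flip I y) \<longleftrightarrow> x = y"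
    "E (base I) z \<Longrightarrow> \<exists>x. E u x \<and> base (flip I x) = z"
proof -
  have fr: "frame (base I, snd (lift I (u, id)))"
    using frame_lift[OF finI[OF assms] frame0] by (simp add: base_def)
  note f = frameD[OF fr]
  note s = snd_lift[OF finI[OF assms]]
  show "E u x \<Longrightarrow> E (base I) (base (flip I x))" using f(2) s by metis
  show "E u x \<Longrightarrow> E u y \<Longrightarrow> base (flip I x) = base (flip I y) \<longleftrightarrow> x = y" using f(3) s by metis
  show "E (base I) z \<Longrightarrow> \<exists>x. E u x \<and> base (flip I x) = z" using f(4) s by metis
qed

lemma base_single: "E u x \<Longrightarrow> base {x} = x"
  using snd_lift[of "{}" x] by (simp add: flip_def)

lemma flip_subset: "I \<subseteq> N u \<Longrightarrow> E u x \<Longrightarrow> flip I x \<subseteq> N u"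
  by (auto simp: flip_def)

lemma flip_flip [simp]: "flip (flip I x) x = I"
  by (auto simp: flip_def)

lemma flip_eq: "flip I x = (I - {x}) \<union> ({x} - I)"
  by (auto simp: flip_def)

lemma base_surj: assumes "y \<in> V" shows "\<exists>I \<subseteq> N u. base I = y"
proof (rule conn_induct[OF uV _ _ assms])
  show "\<exists>I\<subseteq>N u. base I = u" by (rule exI[of _ "{}"]) simp
  fix p q assume "\<exists>I\<subseteq>N u. base I = p" and e: "E p q"
  then obtain I where I: "I \<subseteq> N u" "base I = p" by blast
  then obtain x where "E u x" "base (flip I x) = q" using base_nbr(3) e by blast
  then show "\<exists>I\<subseteq>N u. base I = q" using flip_subset[OF I(1)] by blast
qed

lemma base_dist12:
  assumes "I \<subseteq> N u" "E u x" "E u y" "x \<noteq> y"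
  shows "base I \<noteq> base (flip I x)" "D (base I) (base (flip (flip I x) y))"
proof -
  have 1: "E (base I) (base (flip I x))" using base_nbr assms by blast
  have s: "flip I x \<subseteq> N u" using flip_subset assms by blast
  have 2: "E (base (flip I x)) (base (flip (flip I x) y))" using base_nbr(1)[OF s assms(3)] .
  have "base (flip (flip I x) y) \<noteq> base (flip (flip I x) x)"
    using base_nbr(2)[OF s assms(3,2)] assms(4) by blast
  then have "base I \<noteq> base (flip (flip I x) y)" by (simp add: eq_commute)
  then show "D (base I) (base (flip (flip I x) y))"
    using tfree_D[OF tf E_sym[OF 1] 2] by blast
  show "base I \<noteq> base (flip I x)" using 1 E_irrefl by metis
qed

text \<open>Two sets with equal image at cube distance 1, 2 or 3 would give a loop, a pair at
  distance 2 from itself, or an edge between vertices at distance 2. Distance 4 is excluded by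
  \<open>c2 = 2\<close>.\<close>

lemma base_far:
  assumes I: "I \<subseteq> N u" and S: "S \<subseteq> N u" and c: "card S \<le> 4" and eq: "base I = base ((I - S) \<union> (S - I))"
  shows "S = {}"
proof (rule ccontr)
  assume ne: "S \<noteq> {}"
  have fS: "finite S" using finI S by blast
  have "card S \<noteq> 0" using ne fS by simp
  then consider "card S = 1" | "card S = 2" | "card S = 3" | "card S = 4" using c by linarith
  then show False
  proof cases
    case 1
    then obtain x where x: "S = {x}" using card_1_singletonE by blast
    have "(I - S) \<union> (S - I) = flip I x" unfolding x flip_eq ..
    then have "E (base I) (base I)" using base_nbr(1)[OF I, of x] eq S x by simp
    then show False by simp
  next
    case 2
    then obtain x y where xy: "S = {x, y}" "x \<noteq> y" using card_2_iff by metis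
    have "(I - S) \<union> (S - I) = flip (flip I x) y" unfolding flip_eq using xy by blast
    then have "D (base I) (base I)" using base_dist12(2)[OF I, of x y] eq S xy by simp
    then show False by (simp add: D_def)
  next
    case 3
    then obtain x y z where xyz: "S = {x, y, z}" "x \<noteq> y" "y \<noteq> z" "x \<noteq> z" using card_3_iff by metis
    let ?J = "flip (flip I x) y"
    have "E u x" "E u y" using S xyz(1) by auto
    then have J: "?J \<subseteq> N u" using flip_subset[OF flip_subset[OF I]] by blast
    have "(I - S) \<union> (S - I) = flip ?J z" unfolding flip_eq using xyz by blast
    then have "E (base ?J) (base I)" using base_nbr(1)[OF J, of z] eq S xyz by simp
    moreover have "D (base I) (base ?J)" using base_dist12(2)[OF I] S xyz by simp
    ultimately show False using E_sym unfolding D_def by blast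
  next
    \<comment> \<open>\<open>?M\<close> lies halfway between the two sets. Its neighbours in
      directions \<open>x\<close> and \<open>y\<close> lead to \<open>I\<close>, the one in
      direction \<open>z\<close> leads to the other set. As both sets have the same image, this
      image and \<open>base ?M\<close> have three common neighbours.\<close>
    case 4
    then obtain x S' where "S = insert x S'" "x \<notin> S'" "card S' = 3" using card_eq_SucD[of S 3] by auto
    then obtain y z t where s: "S = {x, y, z, t}" "x \<notin> {y, z, t}" "y \<noteq> z" "z \<noteq> t" "y \<noteq> t"
      using card_3_iff by metis
    have e: "E u x" "E u y" "E u z" "E u t" using s S by auto
    let ?M = "flip (flip I x) y"
    have M: "?M \<subseteq> N u" using flip_subset[OF flip_subset[OF I e(1)] e(2)] .
    have Mx: "flip (flip ?M x) y = I" "flip (flip ?M y) x = I" using s by (auto simp: flip_eq)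
    have Mz: "flip (flip ?M z) t = (I - S) \<union> (S - I)" "flip (flip ?M t) z = (I - S) \<union> (S - I)"
      using s by (auto simp: flip_eq)
    let ?w = "base I"
    have d: "D (base ?M) ?w" using base_dist12(2)[OF M e(1,2)] Mx(1) s by simp
    have nb: "E (base (flip ?M p)) (base ?M)" "E (base (flip ?M p)) (base (flip (flip ?M p) q))" if "E u p" "E u q" for p q
      using base_nbr(1)[OF M that(1)] E_sym base_nbr(1)[OF flip_subset[OF M that(1)] that(2)] by blast+
    have "{base (flip ?M x), base (flip ?M y), base (flip ?M z)} \<subseteq> {r. E (base ?M) r \<and> E ?w r}"
      using nb[OF e(1,2)] nb[OF e(2,1)] nb[OF e(3,4)] Mx Mz eq E_sym by simp
    moreover have "card {base (flip ?M x), base (flip ?M y), base (flip ?M z)} = 3"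
      using base_nbr(2)[OF M e(1,2)] base_nbr(2)[OF M e(2,3)] base_nbr(2)[OF M e(1,3)] s by (simp del: flip_flip)
    moreover have "finite {r. E (base ?M) r \<and> E ?w r}" by simp
    ultimately have "3 \<le> card {r. E (base ?M) r \<and> E ?w r}" by (metis card_mono)
    then show False using card_common_D[OF d] c2_2 by simp
  qed
qed

definition reindex :: "('a \<Rightarrow> 'a) \<Rightarrow> 'a \<times> ('a \<Rightarrow> 'a) \<Rightarrow> 'a \<times> ('a \<Rightarrow> 'a)" where
  "reindex s F = (fst F, snd F \<circ> s)"

definition act :: "('a \<Rightarrow> 'a) \<Rightarrow> 'a \<times> ('a \<Rightarrow> 'a) \<Rightarrow> 'a \<times> ('a \<Rightarrow> 'a)" where
  "act g F = (g (fst F), g \<circ> snd F)"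

text \<open>An automorphism fixing \<open>u\<close> changes the initial frame merely by a
  relabelling. This lemma and \<open>lift_act\<close> compute the two resulting lifts, and comparing
  them makes \<open>base\<close> equivariant.\<close>

lemma lift_reindex:
  assumes s: "bij s" "\<And>x. E u (s x) \<longleftrightarrow> E u x" and "finite I" "frame F"
  shows "lift I (reindex s F) = reindex s (lift (s ` I) F)"
  using assms(3)
proof (induction I rule: finite_induct)
  case (insert x I)
  have inj: "inj s" using s(1) bij_is_inj by blast
  have bN: "bij_betw s (N u) (N u)"
  proof -
    have "s ` N u = N u"
      by (rule endo_inj_surj) (use s(2) inj in \<open>auto simp: inj_on_def dest: injD\<close>)
    then show ?thesis using inj by (simp add: bij_betw_def inj_on_def)
  qed
  have fr: "frame (lift (s ` I) F)" using frame_lift assms(4) insert.hyps by blast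
  obtain v L where vL: "lift (s ` I) F = (v, L)" by (cases "lift (s ` I) F")
  have fvL: "frame (v, L)" using fr vL by simp
  have fr': "frame (v, L \<circ> s)"
    using fvL bij_betw_trans[OF bN] by (auto simp: frame_def)
  have "s x \<notin> s ` I" using insert.hyps inj by (auto dest: injD)
  then have "lift (s ` insert x I) F = move (s x) (v, L)"
    using lift_insert[of "s ` I" "s x" F] insert.hyps vL by simp
  moreover have "lift (insert x I) (reindex s F) = move x (v, L \<circ> s)"
    using insert vL by (simp add: lift_insert reindex_def)
  moreover have "move x (v, L \<circ> s) = reindex s (move (s x) (v, L))"
  proof (cases "E u x")
    case True
    then show ?thesis using move_eq[OF fr' True] move_eq[OF fvL, of "s x"] s(2) inj
      by (auto simp: reindex_def fun_eq_iff dest: injD)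
  next
    case False
    then show ?thesis using s(2) by (simp add: move_def reindex_def)
  qed
  ultimately show ?case by simp
qed simp

lemma lift_act:
  assumes g: "g \<in> G" and "finite I" "frame F"
  shows "lift I (act g F) = act g (lift I F)"
  using assms(2)
proof (induction I rule: finite_induct)
  case (insert x I)
  obtain v L where vL: "lift I F = (v, L)" by (cases "lift I F")
  have fvL: "frame (v, L)" using frame_lift[OF insert.hyps(1) assms(3)] vL by simp
  note f = frameD[OF fvL]
  have fr': "frame (g v, g \<circ> L)"
    unfolding frame_def fst_conv snd_conv
  proof
    show "g v \<in> V" using f(1) g by simp
    show "bij_betw (g \<circ> L) (N u) (N (g v))"
      by (rule bij_N[OF uV]) (use f g in \<open>auto simp: inj_on_def\<close>)
  qed
  have "move x (g v, g \<circ> L) = act g (move x (v, L))"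
  proof (cases "E u x")
    case True
    have "g (opp v (L x) (L y)) = opp (g v) (g (L x)) (g (L y))" if "E u y" "y \<noteq> x" for y
      by (rule opp_G[OF g]) (use f True that in auto)
    then show ?thesis using move_eq[OF fr' True] move_eq[OF fvL True] by (auto simp: act_def fun_eq_iff)
  next
    case False
    then show ?thesis by (simp add: move_def act_def)
  qed
  then show ?case using insert vL by (simp add: lift_insert act_def)
qed simp

lemma base_equivariant:
  assumes "g \<in> G" "g u = u" "I \<subseteq> N u" shows "base (g ` I) = g (base I)"
proof -
  have e: "E u (g x) \<longleftrightarrow> E u x" for x using G_E[OF assms(1), of u x] assms(2) by simp
  have "reindex g (u, id) = act g (u, id)" using assms(2) by (simp add: reindex_def act_def)
  then have "reindex g (lift (g ` I) (u, id)) = act g (lift I (u, id))"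
    using lift_reindex[OF G_bij[OF assms(1)] e finI[OF assms(3)] frame0] lift_act[OF assms(1) finI[OF assms(3)] frame0] by simp
  then show ?thesis by (simp add: base_def reindex_def act_def)
qed

lemma lift_outside: "finite I \<Longrightarrow> \<not> E u y \<Longrightarrow> frame F \<Longrightarrow> snd (lift I F) y = snd F y"
proof (induction I rule: finite_induct)
  case (insert x I)
  then have "frame (lift I F)" using frame_lift by blast
  then show ?case using insert by (auto simp: lift_insert move_def)
qed simp

text \<open>The fibre of \<open>u\<close> is invariant under the stabilizer of \<open>u\<close>, and its elements are pairwise at
  distance at least 5 in the cube; hence it contains at most the two constant words.\<close>

lemma fibre:
  assumes "I \<subseteq> N u" "base I = u" "I \<noteq> {}" shows "I = N u"
proof -
  have "card I \<ge> 5"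
    using base_far[of "{}" I] assms by fastforce
  have inv: "g ` I = I" if g: "g \<in> G" "g u = u" for g
  proof -
    have gN: "g ` I \<subseteq> N u" using assms(1) G_E[OF g(1), of u] g(2) by auto
    have b: "base (g ` I) = base I" using base_equivariant[OF g assms(1)] assms(2) g by simp
    let ?S = "(I - g ` I) \<union> (g ` I - I)"
    have "(I - ?S) \<union> (?S - I) = g ` I" by blast
    moreover have "card ?S \<le> 4"
    proof -
      have fin: "finite I" "finite (g ` I)" using finI assms(1) by auto
      have "I - g ` I \<subseteq> N u - g ` I" "g ` I - I \<subseteq> N u - I" using assms(1) gN by auto
      then have "card (I - g ` I) \<le> card (N u - g ` I)" "card (g ` I - I) \<le> card (N u - I)"
        by (intro card_mono; simp)+
      moreover have "card (N u - g ` I) = 7 - card (g ` I)" "card (N u - I) = 7 - card I"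
        using card_Diff_subset[OF fin(2) gN] card_Diff_subset[OF fin(1) assms(1)] card_N7[OF uV] by simp_all
      moreover have "card (g ` I) = card I" using card_image_G[OF g(1)] .
      moreover have "card ?S \<le> card (I - g ` I) + card (g ` I - I)" by (rule card_Un_le)
      ultimately show ?thesis using \<open>card I \<ge> 5\<close> by linarith
    qed
    moreover have "?S \<subseteq> N u" using assms(1) gN by blast
    ultimately have "?S = {}" using base_far[OF assms(1)] b by metis
    then show ?thesis by blast
  qed
  obtain x where x: "x \<in> I" using assms(3) by blast
  have "y \<in> I" if y: "E u y" for y
  proof -
    have "E u x" using x assms(1) by auto
    then obtain g where "g \<in> G" "g u = u" "g x = y" using nt y by blast
    then show ?thesis using inv x by blast
  qed
  then show ?thesis using assms(1) by auto
qed

text \<open>Lifting along all of \<open>N u\<close> returns to \<open>u\<close> with the labels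
  permuted by some \<open>s\<close>, and \<open>base\<close> of a complement is \<open>base\<close>
  of the image under \<open>s\<close>. Complementing twice shows that \<open>s\<close> is an
  involution on seven points, so it has a fixed point. Since \<open>s\<close> commutes with the
  stabilizer of \<open>u\<close>, which is transitive on \<open>N u\<close>, it is the identity
  there.\<close>

lemma base_complement:
  assumes full: "base (N u) = u" and I: "I \<subseteq> N u" shows "base (N u - I) = base I"
proof -
  define s where "s = snd (lift (N u) (u, id))"
  have L: "lift (N u) (u, id) = (u, s)" using full unfolding base_def s_def by (metis prod.collapse)
  have fr: "frame (u, s)" using frame_lift[OF fin_N frame0, of u] L by simp
  have bb: "bij_betw s (N u) (N u)" using fr by (simp add: frame_def)
  have out: "s x = x" if "\<not> E u x" for x using lift_outside[OF fin_N[of u] that frame0] unfolding s_def by simp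
  have se: "E u (s x) \<longleftrightarrow> E u x" for x using bij_betwE[OF bb] out[of x] by (cases "E u x") auto
  have bs: "bij s"
  proof -
    have "bij_betw s (- N u) (- N u)" using out by (auto simp: bij_betw_def inj_on_def image_iff)
    then have "bij_betw s (N u \<union> - N u) (N u \<union> - N u)" using bb by (intro bij_betw_combine) auto
    then show ?thesis by simp
  qed
  have key: "base (N u - J) = base (s ` J)" if J: "J \<subseteq> N u" for J
  proof -
    have "lift J (lift (N u) (u, id)) = lift (N u - J) (u, id)"
      using finI[OF J] J
    proof (induction J rule: finite_induct)
      case (insert x J)
      have "lift (insert x J) (lift (N u) (u, id)) = move x (lift (N u - J) (u, id))"
        using insert.IH insert.prems lift_insert[OF insert.hyps] by (metis insert_subset)
      also have "\<dots> = lift (flip (N u - J) x) (u, id)" by (rule lift_flip[symmetric]) simp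
      also have "flip (N u - J) x = N u - insert x J" using insert by (auto simp: flip_def)
      finally show ?case .
    qed simp
    moreover have "lift (N u) (u, id) = reindex s (u, id)" using L by (simp add: reindex_def)
    ultimately show ?thesis
      using lift_reindex[OF bs se finI[OF J] frame0] by (simp add: base_def reindex_def)
  qed
  have sx: "base (N u - {x}) = s x" if "E u x" for x
    using key[of "{x}"] base_single[of "s x"] se[of x] that by simp
  have ss: "s (s x) = x" if x: "E u x" for x
  proof -
    have "base (N u - (N u - {x})) = base (s ` (N u - {x}))" by (rule key) auto
    moreover have "N u - (N u - {x}) = {x}" using x by auto
    moreover have "s ` (N u - {x}) = N u - {s x}"
      using bb x by (simp add: bij_betw_def inj_on_image_set_diff[of s "N u" "N u" "{x}"])
    ultimately show ?thesis using base_single[OF x] sx[of "s x"] se[of x] x by simp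
  qed
  have "\<exists>x. E u x \<and> s x = x"
  proof (rule ccontr)
    assume "\<not> ?thesis"
    then have "even (card (N u))"
      using ss se by (intro even_card_involution[of "N u" s]) auto
    then show False using card_N7[OF uV] by simp
  qed
  then obtain x0 where x0: "E u x0" "s x0 = x0" by blast
  have id: "s y = y" if y: "E u y" for y
  proof -
    obtain g where g: "g \<in> G" "g u = u" "g x0 = y" using nt[OF x0(1) y] by blast
    have gN: "g ` N u = N u"
    proof -
      have "E u (g x) \<longleftrightarrow> E u x" for x using G_E[OF g(1), of u x] g(2) by simp
      then have "g ` N u \<subseteq> N u" by auto
      then show ?thesis by (rule endo_inj_surj[OF fin_N]) (simp add: inj_on_def g(1))
    qed
    have "g ` (N u - {x0}) = N u - {y}"
      using gN g by (metis G_bij bij_is_inj image_empty image_insert image_set_diff)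
    then have "s y = g (s x0)"
      using base_equivariant[OF g(1,2), of "N u - {x0}"] sx[OF y] sx[OF x0(1)] by auto
    then show ?thesis using x0 g by simp
  qed
  have "s ` I = I" using id I by (auto simp: image_iff subset_iff)
  then show ?thesis using key[OF I] by simp
qed

text \<open>Removing the elements of \<open>I\<close> one at a time and following along in
  \<open>K\<close> moves the coincidence into the fibre of \<open>u\<close>, so \<open>fibre\<close>
  gives \<open>base (N u) = u\<close>. Then \<open>I\<close> and \<open>K\<close> differ in at least
  five places, hence \<open>N u - I\<close> and \<open>K\<close> in at most four, and
  \<open>base_far\<close> makes them equal.\<close>

lemma base_eq:
  assumes I: "I \<subseteq> N u" and K: "K \<subseteq> N u" and eq: "base I = base K" and ne: "I \<noteq> K"
  shows "base (N u) = u \<and> K = N u - I"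
proof -
  have "\<exists>K' \<subseteq> N u. K' \<noteq> {} \<and> base K' = u"
    using finI[OF I] I K eq ne
  proof (induction I arbitrary: K rule: finite_induct)
    case (insert x I)
    have x: "E u x" "I \<subseteq> N u" using insert.prems(1) by auto
    have f: "flip (insert x I) x = I" using insert.hyps by (auto simp: flip_def)
    have "E (base K) (base I)" using base_nbr(1)[OF insert.prems(1) x(1)] insert.prems(3) f by simp
    then obtain y where y: "E u y" "base (flip K y) = base I" using base_nbr(3)[OF insert.prems(2)] by blast
    have "I \<noteq> flip K y"
    proof
      assume e: "I = flip K y"
      have "flip I x = insert x I" "flip I y = K" using insert.hyps e by (auto simp: flip_def)
      then have "x = y" using base_nbr(2)[OF x(2) x(1) y(1)] insert.prems(3) by simp
      then show False using \<open>flip I x = insert x I\<close> \<open>flip I y = K\<close> insert.prems(4) by simp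
    qed
    then show ?case using insert.IH[OF x(2) flip_subset[OF insert.prems(2) y(1)]] y(2) by simp
  next
    case empty
    show ?case by (rule exI[of _ K]) (use empty.prems in auto)
  qed
  then have full: "base (N u) = u" using fibre by blast
  have bc: "base (N u - I) = base K" using base_complement[OF full I] eq by simp
  let ?S = "(I - K) \<union> (K - I)"
  have "(I - ?S) \<union> (?S - I) = K" by blast
  then have c5: "card ?S \<ge> 5" using base_far[OF I, of ?S] I K eq ne by force
  let ?S' = "N u - ?S"
  have "((N u - I) - ?S') \<union> (?S' - (N u - I)) = K" using I K by blast
  moreover have "card ?S' = 7 - card ?S"
    using card_Diff_subset[of ?S "N u"] finI[of ?S] I K card_N7[OF uV] by auto
  then have "card ?S' \<le> 4" using c5 by simp
  ultimately have "?S' = {}" using base_far[of "N u - I" ?S'] bc by auto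
  then have "K = N u - I" using I K by blast
  then show ?thesis using full by blast
qed

text \<open>A transposition of two coordinates of the cube commutes with taking complements, so it
  is compatible with the only identification \<open>base\<close> can make and descends to the graph.
  This contradicts the existence of a non-reversible 2-arc.\<close>

lemma swap_automorphism:
  assumes xy: "E u x" "E u y" "x \<noteq> y" shows "orb u x y u y x"
proof -
  define s where "s = (\<lambda>t. if t = x then y else if t = y then x else t)"
  have ss: "s (s t) = t" for t unfolding s_def by auto
  have inj: "s a = s b \<longleftrightarrow> a = b" for a b using ss by metis
  have sN: "s ` I \<subseteq> N u" if "I \<subseteq> N u" for I using that xy by (auto simp: s_def)
  have sss: "s ` s ` I = I" for I by (simp add: image_image ss)
  have sflip: "s ` flip I t = flip (s ` I) (s t)" for I t
    unfolding flip_def using inj by auto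
  have wd: "base (s ` I) = base (s ` K)" if IK: "I \<subseteq> N u" "K \<subseteq> N u" "base I = base K" for I K
  proof (cases "I = K")
    case False
    then have f: "base (N u) = u" "K = N u - I" using base_eq[OF IK] by blast+
    have "s ` N u = N u" using sN[of "N u"] sN[of "s ` N u"] sss[of "N u"] image_mono[OF sN[of "N u"], of s] by auto
    then have "s ` K = N u - s ` I" unfolding f(2)
      using image_set_diff[of s "N u" I] inj by (simp add: inj_on_def)
    then show ?thesis using base_complement[OF f(1) sN[OF IK(1)]] by simp
  qed simp
  define f where "f = (\<lambda>p. if p \<in> V then base (s ` (SOME I. I \<subseteq> N u \<and> base I = p)) else p)"
  have bV: "base I \<in> V" if "I \<subseteq> N u" for I
    using frame_lift[OF finI[OF that] frame0] by (simp add: frame_def base_def)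
  have f: "f (base I) = base (s ` I)" if I: "I \<subseteq> N u" for I
  proof -
    have "(SOME J. J \<subseteq> N u \<and> base J = base I) \<subseteq> N u \<and> base (SOME J. J \<subseteq> N u \<and> base J = base I) = base I"
      by (rule someI[of _ I]) (use I in simp)
    then have "base (s ` (SOME J. J \<subseteq> N u \<and> base J = base I)) = base (s ` I)" using wd I by blast
    then show ?thesis using bV[OF I] by (simp add: f_def)
  qed
  have "f \<in> G"
  proof (rule G_I)
    have "f (f p) = p" for p
    proof (cases "p \<in> V")
      case True
      then obtain I where I: "I \<subseteq> N u" "base I = p" using base_surj by blast
      then show ?thesis using f[OF I(1)] f[OF sN[OF I(1)]] sss by simp
    qed (simp add: f_def)
    then show "bij f" by (intro o_bij[of f f]) auto
    show "f p = p" if "p \<notin> V" for p using that by (simp add: f_def)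
    fix p q assume e: "E p q"
    obtain I where I: "I \<subseteq> N u" "base I = p" using base_surj E_V[OF e] by blast
    then obtain t where t: "E u t" "base (flip I t) = q" using base_nbr(3) e by blast
    have "E u (s t)" using sN[of "{t}"] t(1) by simp
    then have "E (base (s ` I)) (base (flip (s ` I) (s t)))" using base_nbr(1)[OF sN[OF I(1)]] by blast
    then show "E (f p) (f q)" using f[OF I(1)] f[OF flip_subset[OF I(1) t(1)]] I(2) t(2) sflip by simp
  qed
  moreover have "f u = u" "f x = y" "f y = x"
    using f[of "{}"] f[of "{x}"] f[of "{y}"] xy base_single by (simp_all add: s_def)
  ultimately show ?thesis unfolding orb_def by blast
qed

end

lemma (in tfree_graph) not_cube_closing:
  assumes "\<And>v a b c. E v a \<Longrightarrow> E v b \<Longrightarrow> E v c \<Longrightarrow> a \<noteq> b \<Longrightarrow> a \<noteq> c \<Longrightarrow> b \<noteq> c \<Longrightarrow>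
    opp a (opp v a b) (opp v a c) = opp b (opp v a b) (opp v b c)"
  shows False
proof -
  obtain v x y where vxy: "E v x" "E v y" "x \<noteq> y" "\<not> orb v x y v y x" by (rule two_arc_orbit)
  interpret cube_closing V E k v
    by unfold_locales (use assms E_V vxy in blast)+
  show False using swap_automorphism vxy by blast
qed

section \<open>The tournament case\<close>

lemma double_mod_7: "(2 * i) mod 7 = (2 * j) mod 7 \<longleftrightarrow> i mod 7 = j mod 7" for i j :: nat
proof
  assume "(2 * i) mod 7 = (2 * j) mod 7"
  then have "(4 * (2 * i)) mod 7 = (4 * (2 * j)) mod 7" by (rule mod_mult_cong[OF refl])
  moreover have "4 * (2 * i) = i + 7 * i" "4 * (2 * j) = j + 7 * j" by simp_all
  ultimately show "i mod 7 = j mod 7" by (simp only: mod_mult_self2)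
qed (rule mod_mult_cong[OF refl])

locale tournament = tfree_graph +
  fixes p0 x0 y0 :: 'a
  assumes arc0: "E p0 x0" "E p0 y0" "x0 \<noteq> y0" and nrev0: "\<not> orb p0 x0 y0 p0 y0 x0"
begin

definition T :: "'a \<Rightarrow> 'a \<Rightarrow> 'a \<Rightarrow> bool" where "T = orb p0 x0 y0"

lemma T_inv3: "inv3 T"
  unfolding T_def by (rule orb_inv3[OF arc0(1,2)])

lemma T_G: "g \<in> G \<Longrightarrow> T (g v) (g x) (g y) \<longleftrightarrow> T v x y"
  by (rule inv3_iff[OF T_inv3])

lemma T_E: assumes "T v x y" shows "E v x" "E v y" "x \<noteq> y"
  using inv3_E[OF T_inv3 assms] orb_neq[OF _ arc0(3)] assms unfolding T_def by blast+

lemma T_trans: assumes "T v x y" "T v' x' y'" shows "\<exists>g\<in>G. g v = v' \<and> g x = x' \<and> g y = y'"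
  using orb_trans[OF orb_sym] assms unfolding T_def orb_def[symmetric] by blast

lemma T_asym: assumes "T v x y" shows "\<not> T v y x"
proof
  assume "T v y x"
  then have "orb v x y v y x" using assms orb_trans[OF orb_sym] unfolding T_def by blast
  then show False using rev_orb nrev0 assms unfolding T_def by blast
qed

text \<open>A non-self-paired suborbit of length 3 and its reverse, again of length 3, exhaust the
  six other neighbours.\<close>

lemma T_total: assumes "E v x" "E v y" "x \<noteq> y" shows "T v x y \<or> T v y x"
proof -
  obtain t where t: "E p0 t" "t \<noteq> x0" "orb p0 x0 t p0 y0 x0"
    using transport[OF arc0(1,2,1)] arc0(3) by metis
  have ty: "t \<notin> sub p0 x0 y0" using in_sub_orb[OF _ t(3)] nrev0 by blast
  have cov: "sub p0 x0 y0 \<union> sub p0 x0 t = N p0 - {x0}"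
    using sub_sum(2)[OF arc0(1,2) t(1) arc0(3)[symmetric] t(2) ty]
      all_sub3[OF arc0(1,2) arc0(3)[symmetric]] all_sub3[OF arc0(1) t(1,2)] k7 by simp
  obtain w where w: "E p0 w" "w \<noteq> x0" "orb p0 x0 w v x y"
    using orb_transport[OF arc0(1) assms(1,2)] assms(3) by metis
  have "w \<in> sub p0 x0 y0 \<union> sub p0 x0 t" unfolding cov using w by simp
  then show ?thesis
  proof
    assume "w \<in> sub p0 x0 y0"
    then show ?thesis using in_sub_orb[OF _ w(3)] unfolding T_def by blast
  next
    assume "w \<in> sub p0 x0 t"
    then have "orb p0 x0 t v x y" using in_sub_orb[OF _ w(3)] by blast
    then have "orb p0 y0 x0 v x y" using orb_trans[OF orb_sym[OF t(3)]] by blast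
    then show ?thesis using orb_swap unfolding T_def by blast
  qed
qed

lemma T_not: "E v x \<Longrightarrow> E v y \<Longrightarrow> x \<noteq> y \<Longrightarrow> \<not> T v x y \<longleftrightarrow> T v y x"
  using T_total T_asym by blast

lemma T_out: assumes "E v x" shows "card {y. T v x y} = 3"
  using inv3_val[OF T_inv3 assms arc0(1)] all_sub3[OF arc0(1,2) arc0(3)[symmetric]]
  unfolding T_def sub_def by simp

text \<open>The automorphisms fixing \<open>v\<close> and \<open>x\<close> are transitive on the
  three out-neighbours of \<open>x\<close>, so these have equal out-degrees among themselves. A
  tournament on three points with that property is a directed triangle.\<close>

lemma T_cycle: assumes "T v x y"
  obtains z w where "{t. T v x t} = {y, z, w}" "y \<noteq> z" "y \<noteq> w" "z \<noteq> w" "T v y z" "T v z w" "T v w y"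
proof -
  define f where "f = (\<lambda>y. card {t. T v x t \<and> T v y t})"
  have const: "f p = f q" if p: "T v x p" and q: "T v x q" for p q
  proof -
    obtain g where g: "g \<in> G" "g v = v" "g x = x" "g q = p" using T_trans[OF q p] by blast
    have "T v x (g t) \<longleftrightarrow> T v x t" "T v p (g t) \<longleftrightarrow> T v q t" for t
      using T_G[OF g(1), of v x t] T_G[OF g(1), of v q t] unfolding g(2-4) by simp_all
    then show ?thesis unfolding f_def by (intro card_Collect_G[OF g(1)]) blast
  qed
  have "E v x" using T_E assms by blast
  then obtain p q r where pqr: "{t. T v x t} = {p, q, r}" "p \<noteq> q" "q \<noteq> r" "p \<noteq> r"
    using T_out[of v x] by (auto simp: card_3_iff)
  have out: "T v x t \<longleftrightarrow> t = p \<or> t = q \<or> t = r" for t using pqr(1) by blast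
  have ee: "E v p" "E v q" "E v r" using T_E(2) out by blast+
  have irr: "\<not> T v t t" for t using T_E(3) by blast
  have S: "{t. T v x t \<and> T v s t} = (if T v s p then {p} else {}) \<union> (if T v s q then {q} else {}) \<union> (if T v s r then {r} else {})" for s
    using out by auto
  have f: "f s = of_bool (T v s p) + of_bool (T v s q) + of_bool (T v s r)" for s
    unfolding f_def S using pqr by auto
  have fc: "f p = f q" "f q = f r" using const out by blast+
  have cyc: "T v p q \<and> T v q r \<and> T v r p \<or> T v q p \<and> T v r q \<and> T v p r"
  proof -
    have n: "T v q p \<longleftrightarrow> \<not> T v p q" "T v r q \<longleftrightarrow> \<not> T v q r" "T v r p \<longleftrightarrow> \<not> T v p r"
      using T_not[OF ee(1,2)] T_not[OF ee(2,3)] T_not[OF ee(1,3)] pqr(2-4) by blast+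
    show ?thesis using fc unfolding f n by (cases "T v p q"; cases "T v q r"; cases "T v p r") (simp_all add: irr)
  qed
  have y: "y = p \<or> y = q \<or> y = r" using assms out by blast
  show ?thesis
  proof (cases "T v p q \<and> T v q r \<and> T v r p")
    case True
    then show ?thesis using y pqr that[of q r] that[of r p] that[of p q] by (elim disjE) (auto simp: insert_commute)
  next
    case False
    then have "T v q p \<and> T v r q \<and> T v p r" using cyc by blast
    then show ?thesis using y pqr that[of r q] that[of p r] that[of q p] by (elim disjE) (auto simp: insert_commute)
  qed
qed

lemma T_common1: assumes "T v x y" shows "\<exists>!t. T v x t \<and> T v y t"
proof -
  obtain z w where zw: "{t. T v x t} = {y, z, w}" "y \<noteq> z" "y \<noteq> w" "z \<noteq> w" "T v y z" "T v z w" "T v w y"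
    using T_cycle[OF assms] by blast
  have "T v x t \<longleftrightarrow> t = y \<or> t = z \<or> t = w" for t using zw(1) by blast
  then show ?thesis using zw T_asym[OF zw(7)] T_E(3) by metis
qed

text \<open>The tournament on a neighbourhood is the quadratic residue tournament on the integers mod 7.\<close>

definition qr_frame :: "'a \<Rightarrow> (nat \<Rightarrow> 'a) \<Rightarrow> bool" where
  "qr_frame v l \<longleftrightarrow> (\<forall>i j. l i = l j \<longleftrightarrow> i mod 7 = j mod 7) \<and> range l = N v \<and>
     (\<forall>i y. T v (l i) y \<longleftrightarrow> y = l (i + 1) \<or> y = l (i + 2) \<or> y = l (i + 4))"

lemma qr_frameD:
  assumes "qr_frame v l"
  shows "l i = l j \<longleftrightarrow> i mod 7 = j mod 7" "range l = N v"
    "T v (l i) y \<longleftrightarrow> y = l (i + 1) \<or> y = l (i + 2) \<or> y = l (i + 4)"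
    "E v (l i)" "v \<in> V"
proof -
  show 1: "l i = l j \<longleftrightarrow> i mod 7 = j mod 7" "range l = N v"
    "T v (l i) y \<longleftrightarrow> y = l (i + 1) \<or> y = l (i + 2) \<or> y = l (i + 4)"
    using assms unfolding qr_frame_def by blast+
  show "E v (l i)" using 1(2) by auto
  then show "v \<in> V" using E_V by blast
qed

lemma lt7_cases: "(i::nat) < 7 \<Longrightarrow> i = 0 \<or> i = 1 \<or> i = 2 \<or> i = 3 \<or> i = 4 \<or> i = 5 \<or> i = 6"
  by linarith

text \<open>The names follow the residues 1, 2, 4: the out-neighbours of \<open>a0\<close> form the
  triangle \<open>a1\<close>, \<open>a2\<close>, \<open>a4\<close>, those of \<open>a1\<close> form
  \<open>a2\<close>, \<open>a3\<close>, \<open>a5\<close>, and \<open>a6\<close> is what remains.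
  Out-degree 3 and the single common out-neighbour along an arc force all other
  orientations.\<close>

lemma qr_frame_ex: assumes v: "v \<in> V" shows "\<exists>l. qr_frame v l"
proof -
  obtain a0 where a0: "E v a0" using edge_ex v by blast
  obtain a1 where a1: "T v a0 a1" using T_out[OF a0] by (metis card.empty empty_Collect_eq zero_neq_numeral)
  obtain a2 a4 where a24: "{t. T v a0 t} = {a1, a2, a4}" "a1 \<noteq> a2" "a1 \<noteq> a4" "a2 \<noteq> a4" "T v a1 a2" "T v a2 a4" "T v a4 a1"
    by (rule T_cycle[OF a1])
  obtain a3 a5 where a35: "{t. T v a1 t} = {a2, a3, a5}" "a2 \<noteq> a3" "a2 \<noteq> a5" "a3 \<noteq> a5" "T v a2 a3" "T v a3 a5" "T v a5 a2"
    by (rule T_cycle[OF a24(5)])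
  have o0: "T v a0 t \<longleftrightarrow> t = a1 \<or> t = a2 \<or> t = a4" for t using a24(1) by blast
  have o1: "T v a1 t \<longleftrightarrow> t = a2 \<or> t = a3 \<or> t = a5" for t using a35(1) by blast
  have e: "E v a1" "E v a2" "E v a3" "E v a4" "E v a5" using T_E a24 a35 a1 by blast+
  have d: "a0 \<noteq> a1" "a0 \<noteq> a2" "a0 \<noteq> a4" "a0 \<noteq> a3" "a0 \<noteq> a5" "a1 \<noteq> a3" "a1 \<noteq> a5" "a4 \<noteq> a3" "a4 \<noteq> a5"
    using T_E(3) o0 o1 T_asym a24(7) a1 by metis+
  have "card (N v - {a0, a1, a2, a3, a4, a5}) = 1"
    using card_Diff_subset[of "{a0, a1, a2, a3, a4, a5}" "N v"] e a0 d a24 a35 card_N7[OF v] by simp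
  then obtain a6 where a6: "N v - {a0, a1, a2, a3, a4, a5} = {a6}" using card_1_singletonE by blast
  have e6: "E v a6" "a6 \<noteq> a0" "a6 \<noteq> a1" "a6 \<noteq> a2" "a6 \<noteq> a3" "a6 \<noteq> a4" "a6 \<noteq> a5"
  proof -
    have "a6 \<in> N v - {a0, a1, a2, a3, a4, a5}" using a6 by blast
    then show "E v a6" "a6 \<noteq> a0" "a6 \<noteq> a1" "a6 \<noteq> a2" "a6 \<noteq> a3" "a6 \<noteq> a4" "a6 \<noteq> a5" by auto
  qed
  have Nv: "N v = {a0, a1, a2, a3, a4, a5, a6}"
  proof
    show "N v \<subseteq> {a0, a1, a2, a3, a4, a5, a6}" using a6 by blast
    show "{a0, a1, a2, a3, a4, a5, a6} \<subseteq> N v" using a0 e e6 by simp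
  qed
  have inN: "t = a0 \<or> t = a1 \<or> t = a2 \<or> t = a3 \<or> t = a4 \<or> t = a5 \<or> t = a6" if "E v t" for t
  proof -
    have "t \<in> N v" using that by simp
    then show ?thesis unfolding Nv by simp
  qed
  have three: "T v x t \<longleftrightarrow> t = p \<or> t = q \<or> t = r" if "T v x p" "T v x q" "T v x r" "p \<noteq> q" "q \<noteq> r" "p \<noteq> r" for x p q r t
  proof -
    have "{p, q, r} = {t. T v x t}"
      using that T_out[OF T_E(1)[OF that(1)]] inv3_fin(1)[OF T_inv3]
      by (intro card_subset_eq) auto
    then show ?thesis by blast
  qed
  have ex3: "T v x p \<or> T v x q \<or> T v x r" if x: "E v x" and sub: "\<And>t. T v x t \<Longrightarrow> t = p \<or> t = q \<or> t = r \<or> t = y \<or> t = z" for x p q r y z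
  proof (rule ccontr)
    assume "\<not> ?thesis"
    then have "{t. T v x t} \<subseteq> {y, z}" using sub by blast
    then have "card {t. T v x t} \<le> card {y, z}" by (intro card_mono) auto
    then show False using T_out[OF x] by (simp add: card_insert_if split: if_splits)
  qed
  note neq = d a24(2-4) a35(2-4) e6(2-7)
  note neqs = neq neq[symmetric]
  have n: "T v x y" if "\<not> T v y x" "E v x" "E v y" "x \<noteq> y" for x y using T_total that by blast
  have n2: "\<not> T v a2 a0" "\<not> T v a2 a1" "\<not> T v a2 a5" "\<not> T v a2 a2"
    using T_asym o0 a24 a35 T_E(3) by blast+
  have "T v a2 a6"
    using ex3[of a2 a6 a6 a6 a3 a4] e(2) inN T_E(2) n2 by metis
  then have o2: "T v a2 t \<longleftrightarrow> t = a3 \<or> t = a4 \<or> t = a6" for t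
    using three[OF a35(5) a24(6)] neqs by metis
  have n4: "\<not> T v a4 a0" "\<not> T v a4 a2" "\<not> T v a4 a4" using T_asym o0 a24 T_E(3) by blast+
  obtain c where c: "T v a4 c" "T v a1 c" "\<And>t. T v a4 t \<Longrightarrow> T v a1 t \<Longrightarrow> t = c"
    using T_common1[OF a24(7)] by metis
  have c35: "c = a3 \<or> c = a5" using c(1,2) n4(2) o1[of c] by auto
  have n35: "\<not> (T v a4 a3 \<and> T v a4 a5)" using c(3)[of a3] c(3)[of a5] o1 a35(4) by metis
  have 46: "T v a4 a6"
  proof (rule ccontr)
    assume "\<not> T v a4 a6"
    then have "{t. T v a4 t} \<subseteq> {a1, c}" using inN[OF T_E(2)] n4 n35 c35 c(1) by blast
    then have "card {t. T v a4 t} \<le> card {a1, c}" by (intro card_mono) auto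
    then show False using T_out[OF e(4)] by (simp add: card_insert_if split: if_splits)
  qed
  have "\<not> T v a4 a3" using T_common1[OF a24(6)] 46 o2 neqs by metis
  then have "T v a4 a5" using c c35 by metis
  then have o4: "T v a4 t \<longleftrightarrow> t = a5 \<or> t = a6 \<or> t = a1" for t
    using three[OF _ 46 a24(7), of a5] neqs by metis
  have o3: "T v a3 t \<longleftrightarrow> t = a4 \<or> t = a5 \<or> t = a0" for t
  proof (rule three)
    show "T v a3 a4" by (rule n) (use o4 neqs e in metis)+
    show "T v a3 a0" by (rule n) (use o0 neqs e a0 in metis)+
  qed (use a35 neqs in blast)+
  have o5: "T v a5 t \<longleftrightarrow> t = a6 \<or> t = a0 \<or> t = a2" for t
  proof (rule three)
    show 50: "T v a5 a0" by (rule n) (use o0 neqs e a0 in metis)+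
    have "\<not> T v a5 a1" "\<not> T v a5 a3" "\<not> T v a5 a4" "\<not> T v a5 a5" using T_asym o1 o3 o4 T_E(3) by blast+
    then show "T v a5 a6" using ex3[of a5 a6 a6 a6 a0 a2] e(5) inN T_E(2) by metis
  qed (use a35 neqs in blast)+
  have o6: "T v a6 t \<longleftrightarrow> t = a0 \<or> t = a1 \<or> t = a3" for t
  proof (rule three)
    show "T v a6 a0" by (rule n) (use o0 neqs e6 a0 in metis)+
    show "T v a6 a1" by (rule n) (use o1 neqs e6 e in metis)+
    show "T v a6 a3" by (rule n) (use o3 neqs e6 e in metis)+
  qed (use neqs in blast)+
  define L where "L = (\<lambda>i::nat. if i = 0 then a0 else if i = 1 then a1 else if i = 2 then a2 else if i = 3 then a3
    else if i = 4 then a4 else if i = 5 then a5 else a6)"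
  have L: "L 0 = a0" "L 1 = a1" "L 2 = a2" "L 3 = a3" "L 4 = a4" "L 5 = a5" "L 6 = a6" by (simp_all add: L_def)
  have Linj: "L i = L j \<longleftrightarrow> i = j" if "i < 7" "j < 7" for i j
    using lt7_cases[OF that(1)] lt7_cases[OF that(2)] by (elim disjE) (simp_all add: L neqs del: One_nat_def)
  define l where "l = (\<lambda>i. L (i mod 7))"
  have "l i = l j \<longleftrightarrow> i mod 7 = j mod 7" for i j unfolding l_def by (rule Linj) simp_all
  moreover have "range l = N v"
  proof -
    have "range l = L ` {0, 1, 2, 3, 4, 5, 6}"
    proof
      show "range l \<subseteq> L ` {0, 1, 2, 3, 4, 5, 6}"
      proof
        fix y assume "y \<in> range l"
        then obtain i where "y = L (i mod 7)" unfolding l_def by blast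
        then show "y \<in> L ` {0, 1, 2, 3, 4, 5, 6}" using lt7_cases[of "i mod 7"] by auto
      qed
      have "L i = l i" if "i < 7" for i using that by (simp add: l_def)
      then show "L ` {0, 1, 2, 3, 4, 5, 6} \<subseteq> range l" by auto
    qed
    also have "\<dots> = N v" unfolding Nv by (simp add: L del: One_nat_def)
    finally show ?thesis .
  qed
  moreover have "T v (l i) y \<longleftrightarrow> y = l (i + 1) \<or> y = l (i + 2) \<or> y = l (i + 4)" for i y
  proof -
    have m: "(i + c) mod 7 = (i mod 7 + c) mod 7" for c by (simp add: mod_simps)
    have "T v (L r) y \<longleftrightarrow> y = L ((r + 1) mod 7) \<or> y = L ((r + 2) mod 7) \<or> y = L ((r + 4) mod 7)" if r: "r < 7" for r
      using lt7_cases[OF r] by (elim disjE) (auto simp: L L(2)[unfolded One_nat_def] L(3)[unfolded numeral_2_eq_2] o0 o1 o2 o3 o4 o5 o6 simp del: One_nat_def)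
    then show ?thesis unfolding l_def m by simp
  qed
  ultimately show ?thesis unfolding qr_frame_def by blast
qed

section \<open>Rigidity, affine changes and transport of frames\<close>

lemma qr_frame_rigid:
  assumes l: "qr_frame v l" and m: "qr_frame v m" and 0: "l 0 = m 0" and 1: "l 1 = m 1"
  shows "l i = m i"
proof -
  have T: "T v (f i) (f j) \<longleftrightarrow> j mod 7 = (i + 1) mod 7 \<or> j mod 7 = (i + 2) mod 7 \<or> j mod 7 = (i + 4) mod 7"
    if "qr_frame v f" for f i j using qr_frameD(3)[OF that, of i "f j"] qr_frameD(1)[OF that] by simp
  have E: "\<exists>j<7. x = f j" if f: "qr_frame v f" and x: "E v x" for f x
  proof -
    obtain i where "x = f i" using qr_frameD(2)[OF f] x by (metis in_N rangeE)
    then have "x = f (i mod 7)" using qr_frameD(1)[OF f] by simp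
    then show ?thesis by (intro exI[of _ "i mod 7"]) simp
  qed
  have eqI: "x = f i" if f: "qr_frame v f" and x: "E v x" and i: "\<And>j. j < 7 \<Longrightarrow> x = f j \<Longrightarrow> j = i" for f x i
    using E[OF f x] i by blast
  have lT: "E v (l i)" for i using qr_frameD(4)[OF l] .
  have 2: "l 2 = m 2"
  proof (rule eqI[OF m lT])
    fix j :: nat assume j: "j < 7" "l 2 = m j"
    have "T v (l 0) (l 2)" "T v (l 1) (l 2)" by (simp_all add: T[OF l])
    then have "T v (m 0) (m j)" "T v (m 1) (m j)" using 0 1 j by simp_all
    then show "j = 2" using lt7_cases[OF j(1)] by (elim disjE) (simp_all add: T[OF m])
  qed
  have 4: "l 4 = m 4"
  proof (rule eqI[OF m lT])
    fix j :: nat assume j: "j < 7" "l 4 = m j"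
    have "T v (l 0) (l 4)" "l 4 \<noteq> l 1" "l 4 \<noteq> l 2" by (simp_all add: T[OF l] qr_frameD(1)[OF l])
    then have "T v (m 0) (m j)" "m j \<noteq> m 1" "m j \<noteq> m 2" using 0 1 2 j by simp_all
    then show "j = 4" using lt7_cases[OF j(1)] by (elim disjE) (simp_all add: T[OF m] qr_frameD(1)[OF m])
  qed
  have 3: "l 3 = m 3"
  proof (rule eqI[OF m lT])
    fix j :: nat assume j: "j < 7" "l 3 = m j"
    have "T v (l 1) (l 3)" "T v (l 2) (l 3)" by (simp_all add: T[OF l])
    then have "T v (m 1) (m j)" "T v (m 2) (m j)" using 1 2 j by simp_all
    then show "j = 3" using lt7_cases[OF j(1)] by (elim disjE) (simp_all add: T[OF m])
  qed
  have 5: "l 5 = m 5"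
  proof (rule eqI[OF m lT])
    fix j :: nat assume j: "j < 7" "l 5 = m j"
    have "T v (l 1) (l 5)" "l 5 \<noteq> l 2" "l 5 \<noteq> l 3" by (simp_all add: T[OF l] qr_frameD(1)[OF l])
    then have "T v (m 1) (m j)" "m j \<noteq> m 2" "m j \<noteq> m 3" using 1 2 3 j by simp_all
    then show "j = 5" using lt7_cases[OF j(1)] by (elim disjE) (simp_all add: T[OF m] qr_frameD(1)[OF m])
  qed
  have 6: "l 6 = m 6"
  proof (rule eqI[OF m lT])
    fix j :: nat assume j: "j < 7" "l 6 = m j"
    have "T v (l 2) (l 6)" "l 6 \<noteq> l 3" "l 6 \<noteq> l 4" by (simp_all add: T[OF l] qr_frameD(1)[OF l])
    then have "T v (m 2) (m j)" "m j \<noteq> m 3" "m j \<noteq> m 4" using 2 3 4 j by simp_all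
    then show "j = 6" using lt7_cases[OF j(1)] by (elim disjE) (simp_all add: T[OF m] qr_frameD(1)[OF m])
  qed
  have "i mod 7 < 7" by simp
  from lt7_cases[OF this] have "l (i mod 7) = m (i mod 7)" using 0 1 2 3 4 5 6 by (elim disjE) (simp_all only:)
  then show ?thesis using qr_frameD(1)[OF l, of i "i mod 7"] qr_frameD(1)[OF m, of i "i mod 7"] by simp
qed

lemma qr_frame_G: assumes "qr_frame v l" "g \<in> G" shows "qr_frame (g v) (\<lambda>i. g (l i))"
proof -
  note f = qr_frameD[OF assms(1)]
  have "y \<in> range (\<lambda>i. g (l i)) \<longleftrightarrow> y \<in> N (g v)" for y
  proof -
    have "y \<in> N (g v) \<longleftrightarrow> inv g y \<in> N v" using G_E[OF assms(2), of v "inv g y"] assms(2) by simp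
    also have "\<dots> \<longleftrightarrow> y \<in> range (\<lambda>i. g (l i))" unfolding f(2)[symmetric]
      using assms(2) by (auto simp: image_iff) (metis G_inv_apply(1))
    finally show ?thesis by blast
  qed
  then have "range (\<lambda>i. g (l i)) = N (g v)" by blast
  moreover have "T (g v) (g (l i)) y \<longleftrightarrow> y = g (l (i + 1)) \<or> y = g (l (i + 2)) \<or> y = g (l (i + 4))" for i y
  proof -
    have "T (g v) (g (l i)) y \<longleftrightarrow> T v (l i) (inv g y)" using T_G[OF assms(2), of v "l i" "inv g y"] assms(2) by simp
    moreover have "inv g y = t \<longleftrightarrow> y = g t" for t using G_inv_apply[OF assms(2)] by metis
    ultimately show ?thesis by (simp only: f(3))
  qed
  ultimately show ?thesis unfolding qr_frame_def using f(1) assms(2) by simp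
qed

lemma qr_frame_shift: assumes "qr_frame v l" shows "qr_frame v (\<lambda>i. l (i + c))"
proof -
  note f = qr_frameD[OF assms]
  have "l j \<in> range (\<lambda>i. l (i + c))" for j
  proof -
    have "(j + 6 * c + c) mod 7 = (j + 7 * c) mod 7" by (simp add: algebra_simps)
    then have "l j = l (j + 6 * c + c)" unfolding f(1) by simp
    then show ?thesis by blast
  qed
  then have "range (\<lambda>i. l (i + c)) = N v" unfolding f(2)[symmetric] by blast
  moreover have "l (i + c) = l (j + c) \<longleftrightarrow> i mod 7 = j mod 7" for i j
    using add_mod_cancel[of c i 7 j] unfolding f(1) by (simp add: add.commute)
  moreover have "T v (l (i + c)) y \<longleftrightarrow> y = l (i + 1 + c) \<or> y = l (i + 2 + c) \<or> y = l (i + 4 + c)" for i y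
    unfolding f(3) by (simp add: algebra_simps)
  ultimately show ?thesis unfolding qr_frame_def by blast
qed

lemma qr_frame_double: assumes "qr_frame v l" shows "qr_frame v (\<lambda>i. l (2 * i))"
proof -
  note f = qr_frameD[OF assms]
  have "l j \<in> range (\<lambda>i. l (2 * i))" for j
  proof -
    have "2 * (4 * j) = j + 7 * j" by simp
    then have "l j = l (2 * (4 * j))" unfolding f(1) by (simp only: mod_mult_self2)
    then show ?thesis by blast
  qed
  then have "range (\<lambda>i. l (2 * i)) = N v" unfolding f(2)[symmetric] by blast
  moreover have "l (2 * i) = l (2 * j) \<longleftrightarrow> i mod 7 = j mod 7" for i j unfolding f(1) by (rule double_mod_7)
  moreover have "T v (l (2 * i)) y \<longleftrightarrow> y = l (2 * (i + 1)) \<or> y = l (2 * (i + 2)) \<or> y = l (2 * (i + 4))" for i y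
  proof -
    have "2 * (i + 4) = (2 * i + 1) + 7" by simp
    then have "l (2 * (i + 4)) = l (2 * i + 1)" unfolding f(1) by (simp only: mod_add_self2)
    moreover have "2 * (i + 1) = 2 * i + 2" "2 * (i + 2) = 2 * i + 4" by simp_all
    ultimately show ?thesis unfolding f(3) by metis
  qed
  ultimately show ?thesis unfolding qr_frame_def by blast
qed

text \<open>The multipliers 1, 2, 4 are the nonzero squares mod 7, so they preserve the set {1, 2,
  4} of differences that defines the tournament.\<close>

lemma qr_frame_affine:
  assumes "qr_frame v l" "s = 1 \<or> s = 2 \<or> s = 4" shows "qr_frame v (\<lambda>i. l (s * i + r))"
proof -
  have "qr_frame v (\<lambda>i. l (i + r))" using qr_frame_shift assms by blast
  note d = this qr_frame_double[OF this] qr_frame_double[OF qr_frame_double[OF this]]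
  show ?thesis using assms(2) d by (elim disjE) simp_all
qed

lemma qr_frame_transport: assumes "qr_frame v l" "qr_frame w m"
  shows "\<exists>g\<in>G. g v = w \<and> (\<forall>i. g (l i) = m i)"
proof -
  have "T v (l 0) (l 1)" "T w (m 0) (m 1)" using qr_frameD(3)[OF assms(1)] qr_frameD(3)[OF assms(2)] by simp_all
  then obtain g where g: "g \<in> G" "g v = w" "g (l 0) = m 0" "g (l 1) = m 1" using T_trans by blast
  have "g (l i) = m i" for i
    using qr_frame_rigid[OF qr_frame_G[OF assms(1) g(1), unfolded g(2)] assms(2)] g by blast
  then show ?thesis using g by blast
qed

text \<open>Three corners of a quadrangle determine the fourth. Once a vertex \<open>y\<close> and
  its neighbours are fixed, each further neighbour of a neighbour \<open>z\<close> completes a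
  quadrangle on \<open>y\<close> and \<open>z\<close>, so it is fixed as well, and connectedness
  does the rest.\<close>

lemma G_faithful:
  assumes g: "g \<in> G" and v: "v \<in> V" "g v = v" and N: "\<And>x. E v x \<Longrightarrow> g x = x"
  shows "g y = y"
proof (cases "y \<in> V")
  case True
  have "g y = y \<and> (\<forall>x. E y x \<longrightarrow> g x = x)"
  proof (rule conn_induct[OF v(1) _ _ True])
    show "g v = v \<and> (\<forall>x. E v x \<longrightarrow> g x = x)" using v N by blast
    fix y z assume y: "g y = y \<and> (\<forall>x. E y x \<longrightarrow> g x = x)" and yz: "E y z"
    have zy: "E z y" using yz by (rule E_sym)
    have gz: "g z = z" using y yz by blast
    have "g w = w" if w: "E z w" for w
    proof (cases "w = y")
      case False
      note o = opp[OF zy w False[symmetric]]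
      have ow: "opp y z (opp z y w) = w" using opp_opp[OF zy w False[symmetric]] .
      have "z \<noteq> opp z y w" using o(3) by simp
      then have "g (opp y z (opp z y w)) = opp (g y) (g z) (g (opp z y w))"
        using opp_G[OF g yz o(1)] by blast
      moreover have "g (opp z y w) = opp z y w" using y o(1) by blast
      ultimately show ?thesis using ow gz y by simp
    qed (use y in simp)
    then show "g z = z \<and> (\<forall>x. E z x \<longrightarrow> g x = x)" using gz by blast
  qed
  then show ?thesis by blast
qed (use g G_out in blast)

lemma G_eqI:
  assumes "g \<in> G" "f \<in> G" "qr_frame v l" "g v = f v" "\<And>i. g (l i) = f (l i)" shows "g y = f y"
proof -
  have "(inv f \<circ> g) y = y"
  proof (rule G_faithful[OF G_comp[OF G_inv[OF assms(2)] assms(1)] qr_frameD(5)[OF assms(3)]])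
    fix x assume "E v x"
    then obtain i where "x = l i" using qr_frameD(2)[OF assms(3)] by (metis in_N rangeE)
    then show "(inv f \<circ> g) x = x" using assms(2,5) by simp
  qed (use assms(2,4) in simp)
  then show ?thesis using assms(2) by (metis G_inv_apply(1) comp_apply)
qed

text \<open>An element of the stabilizer maps the arc from \<open>l 0\<close> to \<open>l 1\<close>
  to another arc of the tournament, which gives \<open>r\<close> and \<open>s\<close>; by rigidity
  this arc determines the images of all labels. The stabilizer is thus the Frobenius group of order
  21.\<close>

lemma stabilizer_affine:
  assumes "d \<in> G" "d v = v" "qr_frame v l"
  shows "\<exists>s r. (s = 1 \<or> s = 2 \<or> s = 4) \<and> (\<forall>m. d (l m) = l (s * m + r))"
proof -
  have fr: "qr_frame v (\<lambda>i. d (l i))" using qr_frame_G[OF assms(3,1)] assms(2) by simp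
  obtain r where r: "d (l 0) = l r" using qr_frameD(2)[OF assms(3)] qr_frameD(4)[OF fr, of 0] by (metis in_N rangeE)
  have "T v (d (l 0)) (d (l 1))" using qr_frameD(3)[OF fr, of 0] by simp
  then have "d (l 1) = l (r + 1) \<or> d (l 1) = l (r + 2) \<or> d (l 1) = l (r + 4)"
    unfolding r qr_frameD(3)[OF assms(3)] .
  then have "\<exists>s. (s = 1 \<or> s = 2 \<or> s = 4) \<and> d (l 1) = l (s * 1 + r)"
  proof (elim disjE)
    show ?thesis if "d (l 1) = l (r + 1)" using that by (intro exI[of _ 1]) (simp add: add.commute)
    show ?thesis if "d (l 1) = l (r + 2)" using that by (intro exI[of _ 2]) (simp add: add.commute)
    show ?thesis if "d (l 1) = l (r + 4)" using that by (intro exI[of _ 4]) (simp add: add.commute)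
  qed
  then obtain s where s: "s = 1 \<or> s = 2 \<or> s = 4" "d (l 1) = l (s * 1 + r)" by blast
  have "d (l m) = l (s * m + r)" for m
    using qr_frame_rigid[OF fr qr_frame_affine[OF assms(3) s(1), of r]] r s(2) by simp
  then show ?thesis using s by blast
qed

end

text \<open>\<open>6\<close> plays the role of \<open>-1\<close> mod 7. The two ways around the quadrangle with labels 0 and \<open>j\<close> lead to frames
  that differ by an affine map, whose multiplier \<open>s\<close> is determined by the first congruence; \<open>hol g j m n\<close> says that this
  map matches label \<open>m\<close> on one way with label \<open>n\<close> on the other.\<close>

definition hol :: "(nat \<Rightarrow> nat) \<Rightarrow> nat \<Rightarrow> nat \<Rightarrow> nat \<Rightarrow> bool" where
  "hol g j m n \<longleftrightarrow> (\<forall>s\<in>{1, 2, 4}.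
     (s * g ((6 * g j) mod 7) + g ((6 * g ((6 * j) mod 7)) mod 7)) mod 7 = 0 \<longrightarrow>
     (s * g ((g m + 6 * g j) mod 7) + g ((6 * g ((6 * j) mod 7)) mod 7)) mod 7 =
       g ((g ((n + 6 * j) mod 7) + 6 * g ((6 * j) mod 7)) mod 7))"

text \<open>Only quadrangles with label difference 1 are tested, with all five labels
  \<open>m\<close> other than 0 and 1. The other differences follow by rotating, doubling and
  reversing.\<close>

definition cube_ok :: "(nat \<Rightarrow> nat) \<Rightarrow> bool" where
  "cube_ok g \<longleftrightarrow> (\<forall>m\<in>{2, 3, 4, 5, 6}. hol g 1 m m)"

definition reciprocal :: "(nat \<Rightarrow> nat) \<Rightarrow> bool" where
  "reciprocal g \<longleftrightarrow> (\<exists>c\<in>{1, 2, 3, 4, 5, 6}. \<forall>i\<in>{1, 2, 3, 4, 5, 6}. (g i * i) mod 7 = c)"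

text \<open>Doubling has the two orbits {1, 2, 4} and {3, 6, 5} on nonzero labels, so
  \<open>g 1\<close> and \<open>g 3\<close> determine \<open>g\<close>. The first four lists belong
  to \<open>s = 2\<close>, the other twelve to \<open>s = 4\<close>.\<close>

lemma gluing_values:
  fixes g :: "nat \<Rightarrow> nat"
  assumes lt: "\<And>i. g i < 7" and nz: "g 1 \<noteq> 0" "g 3 \<noteq> 0" and 0: "g 0 = 0" and gm: "\<And>i. g (i mod 7) = g i"
    and gg: "g (g 1) = 1" "g (g 3) = 3" and s: "s = 2 \<or> s = 4" and dbl: "\<And>i. g (2 * i) = (s * g i) mod 7"
  shows "map g [1, 2, 3, 4, 5, 6] \<in> {[1,2,3,4,5,6], [3,6,1,5,4,2], [5,3,2,6,1,4], [6,5,4,3,2,1], [1,4,3,2,6,5],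
    [1,4,5,2,3,6], [1,4,6,2,5,3], [2,1,3,4,6,5], [2,1,5,4,3,6], [2,1,6,4,5,3], [3,5,1,6,2,4], [4,2,3,1,6,5],
    [4,2,5,1,3,6], [4,2,6,1,5,3], [5,6,4,3,1,2], [6,3,2,5,4,1]}"
proof -
  have 1: "g 1 = 1 \<or> g 1 = 2 \<or> g 1 = 3 \<or> g 1 = 4 \<or> g 1 = 5 \<or> g 1 = 6" using lt[of 1] nz(1) by linarith
  have 3: "g 3 = 1 \<or> g 3 = 2 \<or> g 3 = 3 \<or> g 3 = 4 \<or> g 3 = 5 \<or> g 3 = 6" using lt[of 3] nz(2) by linarith
  have v: "g 2 = (s * g 1) mod 7" "g 4 = (s * ((s * g 1) mod 7)) mod 7" "g 6 = (s * g 3) mod 7"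
    "g 5 = (s * ((s * g 3) mod 7)) mod 7"
    using dbl[of 1] dbl[of 2] dbl[of 3] dbl[of 6] gm[of 12] by simp_all
  show ?thesis using s 1 3 gg v 0
    by (elim disjE) (simp_all del: One_nat_def)
qed

lemma gluing_classification:
  fixes g :: "nat \<Rightarrow> nat"
  assumes "g 0 = 0" and "map g [1, 2, 3, 4, 5, 6] \<in> {[1,2,3,4,5,6], [3,6,1,5,4,2], [5,3,2,6,1,4], [6,5,4,3,2,1], [1,4,3,2,6,5],
    [1,4,5,2,3,6], [1,4,6,2,5,3], [2,1,3,4,6,5], [2,1,5,4,3,6], [2,1,6,4,5,3], [3,5,1,6,2,4], [4,2,3,1,6,5],
    [4,2,5,1,3,6], [4,2,6,1,5,3], [5,6,4,3,1,2], [6,3,2,5,4,1]}"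
  shows "cube_ok g \<or> hol g 2 1 1 \<and> hol g 6 5 1 \<or> reciprocal g"
proof -
  consider
      "map g [1, 2, 3, 4, 5, 6] \<in> {[1,2,3,4,5,6], [6,5,4,3,2,1], [1,4,3,2,6,5], [1,4,6,2,5,3], [2,1,5,4,3,6], [2,1,6,4,5,3], [4,2,3,1,6,5], [4,2,5,1,3,6]}"
    | "map g [1, 2, 3, 4, 5, 6] \<in> {[3,6,1,5,4,2], [5,3,2,6,1,4]}"
    | "map g [1, 2, 3, 4, 5, 6] \<in> {[1,4,5,2,3,6], [2,1,3,4,6,5], [3,5,1,6,2,4], [4,2,6,1,5,3], [5,6,4,3,1,2], [6,3,2,5,4,1]}"
    using assms(2) by blast
  then show ?thesis
  proof cases
    case 1
    have "cube_ok g" using 1 assms(1)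
      by (elim insertE emptyE) (simp_all add: cube_ok_def hol_def)
    then show ?thesis by blast
  next
    case 2
    have "hol g 2 1 1 \<and> hol g 6 5 1" using 2 assms(1)
      by (elim insertE emptyE) (simp_all add: hol_def)
    then show ?thesis by blast
  next
    case 3
    have "reciprocal g" using 3 assms(1)
      by (elim insertE emptyE) (simp_all add: reciprocal_def)
    then show ?thesis by blast
  qed
qed

section \<open>An involution reversing an edge, and its gluing permutation\<close>

locale framed_tournament = tournament +
  fixes u :: 'a and l :: "nat \<Rightarrow> 'a" and h a :: "'a \<Rightarrow> 'a"
  assumes fr: "qr_frame u l" and hG: "h \<in> G" and h_u: "h u = l 0" and h_l0: "h (l 0) = u" and h_h: "h (h x) = x"
    and aG: "a \<in> G" and a_u: "a u = u" and a_l: "a (l i) = l (i + 1)"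
begin

lemmas l_eq = qr_frameD(1)[OF fr]
lemmas l_E = qr_frameD(4)[OF fr]

lemma l_mod: "l (i mod 7) = l i"
  by (simp add: l_eq)

lemma l_ex: "E u x \<Longrightarrow> \<exists>i<7. x = l i"
proof -
  assume "E u x"
  then obtain i where "x = l i" using qr_frameD(2)[OF fr] by (metis in_N rangeE)
  then show ?thesis using l_mod by (intro exI[of _ "i mod 7"]) simp
qed

definition w :: "nat \<Rightarrow> nat \<Rightarrow> 'a" where "w i j = opp u (l i) (l j)"

lemma l_neq: "i mod 7 \<noteq> j mod 7 \<Longrightarrow> l i \<noteq> l j"
  by (simp add: l_eq)

lemma w_commute: "i mod 7 \<noteq> j mod 7 \<Longrightarrow> w i j = w j i"
  unfolding w_def by (rule opp_commute[OF l_E l_E l_neq])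

lemma w_cong: "i mod 7 = i' mod 7 \<Longrightarrow> j mod 7 = j' mod 7 \<Longrightarrow> w i j = w i' j'"
  unfolding w_def using l_eq by metis

lemmas w_props = opp[OF l_E l_E l_neq, folded w_def]

lemma w_inj: "i mod 7 \<noteq> j mod 7 \<Longrightarrow> i mod 7 \<noteq> j' mod 7 \<Longrightarrow> w i j = w i j' \<Longrightarrow> j mod 7 = j' mod 7"
  using opp_inj[OF l_E l_E l_E l_neq l_neq, of i j j'] unfolding w_def l_eq by blast

text \<open>The gluing permutation: \<open>h (l i)\<close> is the neighbour other than \<open>u\<close> that \<open>l 0\<close> shares with \<open>l (g i)\<close>.\<close>

definition g :: "nat \<Rightarrow> nat" where
  "g i = (if i mod 7 = 0 then 0 else (THE j. j < 7 \<and> j \<noteq> 0 \<and> h (l i) = w 0 j))"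

lemma g_ex1: assumes "i mod 7 \<noteq> 0" shows "\<exists>!j. j < 7 \<and> j \<noteq> 0 \<and> h (l i) = w 0 j"
proof -
  have li: "l i \<noteq> l 0" using assms by (simp add: l_eq)
  have e: "E (l 0) (h (l i))" using G_E[OF hG, of u "l i"] l_E h_u by simp
  have ne: "h (l i) \<noteq> u" using h_l0 G_inj[OF hG, of "l i" "l 0"] li by simp
  have vu: "E (l 0) u" using E_sym[OF l_E] .
  define t where "t = opp (l 0) u (h (l i))"
  have t: "E u t" "t \<noteq> l 0" using opp[OF vu e ne[symmetric]] unfolding t_def by blast+
  have "opp u (l 0) t = h (l i)" unfolding t_def using opp_opp[OF vu e ne[symmetric]] .
  moreover obtain j where j: "j < 7" "t = l j" using l_ex[OF t(1)] by blast
  moreover have "j \<noteq> 0" using j t(2) by metis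
  ultimately have ex: "j < 7 \<and> j \<noteq> 0 \<and> h (l i) = w 0 j" unfolding w_def by simp
  show ?thesis
  proof (rule ex1I[of _ j])
    show "j < 7 \<and> j \<noteq> 0 \<and> h (l i) = w 0 j" by (rule ex)
    fix j' assume j': "j' < 7 \<and> j' \<noteq> 0 \<and> h (l i) = w 0 j'"
    then have "j mod 7 = j' mod 7" using ex by (intro w_inj[of 0]) auto
    then show "j' = j" using ex j' by simp
  qed
qed

lemma g0: "i mod 7 = 0 \<Longrightarrow> g i = 0"
  by (simp add: g_def)

lemma g: assumes "i mod 7 \<noteq> 0" shows "g i < 7" "g i \<noteq> 0" "h (l i) = w 0 (g i)"
  using theI'[OF g_ex1[OF assms]] assms by (simp_all add: g_def)

lemma g_lt: "g i < 7"
  using g(1) g0 by (cases "i mod 7 = 0") auto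

lemma g_eqI: assumes "i mod 7 \<noteq> 0" "j mod 7 \<noteq> 0" "h (l i) = w 0 j" shows "g i = j mod 7"
proof -
  have "w 0 (g i) = w 0 j" using g(3)[OF assms(1)] assms(3) by simp
  then have "g i mod 7 = j mod 7" using g[OF assms(1)] assms(2) by (intro w_inj[of 0]) auto
  then show ?thesis using g_lt by simp
qed

lemma g_mod: "g (i mod 7) = g i"
  by (simp add: g_def l_mod)

lemma g_cong: "i mod 7 = j mod 7 \<Longrightarrow> g i = g j"
  using g_mod by metis

lemma g_zero_iff: "g i mod 7 = 0 \<longleftrightarrow> i mod 7 = 0"
proof (cases "i mod 7 = 0")
  case False
  then show ?thesis using g[OF False] by (metis mod_less)
qed (simp add: g0)

text \<open>\<open>h\<close> carries the quadrangle with label \<open>g i\<close> on the edge from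
  \<open>u\<close> to \<open>l 0\<close> to the quadrangle with label \<open>i\<close> on the same
  edge; this uses that \<open>h\<close> is an involution.\<close>

lemma g_g: "g (g i) = i mod 7"
proof (cases "i mod 7 = 0")
  case False
  note gi = g[OF False]
  have d: "l 0 \<noteq> l (g i)" using gi by (simp add: l_eq)
  have 1: "h (w 0 (g i)) = opp (l 0) u (h (l (g i)))"
    unfolding w_def using opp_G[OF hG l_E l_E d] h_u h_l0 by simp
  have "h (w 0 (g i)) = l i" using gi(3) h_h by metis
  then have li: "l i = opp (l 0) u (h (l (g i)))" using 1 by simp
  have e: "E (l 0) (h (l (g i)))" using G_E[OF hG, of u "l (g i)"] l_E h_u by simp
  have ne: "u \<noteq> h (l (g i))" using h_l0 G_inj[OF hG, of "l (g i)" "l 0"] d by metis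
  have "h (l (g i)) = w 0 i" unfolding w_def li using opp_opp[OF E_sym[OF l_E] e ne] by simp
  then show ?thesis using g_eqI[of "g i" i] gi False by simp
qed (simp add: g0)

text \<open>The doubling map \<open>b\<close> fixes \<open>u\<close> and \<open>l 0\<close>, and so
  does its conjugate \<open>d\<close> by \<open>h\<close>, which therefore multiplies labels by some
  \<open>s\<close> in {1, 2, 4}. Injectivity of \<open>g\<close> rules out
  \<open>s = 1\<close>.\<close>

lemma g_double: "\<exists>s. (s = 2 \<or> s = 4) \<and> (\<forall>i. g (2 * i) = (s * g i) mod 7)"
proof -
  obtain b where b: "b \<in> G" "b u = u" "\<And>i. b (l i) = l (2 * i)"
    using qr_frame_transport[OF fr qr_frame_double[OF fr]] by blast
  define d where "d = h \<circ> b \<circ> h"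
  have dG: "d \<in> G" unfolding d_def using G_comp hG b(1) by blast
  have d_u: "d u = u" and d_0: "d (l 0) = l 0" unfolding d_def using h_u h_l0 b by (simp_all add: b(3)[of 0, simplified])
  obtain s r where sr: "s = 1 \<or> s = 2 \<or> s = 4" "\<And>m. d (l m) = l (s * m + r)"
    using stabilizer_affine[OF dG d_u fr] by blast
  have r: "r mod 7 = 0" using sr(2)[of 0] d_0 by (simp add: l_eq)
  have dl: "d (l m) = l (s * m)" for m
  proof -
    have "(s * m + r) mod 7 = (s * m + r mod 7) mod 7" by (rule mod_add_right_eq[symmetric])
    then have "(s * m + r) mod 7 = (s * m) mod 7" unfolding r by simp
    then show ?thesis unfolding sr(2) l_eq .
  qed
  have snz: "(s * q) mod 7 = 0 \<longleftrightarrow> q mod 7 = 0" for q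
    using sr(1) by (elim disjE) (simp_all, presburger+)
  have gd: "g (2 * i) = (s * g i) mod 7" for i
  proof (cases "i mod 7 = 0")
    case True
    then have "(2 * i) mod 7 = 0" by presburger
    then show ?thesis using g0 True by simp
  next
    case False
    have 2: "(2 * i) mod 7 \<noteq> 0" using False by presburger
    have "h (l (2 * i)) = d (h (l i))" unfolding d_def by (simp add: h_h b(3))
    also have "\<dots> = opp u (l 0) (l (s * g i))"
      unfolding g(3)[OF False] w_def using opp_G[OF dG l_E l_E l_neq, of 0 "g i"] g[OF False] d_u d_0 dl by simp
    finally have hw: "h (l (2 * i)) = w 0 (s * g i)" unfolding w_def .
    have nz: "(s * g i) mod 7 \<noteq> 0" using snz[of "g i"] g_zero_iff[of i] False by simp
    show ?thesis by (rule g_eqI[OF 2 nz hw])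
  qed
  have "s \<noteq> 1"
  proof
    assume "s = 1"
    then have "g 2 = g 1" using gd[of 1] g_lt[of 1] by simp
    then have "g (g 2) = g (g 1)" by simp
    then show False unfolding g_g by simp
  qed
  then show ?thesis using sr(1) gd by blast
qed

lemma g_classification: "cube_ok g \<or> hol g 2 1 1 \<and> hol g 6 5 1 \<or> reciprocal g"
proof -
  obtain s where s: "s = 2 \<or> s = 4" "\<And>i. g (2 * i) = (s * g i) mod 7" using g_double by blast
  have "g 1 \<noteq> 0" "g 3 \<noteq> 0" using g(2)[of 1] g(2)[of 3] by simp_all
  then show ?thesis
    using gluing_classification[OF _ gluing_values[of g s]] g_lt g0[of 0] g_mod g_g[of 1] g_g[of 3] s by simp
qed

section \<open>Transport of frames along edges and around quadrangles\<close>

definition A :: "nat \<Rightarrow> 'a \<Rightarrow> 'a" where "A i = (a ^^ i) \<circ> h"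

lemma apow: "a ^^ i \<in> G" "(a ^^ i) u = u" "(a ^^ i) (l j) = l (j + i)"
  by (induction i) (simp_all add: aG a_u a_l G_comp)

lemma A_G: "A i \<in> G"
  unfolding A_def using G_comp apow(1) hG by blast

text \<open>\<open>A i\<close> transports the frame at \<open>u\<close> along the edge labelled
  \<open>i\<close>; in the transported frame the label 0 is the way back.\<close>

lemma A_u: "A i u = l i" and A_l0: "A i (l 0) = u"
  unfolding A_def using apow(2,3)[of i] by (simp_all add: h_u h_l0)

lemma A_l: assumes "q mod 7 \<noteq> 0" shows "A i (l q) = w i (i + g q)"
proof -
  have "l 0 \<noteq> l (g q)" using g[OF assms] by (simp add: l_eq)
  then have "(a ^^ i) (w 0 (g q)) = opp u (l i) (l (g q + i))"
    unfolding w_def using opp_G[OF apow(1) l_E l_E] apow(2,3) by simp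
  then show ?thesis unfolding A_def using g(3)[OF assms] by (simp add: w_def add.commute)
qed

lemma l_add_diff: "l (i + (j + 6 * i) mod 7) = l j"
proof -
  have "(i + (j + 6 * i) mod 7) mod 7 = (j + 7 * i) mod 7" by (simp add: mod_simps)
  then show ?thesis unfolding l_eq by (simp only: mod_mult_self2)
qed

lemma diff_zero_iff: "(j + 6 * i) mod 7 = 0 \<longleftrightarrow> j mod 7 = i mod (7::nat)"
proof
  assume "(j + 6 * i) mod 7 = 0"
  then have "l i = l j" using l_add_diff[of i j] by simp
  then show "j mod 7 = i mod 7" by (simp add: l_eq)
next
  assume "j mod 7 = i mod 7"
  then have "(j + 6 * i) mod 7 = (i + 6 * i) mod 7" by (rule mod_add_cong) simp
  then show "(j + 6 * i) mod 7 = 0" by simp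
qed

text \<open>So \<open>g\<close> translates between labels at the two ends of an edge: after
  transport to \<open>l i\<close>, the label \<open>g (j - i)\<close> leads on to
  \<open>w i j\<close>.\<close>

lemma A_g: assumes "i mod 7 \<noteq> j mod 7" shows "A i (l (g (j + 6 * i))) = w i j"
proof -
  have "g (j + 6 * i) mod 7 \<noteq> 0" unfolding g_zero_iff diff_zero_iff using assms by simp
  then have "A i (l (g (j + 6 * i))) = opp u (l i) (l (i + (j + 6 * i) mod 7))"
    unfolding A_l[OF \<open>g (j + 6 * i) mod 7 \<noteq> 0\<close>] w_def g_g by simp
  then show ?thesis unfolding l_add_diff w_def .
qed

lemma A_opp: "E u x \<Longrightarrow> E u y \<Longrightarrow> x \<noteq> y \<Longrightarrow> A i (opp u x y) = opp (l i) (A i x) (A i y)"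
  using opp_G[OF A_G] A_u by metis

text \<open>Both composites carry \<open>u\<close> to the vertex opposite to \<open>u\<close> in the square through \<open>l i\<close> and \<open>l j\<close>.\<close>

lemma A_A:
  assumes ij: "i mod 7 \<noteq> j mod 7"
  defines "p \<equiv> g (j + 6 * i)" and "p' \<equiv> g (i + 6 * j)"
  shows "\<exists>s. (s = 1 \<or> s = 2 \<or> s = 4) \<and> (s * g (6 * p) + g (6 * p')) mod 7 = 0 \<and>
    (\<forall>m. A i (A p (l m)) = A j (A p' (l (s * m + g (6 * p'))))) \<and>
    (\<forall>d\<in>G. d u = u \<longrightarrow> (\<forall>m. d (l m) = l (s * m + g (6 * p'))) \<longrightarrow> (\<forall>y. A i (A p y) = A j (A p' (d y))))"
proof -
  have key: "A i (A (g (j + 6 * i)) (l 0)) = l i" "A i (A (g (j + 6 * i)) u) = w i j"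
    "A i (A (g (j + 6 * i)) (l (g (6 * g (j + 6 * i))))) = l j" if ij: "i mod 7 \<noteq> j mod 7" for i j
  proof -
    let ?p = "g (j + 6 * i)"
    show "A i (A ?p (l 0)) = l i" "A i (A ?p u) = w i j"
      using A_l0 A_u A_g[OF ij] by simp_all
    have p: "?p mod 7 \<noteq> 0" unfolding g_zero_iff diff_zero_iff using ij by simp
    have 0: "?p mod 7 \<noteq> 0 mod 7" using p by simp
    have "A ?p (l (g (6 * ?p))) = w ?p 0" using A_g[OF 0] by simp
    then have "A i (A ?p (l (g (6 * ?p)))) = opp (l i) (w i j) u"
      unfolding w_def[of ?p] using A_opp[OF l_E l_E l_neq[OF 0]] A_g[OF ij] A_l0 by simp
    also have "\<dots> = opp (l i) u (w i j)"
      using opp_commute[of "l i" "w i j" u] w_props(1,3)[OF ij] E_sym[OF l_E] by blast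
    also have "\<dots> = l j" unfolding w_def using opp_opp[OF l_E l_E l_neq[OF ij]] .
    finally show "A i (A ?p (l (g (6 * ?p)))) = l j" .
  qed
  define C where "C = A i \<circ> A p"
  define B where "B = A j \<circ> A p'"
  have CG: "C \<in> G" and BG: "B \<in> G" unfolding C_def B_def using G_comp A_G by blast+
  have C: "C (l 0) = l i" "C u = w i j" "C (l (g (6 * p))) = l j"
    using key[OF ij] unfolding C_def p_def by simp_all
  have B: "B (l 0) = l j" "B u = w j i" "B (l (g (6 * p'))) = l i"
    using key[OF ij[symmetric]] unfolding B_def p'_def by simp_all
  \<comment> \<open>The two transports agree at \<open>u\<close>, so \<open>d\<close> fixes
    \<open>u\<close> and is affine on labels. Its value at \<open>l 0\<close> gives the translation
    part, and the label it sends to \<open>l 0\<close> gives the congruence for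
    \<open>s\<close>.\<close>
  define d where "d = inv B \<circ> C"
  have dG: "d \<in> G" unfolding d_def using G_comp G_inv BG CG by blast
  have Bd: "B (d y) = C y" for y unfolding d_def using BG by simp
  have d_eq: "d y = z" if "C y = B z" for y z using that BG unfolding d_def by simp
  have d_u: "d u = u" by (rule d_eq) (simp add: C B w_commute[OF ij])
  have d0: "d (l 0) = l (g (6 * p'))" by (rule d_eq) (simp add: C B)
  have d1: "d (l (g (6 * p))) = l 0" by (rule d_eq) (simp add: C B)
  obtain s r where sr: "s = 1 \<or> s = 2 \<or> s = 4" "\<And>m. d (l m) = l (s * m + r)"
    using stabilizer_affine[OF dG d_u fr] by blast
  have r: "r mod 7 = g (6 * p') mod 7" using sr(2)[of 0] d0 by (simp add: l_eq)
  have dl: "d (l m) = l (s * m + g (6 * p'))" for m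
    unfolding sr(2) l_eq by (rule mod_add_cong[OF refl r])
  have "(s * g (6 * p) + g (6 * p')) mod 7 = 0" using d1 unfolding dl l_eq by simp
  moreover have "\<forall>m. A i (A p (l m)) = A j (A p' (l (s * m + g (6 * p'))))"
    using Bd[of "l _"] unfolding dl B_def C_def by simp
  moreover have "A i (A p y) = A j (A p' (d' y))"
    if d': "d' \<in> G" "d' u = u" "\<forall>m. d' (l m) = l (s * m + g (6 * p'))" for d' y
  proof -
    have "d y = d' y" by (rule G_eqI[OF dG d'(1) fr]) (simp_all add: d_u dl d')
    then show ?thesis using Bd[of y] unfolding B_def C_def by simp
  qed
  then have "\<forall>d'\<in>G. d' u = u \<longrightarrow> (\<forall>m. d' (l m) = l (s * m + g (6 * p'))) \<longrightarrow> (\<forall>y. A i (A p y) = A j (A p' (d' y)))"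
    by (intro ballI impI allI)
  ultimately show ?thesis using sr(1) by (intro exI[of _ s] conjI)
qed

text \<open>This is the last corner, as seen from \<open>l i\<close>, of the would-be cube on the
  neighbours \<open>l i\<close>, \<open>l j\<close>, \<open>l m\<close> of \<open>u\<close>.\<close>

definition x :: "nat \<Rightarrow> nat \<Rightarrow> nat \<Rightarrow> 'a" where "x i j m = opp (l i) (w i j) (w i m)"

lemma x_A:
  assumes "i mod 7 \<noteq> j mod 7" "i mod 7 \<noteq> m mod 7" "j mod 7 \<noteq> m mod 7"
  shows "x i j m = A i (A (g (j + 6 * i)) (l (g (g (m + 6 * i) + 6 * g (j + 6 * i)))))"
proof -
  let ?p = "g (j + 6 * i)" and ?q = "g (m + 6 * i)"
  have pq: "?p mod 7 \<noteq> ?q mod 7"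
  proof
    assume "?p mod 7 = ?q mod 7"
    then have "g ?p = g ?q" by (rule g_cong)
    then have "(i * 6 + j) mod 7 = (i * 6 + m) mod 7" unfolding g_g by (simp add: algebra_simps)
    then show False using assms(3) unfolding add_mod_cancel by simp
  qed
  have "A ?p (l (g (?q + 6 * ?p))) = opp u (l ?p) (l ?q)" using A_g[OF pq] by (simp add: w_def)
  then show ?thesis using A_opp[OF l_E l_E l_neq[OF pq]] A_g assms by (simp add: x_def)
qed

lemma x_commute:
  assumes "i mod 7 \<noteq> j mod 7" "i mod 7 \<noteq> m mod 7" "j mod 7 \<noteq> m mod 7"
  shows "x i j m = x i m j"
  unfolding x_def
  by (rule opp_commute[OF w_props(1)[OF assms(1)] w_props(1)[OF assms(2)]]) (use w_inj assms in blast)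

lemma x_adj:
  assumes "i mod 7 \<noteq> j mod 7" "i mod 7 \<noteq> m mod 7" "j mod 7 \<noteq> m mod 7"
  shows "E (x i j m) (w i j)"
  unfolding x_def
  by (rule opp(4)[OF w_props(1)[OF assms(1)] w_props(1)[OF assms(2)]]) (use w_inj assms in blast)

text \<open>By \<open>x_A\<close> both corners are values of the two transports compared in
  \<open>A_A\<close>, and \<open>hol\<close> says that the affine map matches their labels. Rotation
  invariance lets \<open>hol\<close> use labels relative to \<open>i\<close>, which is what
  \<open>e1\<close> and \<open>e2\<close> compute.\<close>

lemma x_hol:
  assumes ij: "i mod 7 \<noteq> j mod 7" and im: "i mod 7 \<noteq> m mod 7" "j mod 7 \<noteq> m mod 7"
    and n: "i mod 7 \<noteq> n mod 7" "j mod 7 \<noteq> n mod 7"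
    and h: "hol g ((j + 6 * i) mod 7) ((m + 6 * i) mod 7) ((n + 6 * i) mod 7)"
  shows "x i j m = x j i n"
proof -
  let ?p = "g (j + 6 * i)" and ?p' = "g (i + 6 * j)" and ?q = "g (m + 6 * i)"
  from A_A[OF ij] obtain s where s: "s = 1 \<or> s = 2 \<or> s = 4" "(s * g (6 * ?p) + g (6 * ?p')) mod 7 = 0"
    "\<forall>m. A i (A ?p (l m)) = A j (A ?p' (l (s * m + g (6 * ?p'))))"
    by (elim exE conjE)
  have e1: "(6 * ((j + 6 * i) mod 7)) mod 7 = (i + 6 * j) mod 7"
  proof -
    have "6 * (j + 6 * i) = (i + 6 * j) + 7 * (5 * i)" by simp
    moreover have "(6 * ((j + 6 * i) mod 7)) mod 7 = (6 * (j + 6 * i)) mod 7" by (rule mod_mult_right_eq)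
    ultimately show ?thesis by (simp only: mod_mult_self2)
  qed
  have e2: "((n + 6 * i) mod 7 + 6 * ((j + 6 * i) mod 7)) mod 7 = (n + 6 * j) mod 7"
  proof -
    have "(n + 6 * i) + 6 * (j + 6 * i) = (n + 6 * j) + 7 * (6 * i)" by simp
    moreover have "((n + 6 * i) mod 7 + 6 * ((j + 6 * i) mod 7)) mod 7 = ((n + 6 * i) + 6 * (j + 6 * i)) mod 7"
      by (rule mod_add_cong[OF mod_mod_trivial mod_mult_right_eq])
    ultimately show ?thesis by (simp only: mod_mult_self2)
  qed
  have "(s * g (?q + 6 * ?p) + g (6 * ?p')) mod 7 = g (g (n + 6 * j) + 6 * ?p') mod 7"
    using h s(1,2) g_lt unfolding hol_def e1 e2 by (simp add: g_mod, auto simp: g_mod)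
  then have "l (s * g (?q + 6 * ?p) + g (6 * ?p')) = l (g (g (n + 6 * j) + 6 * ?p'))"
    unfolding l_eq .
  then show ?thesis
    unfolding x_A[OF ij im] x_A[OF ij[symmetric] n(2,1)] s(3)[rule_format] by simp
qed

text \<open>The hypothesis treats label difference 1. The automorphism doubling labels spreads this
  to the differences 2 and 4, and exchanging \<open>i\<close> and \<open>j\<close> to their
  negatives. Since -1 is not a square mod 7, these are all nonzero differences, so every cube
  closes.\<close>

lemma not_cube_ok: "\<not> cube_ok g"
proof
  assume ok: "cube_ok g"
  have x_eq1: "x i j m = x j i m" if ne: "i mod 7 \<noteq> j mod 7" "i mod 7 \<noteq> m mod 7" "j mod 7 \<noteq> m mod 7"
    and 1: "(j + 6 * i) mod 7 = 1" for i j m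
  proof (rule x_hol[OF ne ne(2,3)])
    let ?m = "(m + 6 * i) mod 7"
    have "?m \<noteq> 0" unfolding diff_zero_iff using ne by auto
    moreover have "1 \<noteq> ?m" unfolding 1[symmetric] using ne(3) add_mod_cancel[of "6 * i" j 7 m] by (simp add: add.commute)
    moreover have lt: "?m < 7" by simp
    ultimately have "?m \<in> {2, 3, 4, 5, 6}" using lt7_cases[OF lt] by fastforce
    then show "hol g ((j + 6 * i) mod 7) ?m ?m" using ok unfolding cube_ok_def 1 by blast
  qed
  obtain b where b: "b \<in> G" "b u = u" "\<And>i. b (l i) = l (2 * i)"
    using qr_frame_transport[OF fr qr_frame_double[OF fr]] by blast
  have bw: "b (w i j) = w (2 * i) (2 * j)" if "i mod 7 \<noteq> j mod 7" for i j
    unfolding w_def using opp_G[OF b(1) l_E l_E l_neq[OF that]] b(2,3) by simp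
  have bx: "b (x i j m) = x (2 * i) (2 * j) (2 * m)"
    if ne: "i mod 7 \<noteq> j mod 7" "i mod 7 \<noteq> m mod 7" "j mod 7 \<noteq> m mod 7" for i j m
  proof -
    have "w i j \<noteq> w i m" using w_inj ne by blast
    from opp_G[OF b(1) w_props(1)[OF ne(1)] w_props(1)[OF ne(2)] this]
    show ?thesis unfolding x_def bw[OF ne(1)] bw[OF ne(2)] b(3) .
  qed
  have dbl: "x (2 * i) (2 * j) (2 * m) = x (2 * j) (2 * i) (2 * m)"
    if ne: "i mod 7 \<noteq> j mod 7" "i mod 7 \<noteq> m mod 7" "j mod 7 \<noteq> m mod 7" and e: "x i j m = x j i m" for i j m
    using bx[OF ne] bx[OF ne(1)[symmetric] ne(3,2)] e by simp
  have x_cong: "x i j m = x i' j' m'" if "i mod 7 = i' mod 7" "j mod 7 = j' mod 7" "m mod 7 = m' mod 7" for i j m i' j' m'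
  proof -
    have "l i = l i'" using that(1) l_eq by blast
    then show ?thesis unfolding x_def w_cong[OF that(1,2)] w_cong[OF that(1,3)] by simp
  qed
  have m8: "(2 * (4 * q)) mod 7 = q mod 7" "(2 * (2 * (2 * q))) mod 7 = q mod 7" for q :: nat
  proof -
    have "2 * (4 * q) = q + 7 * q" "2 * (2 * (2 * q)) = q + 7 * q" by simp_all
    then show "(2 * (4 * q)) mod 7 = q mod 7" "(2 * (2 * (2 * q))) mod 7 = q mod 7" by (simp_all only: mod_mult_self2)
  qed
  have n2: "(2 * i) mod 7 \<noteq> (2 * j) mod 7" "(4 * i) mod 7 \<noteq> (4 * j) mod 7" if "i mod 7 \<noteq> j mod 7" for i j :: nat
  proof -
    have 1: "(2 * i) mod 7 \<noteq> (2 * j) mod 7" if "i mod 7 \<noteq> j mod 7" for i j :: nat using that double_mod_7 by simp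
    have "4 * i = 2 * (2 * i)" "4 * j = 2 * (2 * j)" by simp_all
    then show "(2 * i) mod 7 \<noteq> (2 * j) mod 7" "(4 * i) mod 7 \<noteq> (4 * j) mod 7" using 1[OF that] 1[OF 1[OF that]] by simp_all
  qed
  have x_eq124: "x i j m = x j i m" if ne: "i mod 7 \<noteq> j mod 7" "i mod 7 \<noteq> m mod 7" "j mod 7 \<noteq> m mod 7"
    and d: "(j + 6 * i) mod 7 = 1 \<or> (j + 6 * i) mod 7 = 2 \<or> (j + 6 * i) mod 7 = 4" for i j m
    using d
  proof (elim disjE)
    assume "(j + 6 * i) mod 7 = 1"
    then show ?thesis using x_eq1[OF ne] by blast
  next
    assume d: "(j + 6 * i) mod 7 = 2"
    have "(4 * j + 6 * (4 * i)) mod 7 = (4 * ((j + 6 * i) mod 7)) mod 7" by (simp add: mod_mult_right_eq algebra_simps)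
    then have "(4 * j + 6 * (4 * i)) mod 7 = 1" unfolding d by simp
    then have "x (4 * i) (4 * j) (4 * m) = x (4 * j) (4 * i) (4 * m)"
      using x_eq1 n2(2)[OF ne(1)] n2(2)[OF ne(2)] n2(2)[OF ne(3)] by blast
    then have "x (2 * (4 * i)) (2 * (4 * j)) (2 * (4 * m)) = x (2 * (4 * j)) (2 * (4 * i)) (2 * (4 * m))"
      using dbl n2(2)[OF ne(1)] n2(2)[OF ne(2)] n2(2)[OF ne(3)] by blast
    then show ?thesis using x_cong[OF m8(1)[of i] m8(1)[of j] m8(1)[of m]] x_cong[OF m8(1)[of j] m8(1)[of i] m8(1)[of m]] by simp
  next
    assume d: "(j + 6 * i) mod 7 = 4"
    have "(2 * j + 6 * (2 * i)) mod 7 = (2 * ((j + 6 * i) mod 7)) mod 7" by (simp add: mod_mult_right_eq algebra_simps)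
    then have 1: "(2 * j + 6 * (2 * i)) mod 7 = 1" unfolding d by simp
    note n = n2(1)[OF ne(1)] n2(1)[OF ne(2)] n2(1)[OF ne(3)]
    note nn = n2(1)[OF n(1)] n2(1)[OF n(2)] n2(1)[OF n(3)]
    have "x (2 * (2 * (2 * i))) (2 * (2 * (2 * j))) (2 * (2 * (2 * m))) = x (2 * (2 * (2 * j))) (2 * (2 * (2 * i))) (2 * (2 * (2 * m)))"
      by (rule dbl[OF nn dbl[OF n x_eq1[OF n 1]]])
    then show ?thesis using x_cong[OF m8(2)[of i] m8(2)[of j] m8(2)[of m]] x_cong[OF m8(2)[of j] m8(2)[of i] m8(2)[of m]] by simp
  qed
  have x_eq: "x i j m = x j i m" if ne: "i mod 7 \<noteq> j mod 7" "i mod 7 \<noteq> m mod 7" "j mod 7 \<noteq> m mod 7" for i j m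
  proof -
    let ?d = "(j + 6 * i) mod 7" and ?d' = "(i + 6 * j) mod 7"
    have "?d < 7" by simp
    moreover have "?d \<noteq> 0" unfolding diff_zero_iff using ne by auto
    moreover have "?d' = (6 * ?d) mod 7"
    proof -
      have "6 * (j + 6 * i) = (i + 6 * j) + 7 * (5 * i)" by simp
      then have "(6 * (j + 6 * i)) mod 7 = ?d'" by (simp only: mod_mult_self2)
      then show ?thesis by (simp only: mod_mult_right_eq)
    qed
    moreover have "d = 1 \<or> d = 2 \<or> d = 4 \<or> d' = 1 \<or> d' = 2 \<or> d' = 4"
      if "d < 7" "d \<noteq> 0" "d' = (6 * d) mod 7" for d d' :: nat
      using lt7_cases[OF that(1)] that(2,3) by (elim disjE) simp_all
    ultimately have "?d = 1 \<or> ?d = 2 \<or> ?d = 4 \<or> ?d' = 1 \<or> ?d' = 2 \<or> ?d' = 4" by blast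
    then show ?thesis using x_eq124[OF ne] x_eq124[OF ne(1)[symmetric] ne(3,2)] by metis
  qed
  show False
  proof (rule not_cube_closing)
    fix v p q r assume e: "E v p" "E v q" "E v r" and ne: "p \<noteq> q" "p \<noteq> r" "q \<noteq> r"
    obtain f where f: "f \<in> G" "f u = v" using vt qr_frameD(5)[OF fr] E_V[OF e(1)] by blast
    have "\<exists>i. y = f (l i)" if "E v y" for y
    proof -
      have "E u (inv f y)" using that G_E[OF f(1), of u "inv f y"] f by simp
      then obtain i where "inv f y = l i" using l_ex by blast
      then show ?thesis using f(1) by (metis G_inv_apply(1))
    qed
    then obtain i j m where ijm: "p = f (l i)" "q = f (l j)" "r = f (l m)" using e by metis
    then have d: "i mod 7 \<noteq> j mod 7" "i mod 7 \<noteq> m mod 7" "j mod 7 \<noteq> m mod 7" using ne unfolding ijm G_inj[OF f(1)] l_eq by blast+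
    have fw: "opp v (f (l i)) (f (l j)) = f (w i j)" if "i mod 7 \<noteq> j mod 7" for i j
      unfolding w_def using opp_G[OF f(1) l_E l_E l_neq[OF that]] f(2) by simp
    have fx: "opp (f (l i)) (f (w i j)) (f (w i m)) = f (x i j m)" if "i mod 7 \<noteq> j mod 7" "i mod 7 \<noteq> m mod 7" "j mod 7 \<noteq> m mod 7" for i j m
      unfolding x_def by (rule opp_G[OF f(1) w_props(1)[OF that(1)] w_props(1)[OF that(2)], symmetric]) (use w_inj that in blast)
    have "opp p (opp v p q) (opp v p r) = f (x i j m)" unfolding ijm fw[OF d(1)] fw[OF d(2)] fx[OF d] ..
    moreover have "opp q (opp v p q) (opp v q r) = f (x j i m)"
      unfolding ijm fw[OF d(1)] fw[OF d(3)] w_commute[OF d(1)] fx[OF d(1)[symmetric] d(3,2)] ..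
    ultimately show "opp p (opp v p q) (opp v p r) = opp q (opp v p q) (opp v q r)" using x_eq[OF d] by simp
  qed
qed

text \<open>The two instances of \<open>hol\<close> identify the corner over
  \<open>i, i + 1, i + 2\<close> with the one over \<open>i + 1, i + 2, i + 3\<close>. Hence one
  vertex is adjacent to all \<open>w i (i + 1)\<close> and also to \<open>w 0 2\<close>; these eight
  neighbours already exceed the valency.\<close>

lemma not_long_cycle: "\<not> (hol g 2 1 1 \<and> hol g 6 5 1)"
proof
  assume hh: "hol g 2 1 1 \<and> hol g 6 5 1"
  have ne: "(i + b) mod 7 \<noteq> (i + c) mod 7" if "b < 7" "c < 7" "b \<noteq> c" for i b c :: nat
    using that unfolding add_mod_cancel by simp
  have sub: "(i + b + 6 * (i + c)) mod 7 = (b + 6 * c) mod 7" for i b c :: nat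
  proof -
    have "i + b + 6 * (i + c) = (b + 6 * c) + 7 * i" by simp
    then show ?thesis by (simp only: mod_mult_self2)
  qed
  have step: "x (i + 0) (i + 1) (i + 2) = x (i + 1) (i + 2) (i + 3)" for i
  proof -
    have "x (i + 0) (i + 1) (i + 2) = x (i + 0) (i + 2) (i + 1)" by (rule x_commute; rule ne; simp)
    also have "\<dots> = x (i + 2) (i + 0) (i + 1)"
      by (rule x_hol; (rule ne; simp)?) (use hh in \<open>simp only: sub, simp\<close>)
    also have "\<dots> = x (i + 2) (i + 1) (i + 0)" by (rule x_commute; rule ne; simp)
    also have "\<dots> = x (i + 1) (i + 2) (i + 3)"
      by (rule x_hol; (rule ne; simp)?) (use hh in \<open>simp only: sub, simp\<close>)
    finally show ?thesis .
  qed
  have const: "x i (i + 1) (i + 2) = x 0 1 2" for i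
  proof (induction i)
    case (Suc i)
    have "x (i + 1) (i + 1 + 1) (i + 1 + 2) = x (i + 1) (i + 2) (i + 3)" by (simp add: numeral_2_eq_2 numeral_3_eq_3)
    then show ?case using step[of i] Suc by simp
  qed (simp add: numeral_2_eq_2)
  let ?X = "x 0 1 2"
  have e1: "E ?X (w i (i + 1))" for i
  proof -
    have "E (x (i + 0) (i + 1) (i + 2)) (w (i + 0) (i + 1))" by (rule x_adj; rule ne; simp)
    then show ?thesis using const[of i] by simp
  qed
  have e2: "E ?X (w 0 2)"
    using x_adj[of 0 2 1] x_commute[of 0 1 2] by simp
  have wn: "{i mod 7, j mod 7} = {i' mod 7, j' mod 7}"
    if "i mod 7 \<noteq> j mod 7" "i' mod 7 \<noteq> j' mod 7" "w i j = w i' j'" for i j i' j'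
  proof -
    have "D u (w i j)" unfolding w_def by (rule D_opp[OF l_E l_E l_neq[OF that(1)]])
    then have "card {z. E u z \<and> E (w i j) z} = 2" using card_common_D c2_2 by simp
    moreover have "{l i, l j} \<subseteq> {z. E u z \<and> E (w i j) z}" "{l i', l j'} \<subseteq> {z. E u z \<and> E (w i j) z}"
      using l_E w_props(4,5)[OF that(1)] w_props(4,5)[OF that(2)] that(3) by auto
    moreover have "card {l i, l j} = 2" "card {l i', l j'} = 2" using l_neq that by auto
    ultimately have "{l i, l j} = {z. E u z \<and> E (w i j) z}" "{l i', l j'} = {z. E u z \<and> E (w i j) z}"
      by (metis card_subset_eq fin_sub(1))+
    then have "{l i, l j} = {l i', l j'}" by simp
    then show ?thesis unfolding doubleton_eq_iff l_eq .
  qed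
  have "w a b \<noteq> w c d" if "a < 7" "b < 7" "c < 7" "d < 7" "a \<noteq> b" "c \<noteq> d" "{a, b} \<noteq> {c, d}" for a b c d
    using wn[of a b c d] that by auto
  then have "card {w 0 1, w 1 2, w 2 3, w 3 4, w 4 5, w 5 6, w 6 0, w 0 2} = 8"
    by (simp add: doubleton_eq_iff)
  moreover have "w 6 7 = w 6 0" by (rule w_cong) simp_all
  then have "{w 0 1, w 1 2, w 2 3, w 3 4, w 4 5, w 5 6, w 6 0, w 0 2} \<subseteq> N ?X"
    using e1[of 0] e1[of 1] e1[of 2] e1[of 3] e1[of 4] e1[of 5] e1[of 6] e2 by (simp add: eval_nat_numeral)
  ultimately have "8 \<le> card (N ?X)" by (metis card_mono fin_N)
  then show False using card_N7[OF E_V(1)[OF e2]] by simp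
qed

end

text \<open>Coset enumeration (Todd and Coxeter) over the cyclic subgroup generated by \<open>A\<close>: the relators say
  that \<open>A\<^sup>j C\<^sup>-\<^sup>e\<close> is an involution whenever \<open>j e = 1\<close> mod 7, as in \<open>PSL(2,7)\<close>. Each
  equation fills the only gap in a relator cycle.\<close>

lemma two_generator_orbit:
  fixes A C :: "'b \<Rightarrow> 'b"
  assumes inj: "inj A" "inj C" and A_fix: "A p0 = p0"
    and A7: "\<And>x. (A ^^ 7) x = x" and C7: "\<And>x. (C ^^ 7) x = x"
    and rel: "\<And>j e x. (j, e) \<in> {(1, 1), (2, 4), (3, 5), (4, 2), (5, 3), (6, 6)} \<Longrightarrow>
      (C ^^ (7 - e)) ((A ^^ j) ((C ^^ (7 - e)) ((A ^^ j) x))) = x"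
  shows "\<exists>S. p0 \<in> S \<and> A ` S \<subseteq> S \<and> C ` S \<subseteq> S \<and> finite S \<and> card S \<le> 24"
proof -
  \<comment> \<open>\<open>True\<close> stands for \<open>C\<close> and \<open>False\<close> for
    \<open>A\<close>, and \<open>fold\<close> applies the leftmost letter first.\<close>
  define run where "run = fold (\<lambda>b. if b then C else A)"
  have inj_run: "inj (run w)" for w
  proof (induction w)
    case (Cons b w)
    have eq: "run (b # w) = run w \<circ> (if b then C else A)" unfolding run_def by simp
    have "inj (if b then C else A)" using inj by simp
    then show ?case unfolding eq by (rule inj_compose[OF Cons])
  qed (simp add: run_def)
  \<comment> \<open>Every rotation of a relator is again a relator. The rotations used below start a
    cycle just after its gap, so that the unknown edge comes last.\<close>
  have rot: "run (drop n w @ take n w) x = x" if w: "\<And>x. run w x = x" for n w x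
  proof -
    let ?u = "take n w" and ?v = "drop n w"
    have "run ?v (run ?u y) = y" for y using w[of y] unfolding run_def by (metis append_take_drop_id comp_apply fold_append)
    then have "run ?v (run ?u (run ?v x)) = run ?v x" .
    then have "run ?u (run ?v x) = x" using injD[OF inj_run] by blast
    then show ?thesis unfolding run_def by simp
  qed
  have relators:
    "run [False, False, False, False, False, False, False] x = x"
    "run [True, True, True, True, True, True, True] x = x"
    "run [False, True, True, True, True, True, True, False, True, True, True, True, True, True] x = x"
    "run [False, False, True, True, True, False, False, True, True, True] x = x"
    "run [False, False, False, True, True, False, False, False, True, True] x = x"
    "run [False, False, False, False, True, True, True, True, True, False, False, False, False, True, True, True, True, True] x = x"
    "run [False, False, False, False, False, True, True, True, True, False, False, False, False, False, True, True, True, True] x = x"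
    "run [False, False, False, False, False, False, True, False, False, False, False, False, False, True] x = x" for x
    using A7[of x] C7[of x] rel[of 1 1 x] rel[of 2 4 x] rel[of 3 5 x] rel[of 4 2 x] rel[of 5 3 x] rel[of 6 6 x]
    by (simp_all add: run_def eval_nat_numeral)
  \<comment> \<open>\<open>edges\<close> accumulates the coset table. The 24 rows match the index
    168 / 7 of a cyclic subgroup of order 7 in \<open>PSL(2,7)\<close>; the points need not be
    distinct.\<close>
  note edges = A_fix
  define p1 where "p1 = C p0"
  note edges = edges p1_def[symmetric]
  define p2 where "p2 = C p1"
  note edges = edges p2_def[symmetric]
  define p3 where "p3 = A p1"
  note edges = edges p3_def[symmetric]
  define p4 where "p4 = C p3"
  note edges = edges p4_def[symmetric]
  define p5 where "p5 = A p2"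
  note edges = edges p5_def[symmetric]
  define p6 where "p6 = C p4"
  note edges = edges p6_def[symmetric]
  define p7 where "p7 = C p5"
  note edges = edges p7_def[symmetric]
  define p8 where "p8 = A p5"
  note edges = edges p8_def[symmetric]
  define p9 where "p9 = C p8"
  note edges = edges p9_def[symmetric]
  define p10 where "p10 = C p2"
  note edges = edges p10_def[symmetric]
  define p11 where "p11 = A p10"
  note edges = edges p11_def[symmetric]
  define p12 where "p12 = A p11"
  note edges = edges p12_def[symmetric]
  define p13 where "p13 = C p12"
  note edges = edges p13_def[symmetric]
  define p14 where "p14 = C p6"
  note edges = edges p14_def[symmetric]
  define p15 where "p15 = A p3"
  note edges = edges p15_def[symmetric]
  define p16 where "p16 = A p13"
  note edges = edges p16_def[symmetric]
  define p17 where "p17 = C p16"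
  note edges = edges p17_def[symmetric]
  define p18 where "p18 = C p15"
  note edges = edges p18_def[symmetric]
  define p19 where "p19 = A p14"
  note edges = edges p19_def[symmetric]
  define p20 where "p20 = C p13"
  note edges = edges p20_def[symmetric]
  have "C p20 = p0" using rot[OF relators(4), of 0 p0] by (simp add: edges run_def)
  note edges = edges this
  have "A p8 = p13" using rot[OF relators(5), of 8 p13] by (simp add: edges run_def)
  note edges = edges this
  have "C p10 = p12" using rot[OF relators(2), of 4 p12] by (simp add: edges run_def)
  note edges = edges this
  have "A p20 = p1" using rot[OF relators(3), of 8 p1] by (simp add: edges run_def)
  note edges = edges this
  have "A p19 = p10" using rot[OF relators(4), of 7 p10] by (simp add: edges run_def)
  note edges = edges this
  have "C p18 = p19" using rot[OF relators(5), of 5 p19] by (simp add: edges run_def)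
  note edges = edges this
  have "C p17 = p3" using rot[OF relators(6), of 6 p3] by (simp add: edges run_def)
  note edges = edges this
  have "C p19 = p5" using rot[OF relators(4), of 5 p5] by (simp add: edges run_def)
  note edges = edges this
  define p21 where "p21 = A p15"
  note edges = edges p21_def[symmetric]
  have "A p21 = p18" using rot[OF relators(5), of 8 p18] by (simp add: edges run_def)
  note edges = edges this
  define p22 where "p22 = A p18"
  note edges = edges p22_def[symmetric]
  have "A p22 = p20" using rot[OF relators(1), of 6 p20] by (simp add: edges run_def)
  note edges = edges this
  have "C p14 = p22" using rot[OF relators(3), of 7 p22] by (simp add: edges run_def)
  note edges = edges this
  have "C p9 = p15" using rot[OF relators(4), of 4 p15] by (simp add: edges run_def)
  note edges = edges this
  have "A p12 = p9" using rot[OF relators(5), of 3 p9] by (simp add: edges run_def)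
  note edges = edges this
  have "A p4 = p14" using rot[OF relators(8), of 8 p14] by (simp add: edges run_def)
  note edges = edges this
  have "C p21 = p21" using rot[OF relators(8), of 0 p21] by (simp add: edges run_def)
  note edges = edges this
  have "A p9 = p4" using rot[OF relators(8), of 12 p4] by (simp add: edges run_def)
  note edges = edges this
  have "C p7 = p8" using rot[OF relators(2), of 2 p8] by (simp add: edges run_def)
  note edges = edges this
  have "C p22 = p16" using rot[OF relators(2), of 5 p16] by (simp add: edges run_def)
  note edges = edges this
  have "A p17 = p2" using rot[OF relators(3), of 8 p2] by (simp add: edges run_def)
  note edges = edges this
  have "A p7 = p7" using rot[OF relators(3), of 8 p7] by (simp add: edges run_def)
  note edges = edges this
  have "A p6 = p6" using rot[OF relators(3), of 8 p6] by (simp add: edges run_def)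
  note edges = edges this
  have "C p11 = p11" using rot[OF relators(8), of 7 p11] by (simp add: edges run_def)
  note edges = edges this
  define p23 where "p23 = A p16"
  note edges = edges p23_def[symmetric]
  have "A p23 = p17" using rot[OF relators(1), of 6 p17] by (simp add: edges run_def)
  note edges = edges this
  have "C p23 = p23" using rot[OF relators(8), of 7 p23] by (simp add: edges run_def)
  note edges = edges this
  have AS: "A x \<in> {p0, p1, p2, p3, p4, p5, p6, p7, p8, p9, p10, p11, p12, p13, p14, p15, p16, p17, p18, p19, p20, p21, p22, p23} \<and> C x \<in> {p0, p1, p2, p3, p4, p5, p6, p7, p8, p9, p10, p11, p12, p13, p14, p15, p16, p17, p18, p19, p20, p21, p22, p23}"
    if "x \<in> {p0, p1, p2, p3, p4, p5, p6, p7, p8, p9, p10, p11, p12, p13, p14, p15, p16, p17, p18, p19, p20, p21, p22, p23}" for x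
    using that by (elim insertE emptyE) (simp_all add: edges)
  have "card (set [p0, p1, p2, p3, p4, p5, p6, p7, p8, p9, p10, p11, p12, p13, p14, p15, p16, p17, p18, p19, p20, p21, p22, p23]) \<le> 24"
    by (rule order_trans[OF card_length]) simp
  then show ?thesis using AS
    by (intro exI[of _ "{p0, p1, p2, p3, p4, p5, p6, p7, p8, p9, p10, p11, p12, p13, p14, p15, p16, p17, p18, p19, p20, p21, p22, p23}"] conjI image_subsetI) auto
qed

section \<open>The gluings \<open>g i = c / i\<close>\<close>

context framed_tournament
begin

definition c :: "'a \<Rightarrow> 'a" where "c = h \<circ> a \<circ> h"

lemma c_pow: "(c ^^ n) y = h ((a ^^ n) (h y))"
  by (induction n arbitrary: y) (simp_all add: c_def h_h)

lemma a7: "(a ^^ 7) y = y"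
  by (rule G_eqI[OF apow(1) G_id(2) fr, unfolded apow(2,3)]) (simp_all add: l_eq)

lemma a_pow_mod: "(a ^^ n) y = (a ^^ (n mod 7)) y"
proof -
  have "(a ^^ (7 * q)) y = y" for q by (induction q) (simp_all add: funpow_add a7 del: funpow.simps)
  then show ?thesis by (metis comp_apply funpow_add mod_mult_div_eq)
qed

lemma a_pow_cong: "n mod 7 = m mod 7 \<Longrightarrow> (a ^^ n) y = (a ^^ m) y"
  using a_pow_mod[of n y] a_pow_mod[of m y] by simp

lemma c_pow_cong: "n mod 7 = m mod 7 \<Longrightarrow> (c ^^ n) y = (c ^^ m) y"
  unfolding c_pow using a_pow_cong by metis

lemma reciprocal_values:
  assumes "q \<in> {1, 2, 3, 4, 5, 6}" "\<And>i. i \<in> {1, 2, 3, 4, 5, 6} \<Longrightarrow> (g i * i) mod 7 = q"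
  shows "g 1 = (q * 1) mod 7" "g 2 = (q * 4) mod 7" "g 3 = (q * 5) mod 7" "g 4 = (q * 2) mod 7" "g 5 = (q * 3) mod 7" "g 6 = (q * 6) mod 7"
proof -
  note g = assms(2)
  have r: "x = (q * e) mod 7" if "(x * i) mod 7 = q" "x < 7" "(i * e) mod 7 = 1" for x i e :: nat
  proof -
    have "(q * e) mod 7 = (x * (i * e)) mod 7" unfolding that(1)[symmetric] by (simp add: mod_mult_left_eq mult.assoc)
    also have "\<dots> = (x * ((i * e) mod 7)) mod 7" by (simp only: mod_mult_right_eq)
    finally show ?thesis using that(2,3) by simp
  qed
  show "g 1 = (q * 1) mod 7" by (rule r[OF g[of 1] g_lt]) simp_all
  show "g 2 = (q * 4) mod 7" by (rule r[OF g[of 2] g_lt]) simp_all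
  show "g 3 = (q * 5) mod 7" by (rule r[OF g[of 3] g_lt]) simp_all
  show "g 4 = (q * 2) mod 7" by (rule r[OF g[of 4] g_lt]) simp_all
  show "g 5 = (q * 3) mod 7" by (rule r[OF g[of 5] g_lt]) simp_all
  show "g 6 = (q * 6) mod 7" by (rule r[OF g[of 6] g_lt]) simp_all
qed

text \<open>This is \<open>A_A\<close> for the labels 0 and \<open>j\<close>. For a reciprocal
  \<open>g\<close> the multiplier can only be 1 and the translation part is \<open>j\<close>, so the
  stabilizer element comparing the two transports is \<open>a ^^ j\<close>.\<close>

lemma braid_relation:
  assumes q: "q \<in> {1, 2, 3, 4, 5, 6}" "\<And>i. i \<in> {1, 2, 3, 4, 5, 6} \<Longrightarrow> (g i * i) mod 7 = q"
    and j: "j \<in> {1, 2, 3, 4, 5, 6}"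
  shows "(c ^^ g j) y = (a ^^ j) ((c ^^ g (6 * j)) ((a ^^ j) y))"
proof -
  note v = reciprocal_values[OF q]
  let ?p = "g j" and ?p' = "g (6 * j)"
  have d: "0 mod 7 \<noteq> j mod 7" using j by auto
  have e: "g (6 * ?p') = j \<and> (\<forall>s\<in>{1, 2, 4}. (s * g (6 * ?p) + g (6 * ?p')) mod 7 = 0 \<longrightarrow> s = 1)"
  proof -
    have "g ((6 * g ((6 * j) mod 7)) mod 7) = j \<and> (\<forall>s\<in>{1, 2, 4}. (s * g ((6 * g j) mod 7) + g ((6 * g ((6 * j) mod 7)) mod 7)) mod 7 = 0 \<longrightarrow> s = 1)"
      using q(1) j v by (elim insertE emptyE) simp_all
    from this[unfolded g_mod] show ?thesis .
  qed
  from A_A[OF d] obtain s where s: "s = 1 \<or> s = 2 \<or> s = 4" "(s * g (6 * ?p) + g (6 * ?p')) mod 7 = 0"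
    "\<forall>d\<in>G. d u = u \<longrightarrow> (\<forall>m. d (l m) = l (s * m + g (6 * ?p'))) \<longrightarrow> (\<forall>y. A 0 (A ?p y) = A j (A ?p' (d y)))"
    by (simp only: add_0 mult_0_right add_0_right) (elim exE conjE)
  have "s \<in> {1, 2, 4}" using s(1) by simp
  then have "s = 1" using conjunct2[OF e] s(2) by (metis (no_types, lifting))
  then have "A 0 (A ?p y) = A j (A ?p' ((a ^^ j) y))"
    using s(3) apow e by (simp add: add.commute)
  then show ?thesis by (simp add: A_def c_pow)
qed

text \<open>The bound counts \<open>u\<close>, its 7 neighbours and the 21 vertices at distance
  2.\<close>

lemma card_V: "card V \<ge> 29"
proof -
  have uV: "u \<in> V" using qr_frameD(5)[OF fr] .
  have "k2 * 2 = 42" using k2_c2[unfolded k7 tf c2_2] by simp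
  then have "card {w. D u w} = 21" using card_k2[OF uV] by simp
  moreover have "card (insert u (N u) \<union> {w. D u w}) = card (insert u (N u)) + card {w. D u w}"
  proof (rule card_Un_disjoint)
    show "finite {w. D u w}" by (rule fin_D)
  qed (auto simp: D_def)
  moreover have "card (insert u (N u)) = 8" using card_N7[OF uV] by simp
  moreover have "insert u (N u) \<union> {w. D u w} \<subseteq> V" using uV N_subset D_V by auto
  moreover note card_mono[OF fin calculation(4)]
  ultimately show ?thesis by linarith
qed

definition word :: "('a \<Rightarrow> 'a) \<Rightarrow> bool list \<Rightarrow> 'a \<Rightarrow> 'a" where
  "word f = foldr (\<lambda>b. if b then h else f)"

lemma word_simps [simp]: "word f [] y = y" "word f (True # bs) y = h (word f bs y)" "word f (False # bs) y = f (word f bs y)"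
  "word f (bs @ bs') y = word f bs (word f bs' y)"
  by (simp_all add: word_def)

lemma word_replicate [simp]: "word f (replicate i False) y = (f ^^ i) y"
  by (induction i) simp_all

lemma word_G: "f \<in> G \<Longrightarrow> word f bs \<in> G"
proof (induction bs)
  case Nil
  have "word f [] = id" by (rule ext) simp
  then show ?case by simp
next
  case (Cons b bs)
  have eq: "word f (b # bs) = (if b then h else f) \<circ> word f bs" by (rule ext) (simp add: word_def)
  have "(if b then h else f) \<in> G" using hG Cons.prems by simp
  then show ?case unfolding eq by (rule G_comp[OF _ Cons.IH[OF Cons.prems]])
qed

text \<open>The pairs of values of a word in \<open>a, h\<close> and of the same word in \<open>a\<^sup>-\<^sup>1, h\<close> at \<open>u\<close>
  form a set of at most 48 < 2 |V| points. Hence it is the graph of an automorphism, which reverses the tournament at \<open>u\<close>.\<close>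

lemma not_reciprocal: "\<not> reciprocal g"
proof
  assume "reciprocal g"
  then obtain q where q: "q \<in> {1, 2, 3, 4, 5, 6}" "\<And>i. i \<in> {1, 2, 3, 4, 5, 6} \<Longrightarrow> (g i * i) mod 7 = q"
    unfolding reciprocal_def by blast
  note v = reciprocal_values[OF q]
  define a' where "a' = a ^^ 6"
  have a'_pow: "(a' ^^ n) y = (a ^^ (6 * n)) y" for n y
    unfolding a'_def by (simp add: funpow_mult mult.commute)
  have c7: "(c ^^ 7) y = y" for y unfolding c_pow a7 by (rule h_h)
  have cp: "((c ^^ n) ^^ m) y = (c ^^ (n * m)) y" for n m y by (simp add: funpow_mult mult.commute)
  have rel: "((c ^^ q) ^^ (7 - e)) ((a ^^ j) (((c ^^ q) ^^ (7 - e)) ((a ^^ j) y))) = y"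
    if je: "(j, e) \<in> {(1, 1), (2, 4), (3, 5), (4, 2), (5, 3), (6, 6)}" for j e y
  proof -
    have j: "j \<in> {1, 2, 3, 4, 5, 6}" using je by auto
    have "g j = (q * e) mod 7 \<and> g ((6 * j) mod 7) = (q * (7 - e)) mod 7"
      using je v by (elim insertE emptyE) (simp_all add: mult.commute)
    then have ge: "g j = (q * e) mod 7" "g (6 * j) = (q * (7 - e)) mod 7" by (simp_all add: g_mod)
    have e7: "e \<le> 7" using je by auto
    have 1: "(c ^^ (q * e)) y = (c ^^ g j) y" for y by (rule c_pow_cong) (simp add: ge)
    have 2: "(c ^^ (q * (7 - e))) y = (c ^^ g (6 * j)) y" for y by (rule c_pow_cong) (simp add: ge)
    have "(a ^^ j) (((c ^^ q) ^^ (7 - e)) ((a ^^ j) y)) = (c ^^ (q * e)) y"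
      unfolding cp 1 2 using braid_relation[OF q j] by simp
    then have "((c ^^ q) ^^ (7 - e)) ((a ^^ j) (((c ^^ q) ^^ (7 - e)) ((a ^^ j) y))) = (c ^^ (q * (7 - e))) ((c ^^ (q * e)) y)"
      by (simp add: cp)
    also have "\<dots> = (c ^^ (q * (7 - e) + q * e)) y" by (simp add: funpow_add)
    also have "q * (7 - e) + q * e = 7 * q" using e7 by (simp add: algebra_simps flip: distrib_left)
    also have "(c ^^ (7 * q)) y = (c ^^ 0) y" by (rule c_pow_cong) simp
    finally show ?thesis by simp
  qed
  \<comment> \<open>Passing from \<open>c\<close> to its \<open>q\<close>-th power removes the
    constant: with \<open>e\<close> the inverse of \<open>j\<close> mod 7, \<open>c ^^ g j\<close>
    becomes the \<open>e\<close>-th power of \<open>C\<close>, and the braid relation becomes a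
    relator of \<open>two_generator_orbit\<close>.\<close>
  define C where "C = c ^^ q"
  define C' where "C' = (c ^^ q) ^^ 6"
  have C'_pow: "(C' ^^ n) y = (C ^^ (6 * n)) y" for n y
    unfolding C'_def C_def by (simp add: funpow_mult ac_simps)
  have C_cong: "(C ^^ n) y = (C ^^ m) y" if "n mod 7 = m mod 7" for n m y
  proof -
    have "(q * n) mod 7 = (q * m) mod 7" using mod_mult_cong[OF refl that] .
    then show ?thesis unfolding C_def cp by (rule c_pow_cong)
  qed
  have rel': "(C' ^^ (7 - e)) ((a' ^^ j) ((C' ^^ (7 - e)) ((a' ^^ j) y))) = y"
    if je: "(j, e) \<in> {(1, 1), (2, 4), (3, 5), (4, 2), (5, 3), (6, 6)}" for j e y
  proof -
    \<comment> \<open>The condition that \<open>j * e\<close> is 1 mod 7 is unchanged when both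
      factors change sign, so the inverses of \<open>a\<close> and \<open>C\<close> satisfy the same
      relators.\<close>
    have je': "(7 - j, 7 - e) \<in> {(1, 1), (2, 4), (3, 5), (4, 2), (5, 3), (6, 6)}" using je by auto
    have m: "(6 * (7 - e)) mod 7 = (7 - (7 - e)) mod 7" "(6 * j) mod 7 = (7 - j) mod 7" using je by auto
    have "(C' ^^ (7 - e)) y = (C ^^ (7 - (7 - e))) y" "(a' ^^ j) y = (a ^^ (7 - j)) y" for y
      unfolding C'_pow a'_pow by (rule C_cong[OF m(1)], rule a_pow_cong[OF m(2)])
    then show ?thesis using rel[OF je'] unfolding C_def by simp
  qed
  have cG: "c ^^ n \<in> G" for n
  proof -
    have "c ^^ n = h \<circ> (a ^^ n) \<circ> h" by (rule ext) (simp add: c_pow)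
    then show ?thesis using G_comp hG apow(1) by simp
  qed
  have pow_G: "f ^^ n \<in> G" if f: "f \<in> G" for f n
  proof (induction n)
    case (Suc n)
    show ?case using G_comp[OF f Suc] by (simp only: funpow.simps)
  qed simp
  have C'G: "C' \<in> G" unfolding C'_def using pow_G cG by blast
  have a'G: "a' \<in> G" unfolding a'_def using apow(1) .
  have injG: "inj f" if "f \<in> G" for f using G_bij that bij_is_inj by blast
  let ?A = "map_prod a a'" and ?C = "map_prod C C'" and ?H = "map_prod h h"
  have mp: "(map_prod f f' ^^ n) (y, z) = ((f ^^ n) y, (f' ^^ n) z)" for f f' :: "'a \<Rightarrow> 'a" and n y z
    by (induction n) simp_all
  have a'_u: "a' u = u" unfolding a'_def by (rule apow)
  have "\<exists>S. (u, u) \<in> S \<and> ?A ` S \<subseteq> S \<and> ?C ` S \<subseteq> S \<and> finite S \<and> card S \<le> 24"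
  proof (rule two_generator_orbit)
    show "inj ?A" "inj ?C" using injG aG a'G C'G cG[of q] by (auto simp: C_def intro: prod.inj_map)
    show "?A (u, u) = (u, u)" by (simp add: a_u a'_u)
    show "(?A ^^ 7) x = x" for x
    proof (cases x)
      case (Pair y z)
      have "(a' ^^ 7) z = (a ^^ 0) z" unfolding a'_pow by (rule a_pow_cong) simp
      then show ?thesis using Pair mp a7 by simp
    qed
    show "(?C ^^ 7) x = x" for x
    proof (cases x)
      case (Pair y z)
      have "(C' ^^ 7) z = (C ^^ 0) z" "(C ^^ 7) y = (C ^^ 0) y" unfolding C'_pow by (rule C_cong; simp)+
      then show ?thesis using Pair mp by simp
    qed
    fix j e :: nat and x assume je: "(j, e) \<in> {(1, 1), (2, 4), (3, 5), (4, 2), (5, 3), (6, 6)}"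
    show "(?C ^^ (7 - e)) ((?A ^^ j) ((?C ^^ (7 - e)) ((?A ^^ j) x))) = x"
      using rel[OF je] rel'[OF je] by (cases x) (simp add: mp C_def)
  qed
  then obtain S where S: "(u, u) \<in> S" "?A ` S \<subseteq> S" "?C ` S \<subseteq> S" "finite S" "card S \<le> 24" by blast
  \<comment> \<open>\<open>S\<close> is closed under \<open>a\<close> and \<open>C\<close> but not
    necessarily under \<open>h\<close>. Since conjugation by \<open>h\<close> exchanges
    \<open>a\<close> with \<open>c\<close>, a power of \<open>C\<close>, adding one translate of
    \<open>S\<close> suffices.\<close>
  define X where "X = S \<union> ?H ` S"
  have finX: "finite X" using S(4) by (simp add: X_def)
  have cardX: "card X \<le> 48"
  proof -
    have "card X \<le> card S + card (?H ` S)" unfolding X_def by (rule card_Un_le)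
    also have "card (?H ` S) \<le> card S" using S(4) by (rule card_image_le)
    finally show ?thesis using S(5) by linarith
  qed
  have HX: "?H x \<in> X" if "x \<in> X" for x
  proof (cases "x \<in> S")
    case False
    then have "x \<in> ?H ` S" using \<open>x \<in> X\<close> unfolding X_def by simp
    then obtain s where s: "s \<in> S" "x = ?H s" by (rule imageE)
    then have "?H x = s" by (cases s) (simp add: h_h)
    then show ?thesis using s unfolding X_def by simp
  qed (simp add: X_def)
  \<comment> \<open>The inverse of \<open>q\<close> mod 7 recovers \<open>c\<close> as a power of
    \<open>C\<close>.\<close>
  obtain t where t: "(q * t) mod 7 = 1"
  proof -
    have "\<exists>t. (q * t) mod 7 = 1" using q(1)
      by (elim insertE emptyE) (auto intro: exI[of _ 1] exI[of _ 2] exI[of _ 3] exI[of _ 4] exI[of _ 5] exI[of _ 6])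
    then show ?thesis using that by blast
  qed
  have AX: "?A x \<in> X" if "x \<in> X" for x
  proof (cases "x \<in> S")
    case True
    then have "?A x \<in> S" using S(2) by blast
    then show ?thesis unfolding X_def by simp
  next
    case False
    then have "x \<in> ?H ` S" using \<open>x \<in> X\<close> unfolding X_def by simp
    then obtain yz where yz: "yz \<in> S" "x = ?H yz" by (rule imageE)
    obtain y z where "yz = (y, z)" by (cases yz)
    then have s: "(y, z) \<in> S" "x = (h y, h z)" using yz by simp_all
    have CS: "(?C ^^ n) s \<in> S" if "s \<in> S" for n s using that S(3) by (induction n) auto
    have 1: "(c ^^ 1) y = (C ^^ t) y" unfolding C_def cp by (rule c_pow_cong) (simp add: t)
    have 6: "(c ^^ 6) z = (C' ^^ t) z"
    proof -
      have "(q * (6 * t)) mod 7 = (6 * ((q * t) mod 7)) mod 7" by (simp add: mod_mult_right_eq mult.left_commute)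
      then have "6 mod 7 = (q * (6 * t)) mod 7" unfolding t by simp
      then show ?thesis unfolding C'_pow C_def cp by (rule c_pow_cong)
    qed
    have "?A x = ?H ((c ^^ 1) y, (c ^^ 6) z)" unfolding s(2) a'_def by (simp add: c_pow h_h del: funpow.simps) (simp add: c_def h_h)
    also have "((c ^^ 1) y, (c ^^ 6) z) = (?C ^^ t) (y, z)" unfolding 1 6 mp ..
    finally show ?thesis using CS[OF s(1)] unfolding X_def by blast
  qed
  define B where "B = word a"
  define B' where "B' = word a'"
  define Z where "Z = range (\<lambda>bs. (B bs u, B' bs u))"
  have "(B bs u, B' bs u) \<in> X" for bs
  proof (induction bs)
    case Nil
    show ?case using S(1) by (simp add: B_def B'_def X_def)
  next
    case (Cons b bs)
    then show ?case using AX[OF Cons] HX[OF Cons] by (cases b) (simp_all add: B_def B'_def)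
  qed
  then have ZX: "Z \<subseteq> X" unfolding Z_def by blast
  have cardZ: "card Z \<le> 48" using card_mono[OF finX ZX] cardX by simp
  have finZ: "finite Z" using ZX finX finite_subset by blast
  have BG: "B bs \<in> G" "B' bs \<in> G" for bs unfolding B_def B'_def using word_G aG a'G by blast+
  have B_app: "B (bs @ bs') y = B bs (B bs' y)" "B' (bs @ bs') y = B' bs (B' bs' y)" for bs bs' y
    unfolding B_def B'_def by simp_all
  have B_l: "B (replicate i False @ [True]) u = l i" "B' (replicate i False @ [True]) u = l (6 * i)" for i
    unfolding B_def B'_def by (simp_all add: h_u apow a'_pow)
  have nb: "\<exists>i. z = f (l i)" if f: "f \<in> G" and z: "E (f u) z" for f z
  proof -
    have "E u (inv f z)" using z G_E[OF f, of u "inv f z"] f by simp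
    then obtain i where "inv f z = l i" using l_ex by blast
    then show ?thesis using f by (metis G_inv_apply(1))
  qed
  have uV: "u \<in> V" using qr_frameD(5)[OF fr] .
  have domB: "\<exists>bs. y = B bs u" if "y \<in> V" for y
  proof (rule conn_induct[OF uV _ _ that])
    show "\<exists>bs. u = B bs u" by (rule exI[of _ "[]"]) (simp add: B_def)
    fix y z assume "\<exists>bs. y = B bs u" "E y z"
    then obtain bs i where "z = B bs (l i)" using nb BG by blast
    then show "\<exists>bs. z = B bs u" using B_l(1) B_app(1) by metis
  qed
  have domB': "\<exists>bs. y = B' bs u" if "y \<in> V" for y
  proof (rule conn_induct[OF uV _ _ that])
    show "\<exists>bs. u = B' bs u" by (rule exI[of _ "[]"]) (simp add: B'_def)
    fix y z assume "\<exists>bs. y = B' bs u" "E y z"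
    then obtain bs i where "z = B' bs (l i)" using nb BG by blast
    moreover have "6 * (6 * i) = i + 7 * (5 * i)" by simp
    then have "l (6 * (6 * i)) = l i" unfolding l_eq by (simp only: mod_mult_self2)
    ultimately show "\<exists>bs. z = B' bs u" using B_l(2)[of "6 * i"] B_app(2) by metis
  qed
  have inverse: "\<exists>bs'. \<forall>y. B bs' (B bs y) = y \<and> B' bs' (B' bs y) = y" for bs
  proof (induction bs)
    case Nil
    show ?case by (rule exI[of _ "[]"]) (simp add: B_def B'_def)
  next
    case (Cons b bs)
    then obtain bs' where bs': "B bs' (B bs y) = y" "B' bs' (B' bs y) = y" for y by blast
    have a6: "(a ^^ 6) (a y) = y" "(a' ^^ 6) (a' y) = y" for y
    proof -
      show "(a ^^ 6) (a y) = y" using a7[of y] by (simp add: eval_nat_numeral)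
      have "(a' ^^ 7) y = (a ^^ 0) y" unfolding a'_pow by (rule a_pow_cong) simp
      then show "(a' ^^ 6) (a' y) = y" by (simp add: eval_nat_numeral)
    qed
    show ?case
    proof (cases b)
      case True
      show ?thesis
        by (rule exI[of _ "bs' @ [True]"]) (use True bs' in \<open>simp add: B_def B'_def h_h\<close>)
    next
      case False
      show ?thesis
        by (rule exI[of _ "bs' @ replicate 6 False"]) (use False bs' a6 in \<open>simp add: B_def B'_def del: replicate.simps funpow.simps\<close>)
    qed
  qed
  \<comment> \<open>A word fixing \<open>u\<close> whose mirror image moves \<open>u\<close> could
    be appended to any word, so each of the at least 29 vertices would occur with two partners. That
    makes 58 pairs, more than 48.\<close>
  have B'_fix: "B' bs u = u" if bs: "B bs u = u" for bs
  proof (rule ccontr)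
    assume ne: "B' bs u \<noteq> u"
    have "\<exists>z z'. (y, z) \<in> Z \<and> (y, z') \<in> Z \<and> z \<noteq> z'" if yV: "y \<in> V" for y
    proof -
      obtain bs' where y: "y = B bs' u" using domB[OF yV] by blast
      have "(B bs' u, B' bs' u) \<in> Z" "(B (bs' @ bs) u, B' (bs' @ bs) u) \<in> Z" unfolding Z_def by blast+
      moreover have "B' bs' (B' bs u) \<noteq> B' bs' u" using ne G_inj[OF BG(2)] by blast
      ultimately show ?thesis unfolding y B_app bs by metis
    qed
    then obtain f f' where f: "(y, f y) \<in> Z" "(y, f' y) \<in> Z" "f y \<noteq> f' y" if "y \<in> V" for y by metis
    have "card ((\<lambda>y. (y, f y)) ` V \<union> (\<lambda>y. (y, f' y)) ` V) = card ((\<lambda>y. (y, f y)) ` V) + card ((\<lambda>y. (y, f' y)) ` V)"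
      by (rule card_Un_disjoint) (use fin f in auto)
    also have "\<dots> = 2 * card V" by (simp add: card_image inj_on_def)
    finally have "58 \<le> card ((\<lambda>y. (y, f y)) ` V \<union> (\<lambda>y. (y, f' y)) ` V)" using card_V by simp
    note large = this
    have "(\<lambda>y. (y, f y)) ` V \<union> (\<lambda>y. (y, f' y)) ` V \<subseteq> Z" using f by blast
    from card_mono[OF finZ this] large show False using cardZ by linarith
  qed
  have B_B': "B' bs u = B' bs' u" if e: "B bs u = B bs' u" for bs bs'
  proof -
    obtain cs where cs: "\<forall>y. B cs (B bs y) = y \<and> B' cs (B' bs y) = y" using inverse by blast
    then have "B (cs @ bs') u = u" unfolding B_app e[symmetric] by blast
    then have "B' cs (B' bs' u) = B' cs (B' bs u)" using B'_fix[of "cs @ bs'"] cs unfolding B_app by simp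
    then show ?thesis using G_inj[OF BG(2)] by simp
  qed
  define th where "th = (\<lambda>y. if y \<in> V then B' (SOME bs. B bs u = y) u else y)"
  have th: "th (B bs u) = B' bs u" for bs
  proof -
    have "B (SOME bs'. B bs' u = B bs u) u = B bs u" by (rule someI) simp
    from B_B'[OF this] show ?thesis using uV BG(1)[of bs] by (simp add: th_def)
  qed
  have th_B: "th (B bs (l i)) = B' bs (l (6 * i))" for bs i
    using th[of "bs @ replicate i False @ [True]"] unfolding B_app(1)[of bs] B_app(2)[of bs] B_l .
  have img: "th ` V = V"
  proof
    show "th ` V \<subseteq> V" using domB th BG uV by fastforce
    show "V \<subseteq> th ` V"
    proof
      fix y assume "y \<in> V"
      then obtain bs where "y = th (B bs u)" using domB' th by metis
      then show "y \<in> th ` V" using BG uV by simp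
    qed
  qed
  have "th \<in> G"
  proof (rule G_I)
    have "inj_on th V" using img fin by (simp add: eq_card_imp_inj_on)
    then show "bij th" using img by (intro bij_betw_imp_bij) (auto simp: bij_betw_def th_def)
    show "th y = y" if "y \<notin> V" for y using that by (simp add: th_def)
    fix y z assume e: "E y z"
    obtain bs where bs: "y = B bs u" using domB E_V[OF e] by blast
    then obtain i where i: "z = B bs (l i)" using nb[OF BG(1)] e by blast
    show "E (th y) (th z)" unfolding bs i th th_B using l_E BG(2) by simp
  qed
  moreover have "th u = u" "th (l i) = l (6 * i)" for i
    using th[of "[]"] th_B[of "[]" i] by (simp_all add: B_def B'_def)
  ultimately have "T u (l (6 * 0)) (l (6 * 1)) \<longleftrightarrow> T u (l 0) (l 1)" using T_G by metis
  moreover have "T u (l 0) (l 1)" using qr_frameD(3)[OF fr] by simp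
  \<comment> \<open>The label 6, which is -1, is not among the squares 1, 2, 4, so
    \<open>T u (l 0) (l 6)\<close> fails.\<close>
  ultimately show False using qr_frameD(3)[OF fr, of 0] by (simp add: l_eq)
qed

lemma contradiction: False
  using g_classification not_cube_ok not_long_cycle not_reciprocal by blast

end

context tournament
begin

text \<open>Transport of frames gives some \<open>h\<close> exchanging \<open>u\<close> and
  \<open>l 0\<close>. Its square fixes both ends of the edge, so it multiplies labels by
  \<open>s\<close> in {1, 2, 4} and its third power is the identity. The cube of \<open>h\<close> is
  then an involution that still reverses the edge.\<close>

lemma framed_tournament_ex: "\<exists>u l h a. framed_tournament V E k p0 x0 y0 u l h a"
proof -
  obtain u where u: "u \<in> V" using V_nonempty by blast
  obtain l where l: "qr_frame u l" using qr_frame_ex[OF u] by blast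
  note lD = qr_frameD[OF l]
  obtain a where a: "a \<in> G" "a u = u" "\<And>i. a (l i) = l (i + 1)"
    using qr_frame_transport[OF l qr_frame_shift[OF l, of 1]] by blast
  have vV: "l 0 \<in> V" using E_V lD(4) by blast
  obtain f where f: "qr_frame (l 0) f" using qr_frame_ex[OF vV] by blast
  obtain c where c: "u = f c"
    using qr_frameD(2)[OF f] E_sym[OF lD(4)[of 0]] by (metis in_N rangeE)
  obtain h where h: "h \<in> G" "h u = l 0" "\<And>i. h (l i) = f (i + c)"
    using qr_frame_transport[OF l qr_frame_shift[OF f, of c]] by blast
  have hv: "h (l 0) = u" using h(3)[of 0] c by simp
  define d where "d = h \<circ> h"
  have d: "d \<in> G" "d u = u" "d (l 0) = l 0" using G_comp h hv by (auto simp: d_def)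
  obtain s r where sr: "s = 1 \<or> s = 2 \<or> s = 4" "\<And>m. d (l m) = l (s * m + r)"
    using stabilizer_affine[OF d(1,2) l] by blast
  have r: "r mod 7 = 0" using sr(2)[of 0] d(3) by (simp add: lD(1))
  have dl: "d (l m) = l (s * m)" for m
  proof -
    have "(s * m + r) mod 7 = (s * m + r mod 7) mod 7" by (rule mod_add_right_eq[symmetric])
    then have "(s * m + r) mod 7 = (s * m) mod 7" unfolding r by simp
    then show ?thesis unfolding sr(2) lD(1) .
  qed
  have ddd: "d (d (d y)) = y" for y
  proof -
    have "(d \<circ> d \<circ> d) y = id y"
    proof (rule G_eqI[OF _ G_id(1) l])
      show "d \<circ> d \<circ> d \<in> G" using G_comp d(1) by blast
      \<comment> \<open>The cubes of 1, 2, 4 are 1, 1 + 7 and 1 + 7 * 9, which explains the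
        coefficients 0, 1 and 9.\<close>
      have e: "s * (s * (s * i)) = i + 7 * (if s = 1 then 0 else if s = 2 then i else 9 * i)" for i using sr(1) by auto
      show "(d \<circ> d \<circ> d) (l i) = id (l i)" for i unfolding comp_apply dl id_apply lD(1) e by (rule mod_mult_self2)
    qed (simp add: d(2))
    then show ?thesis by simp
  qed
  have "framed_tournament V E k p0 x0 y0 u l (h \<circ> h \<circ> h) a"
  proof unfold_locales
    show "h \<circ> h \<circ> h \<in> G" using G_comp h(1) by blast
    show "(h \<circ> h \<circ> h) ((h \<circ> h \<circ> h) x) = x" for x using ddd[of x] by (simp add: d_def)
  qed (simp_all add: l a h(2) hv)
  then show ?thesis by blast
qed

lemma no_tournament: False
  using framed_tournament_ex by (elim exE) (erule framed_tournament.contradiction)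

end

lemma (in tfree_graph) no_tfree: False
proof -
  obtain v x y where vxy: "E v x" "E v y" "x \<noteq> y" "\<not> orb v x y v y x" by (rule two_arc_orbit)
  then have "tournament V E k v x y" by unfold_locales
  then show False by (rule tournament.no_tournament)
qed

theorem theorem1p4:
  fixes V :: "'a set" and E :: "'a \<Rightarrow> 'a \<Rightarrow> bool" and k :: nat
  assumes "finite V"
    and "simple_graph V E"
    and "connected_graph V E"
    and "regular_of_valency V E k"
    and "k \<le> 8"
    and "two_distance_transitive V E"
    and "locally_primitive V E"
  shows "two_arc_transitive V E \<or> isomorphic_to_icosahedron V E"
proof (rule ccontr)
  assume n: "\<not> ?thesis"
  interpret dt_graph V E k by unfold_locales (use assms in blast)+
  have "a1 = 0" using triangle_imp_icosahedron assms(5) n by blast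
  then have "tfree_graph V E k" by unfold_locales (use n assms(5) in blast)+
  then show False by (rule tfree_graph.no_tfree)
qed

end
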